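(* Let $2\le k\le n$ and $\mathbf{s}=(n-k+2,n-k+3,\dots,n)\in\mathbb{Z}_{>0}^{k-1}$. Then $\widetilde{E}^{\mathbf{s}}_{k-1}(x)=H_{U_{k,n}}(x)$. Consequently (using that every $\widetilde{E}^{\mathbf{s}}_m(x)$ is real-rooted), $H_{U_{k,n}}(x)$ has only real roots for every $1\le k\le n$.
   Context: For $\mathbf{s}=(s_1,\dots,s_m)\in\mathbb{Z}_{>0}^m$ let $\mathcal{I}^{\mathbf{s}}_m=\{\mathbf{e}=(e_1,\dots,e_m)\in\mathbb{Z}^m:0\le e_i<s_i\}$, with conventions $e_0=e_{m+1}=0$, $s_0=s_{m+1}=1$. An index $i\in\{0,\dots,m\}$ is an ascent of $\mathbf{e}$ if $e_i/s_i<e_{i+1}/s_{i+1}$ and a collision if $e_i/s_i=e_{i+1}/s_{i+1}$; $\mathrm{asc}(\mathbf{e})$, $\mathrm{col}(\mathbf{e})$ count them. Define $\widetilde{E}^{\mathbf{s}}_m(x)=\sum_{\mathbf{e}\in\mathcal{I}^{\mathbf{s}}_m}(1+x)^{\mathrm{col}(\mathbf{e})}x^{\mathrm{asc}(\mathbf{e})}$ (Haglund–Zhang have shown these are real-rooted). $U_{k,n}$ is the uniform matroid of rank $k$ on $[n]$. Augmented Chow ring: for a loopless matroid $M$ on $E$ with lattice of flats $\mathcal{L}(M)$, $\mathrm{CH}(M)=\mathbb{Q}[x_F,y_i: F\in\mathcal{L}(M)\setminus\{E\},\, i\in E]/(I'+J')$, $I'$ generated by $y_i-\sum_{F\not\ni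 i}x_F$, $J'$ by $x_{F_1}x_{F_2}$ for incomparable $F_1,F_2$ and $y_ix_F$ for $i\notin F$; variables of degree $1$; $H_M(x)=\sum_j\dim_{\mathbb{Q}}\mathrm{CH}^j(M)x^j$. *)

theory Defs
  imports "HOL-Library.Poly_Mapping" "HOL-Computational_Algebra.Computational_Algebra"
begin

text \<open>s is a list (s_1,...,s_m); index i of the paper is list position i-1.
  Extended sequences with e_0 = e_{m+1} = 0 and s_0 = s_{m+1} = 1.\<close>

definition ext_e :: "nat list \<Rightarrow> nat \<Rightarrow> nat" where
  "ext_e e i = (if 1 \<le> i \<and> i \<le> length e then e ! (i - 1) else 0)"

definition ext_s :: "nat list \<Rightarrow> nat \<Rightarrow> nat" where
  "ext_s s i = (if 1 \<le> i \<and> i \<le> length s then s ! (i - 1) else 1)"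

definition ratio :: "nat list \<Rightarrow> nat list \<Rightarrow> nat \<Rightarrow> rat" where
  "ratio s e i = of_nat (ext_e e i) / of_nat (ext_s s i)"

definition asc :: "nat list \<Rightarrow> nat list \<Rightarrow> nat" where
  "asc s e = card {i \<in> {0..length s}. ratio s e i < ratio s e (i + 1)}"

definition col :: "nat list \<Rightarrow> nat list \<Rightarrow> nat" where
  "col s e = card {i \<in> {0..length s}. ratio s e i = ratio s e (i + 1)}"

definition inversion_seqs :: "nat list \<Rightarrow> nat list set" where
  "inversion_seqs s = {e. length e = length s \<and> (\<forall>i < length s. e ! i < s ! i)}"

definition E_tilde :: "nat list \<Rightarrow> real poly" where
  "E_tilde s = (\<Sum>e \<in> inversion_seqs s. [:1, 1:] ^ col s e * monom 1 (asc s e))"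

definition flats :: "'a set \<Rightarrow> ('a set \<Rightarrow> nat) \<Rightarrow> 'a set set" where
  "flats E r = {A. A \<subseteq> E \<and> (\<forall>e \<in> E - A. r A < r (insert e A))}"

definition uniform_rank :: "nat \<Rightarrow> nat set \<Rightarrow> nat" where
  "uniform_rank k A = min (card A) k"

definition uniform_ground :: "nat \<Rightarrow> nat set" where
  "uniform_ground n = {1..n}"

text \<open>Variables: Inl F stands for x_F, Inr i for y_i. Polynomials over Q in these variables
  are finitely supported maps from monomials (finitely supported exponent maps) to rat.\<close>

type_synonym 'a var = "'a set + 'a"
type_synonym 'a mpoly = "('a var \<Rightarrow>\<^sub>0 nat) \<Rightarrow>\<^sub>0 rat"

definition mvar :: "'v \<Rightarrow> ('v \<Rightarrow>\<^sub>0 nat) \<Rightarrow>\<^sub>0 rat" where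
  "mvar v = Poly_Mapping.single (Poly_Mapping.single v 1) 1"

definition mon_deg :: "('v \<Rightarrow>\<^sub>0 nat) \<Rightarrow> nat" where
  "mon_deg m = (\<Sum>v \<in> Poly_Mapping.keys m. Poly_Mapping.lookup m v)"

definition qscale :: "rat \<Rightarrow> (('v \<Rightarrow>\<^sub>0 nat) \<Rightarrow>\<^sub>0 rat) \<Rightarrow> (('v \<Rightarrow>\<^sub>0 nat) \<Rightarrow>\<^sub>0 rat)" where
  "qscale c p = Poly_Mapping.single 0 c * p"

definition chow_vars :: "'a set \<Rightarrow> 'a set set \<Rightarrow> 'a var set" where
  "chow_vars E L = Inl ` (L - {E}) \<union> Inr ` E"

definition poly_ring :: "'v set \<Rightarrow> (('v \<Rightarrow>\<^sub>0 nat) \<Rightarrow>\<^sub>0 rat) set" where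
  "poly_ring V = {p. \<forall>m \<in> Poly_Mapping.keys p. Poly_Mapping.keys m \<subseteq> V}"

definition homog :: "'v set \<Rightarrow> nat \<Rightarrow> (('v \<Rightarrow>\<^sub>0 nat) \<Rightarrow>\<^sub>0 rat) set" where
  "homog V j = {p \<in> poly_ring V. \<forall>m \<in> Poly_Mapping.keys p. mon_deg m = j}"

definition ideal_gen :: "'v set \<Rightarrow> (('v \<Rightarrow>\<^sub>0 nat) \<Rightarrow>\<^sub>0 rat) set \<Rightarrow> (('v \<Rightarrow>\<^sub>0 nat) \<Rightarrow>\<^sub>0 rat) set" where
  "ideal_gen V G = {(\<Sum>g \<in> S. c g * g) | S c. finite S \<and> S \<subseteq> G \<and> (\<forall>g \<in> S. c g \<in> poly_ring V)}"

definition chow_gens :: "'a set \<Rightarrow> 'a set set \<Rightarrow> 'a mpoly set" where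
  "chow_gens E L =
     {mvar (Inr i) - (\<Sum>F \<in> {F \<in> L - {E}. i \<notin> F}. mvar (Inl F)) | i. i \<in> E}
   \<union> {mvar (Inl F1) * mvar (Inl F2) | F1 F2.
        F1 \<in> L - {E} \<and> F2 \<in> L - {E} \<and> \<not> F1 \<subseteq> F2 \<and> \<not> F2 \<subseteq> F1}
   \<union> {mvar (Inr i) * mvar (Inl F) | i F. i \<in> E \<and> F \<in> L - {E} \<and> i \<notin> F}"

definition chow_ideal :: "'a set \<Rightarrow> 'a set set \<Rightarrow> 'a mpoly set" where
  "chow_ideal E L = ideal_gen (chow_vars E L) (chow_gens E L)"

text \<open>dim_Q CH^j(M): the degree-j graded piece of Q[V]/I is the quotient of the degree-j
  homogeneous polynomials by the degree-j homogeneous elements of I.\<close>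
definition chow_dim :: "'a set \<Rightarrow> 'a set set \<Rightarrow> nat \<Rightarrow> nat" where
  "chow_dim E L j =
     vector_space.dim qscale (homog (chow_vars E L) j)
     - vector_space.dim qscale (homog (chow_vars E L) j \<inter> chow_ideal E L)"

definition aug_chow_hilbert :: "'a set \<Rightarrow> ('a set \<Rightarrow> nat) \<Rightarrow> real fps" where
  "aug_chow_hilbert E r = Abs_fps (\<lambda>j. of_nat (chow_dim E (flats E r) j))"

definition real_rooted :: "real poly \<Rightarrow> bool" where
  "real_rooted p \<longleftrightarrow> p \<noteq> 0 \<and> (\<forall>z::complex. poly (map_poly complex_of_real p) z = 0 \<longrightarrow> z \<in> \<real>)"

end

theory Submission
  imports Defs "HOL-Library.Function_Algebras"
begin

text \<open>
  Refining \<open>E_tilde\<close> by the last entry gives a linear recursion on vectors of polynomials. At a point of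
  the open upper half plane the recursion keeps the vector inside a sector of angle less than \<open>\<pi>\<close> whose
  first boundary ray passes through the first entry, so that entry never vanishes: this is
  real-rootedness. Solving the recursion with exponential generating functions expresses it through
  Eulerian polynomials.

  In the Chow ring the \<open>y i\<close> are eliminated and \<open>x \<emptyset>\<close> is traded for \<open>\<alpha> = (\<Sum>F. x F)\<close>, which plays the
  role of \<open>- x E\<close>. The Feichtner--Yuzvinsky monomials span by straightening. For the Boolean matroid they are
  independent because the defining relations deform to relations satisfied at as many points as there are
  monomials, one point for each maximal cone of the stellahedral fan. Multiplication by
  \<open>\<alpha> ^ (n - k)\<close> maps the ring of \<open>U_{k,n}\<close> to the Boolean one and sends FY monomials to
  distinct FY monomials. Counting chains by their largest
  proper flat then gives the same expression in Eulerian polynomials.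
\<close>

text \<open>Consecutive moduli are what makes a linear recursion possible: quotients are then
  ordered as their numerators and agree only at 0. The closing index behaves like one more step, to
  an entry 0, so a list of length \<open>k - 1\<close> leads to entry 0 of row \<open>k\<close>.

  Spanning bounds the graded dimensions only from above, and membership in the ideal is awkward to
  refute directly. The deformation gives \<open>y i - nabove {i}\<close> a nonzero constant value
  and keeps the monomial relations exact. A homogeneous element of the ideal then agrees on the
  points with a polynomial of lower degree, which independence as functions excludes. The parameters
  \<open>t i\<close> are distinct and nonzero so that no coordinate along a flag degenerates. The
  numbers of points and of monomials are compared by putting \<open>x = 1\<close> in the generating
  function.

  The detour through the Boolean case is forced by this count: rank 1 on \<open>n\<close> elements
  has \<open>n + 1\<close> maximal cones but two monomials.\<close>

section \<open>The refined polynomials\<close>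

text \<open>\<open>E_refined x r m j\<close> is the sum over the inversion sequences for \<open>(r + 2, \<dots>, r + m + 1)\<close> with last
  entry \<open>j\<close>, not counting the index \<open>m\<close>. The entry for \<open>m = 0\<close> stands for a fictitious modulus \<open>r + 1\<close>.\<close>

primrec E_refined :: "'a::comm_ring_1 \<Rightarrow> nat \<Rightarrow> nat \<Rightarrow> nat \<Rightarrow> 'a" where
  "E_refined x r 0 j = (if j = 0 then 1 else 0)"
| "E_refined x r (Suc m) j =
     x * (\<Sum>i<j. E_refined x r m i) + (\<Sum>i=j..r + m. E_refined x r m i) + (if j = 0 then x * E_refined x r m 0 else 0)"

definition step_weight :: "rat \<Rightarrow> rat \<Rightarrow> real poly" where
  "step_weight u v = (if u < v then [:0, 1:] else if u = v then [:1, 1:] else 1)"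

definition prefix_weight :: "nat list \<Rightarrow> nat list \<Rightarrow> nat \<Rightarrow> real poly" where
  "prefix_weight s e m = (\<Prod>i<m. step_weight (ratio s e i) (ratio s e (i + 1)))"

lemma prefix_weight_eq: "[:1, 1:] ^ col s e * monom 1 (asc s e) = prefix_weight s e (Suc (length s))"
proof -
  have x: "monom 1 m = [:0, 1 :: real:] ^ m" for m
    by (simp add: monom_altdef)
  have "step_weight u v = (if u = v then [:1, 1:] else 1) * (if u < v then [:0, 1:] else 1)" for u v
    by (auto simp: step_weight_def)
  then have "prefix_weight s e (Suc (length s)) =
      (\<Prod>i\<in>{0..length s}. if ratio s e i = ratio s e (i + 1) then [:1, 1:] else 1)
      * (\<Prod>i\<in>{0..length s}. if ratio s e i < ratio s e (i + 1) then [:0, 1:] else 1)"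
    unfolding prefix_weight_def by (simp only: prod.distrib lessThan_Suc_atMost atMost_atLeast0)
  then show ?thesis
    by (simp add: col_def asc_def x flip: prod.inter_filter)
qed

lemma inversion_seqs_snoc:
  "inversion_seqs (s @ [q]) = (\<lambda>(e, j). e @ [j]) ` (inversion_seqs s \<times> {..<q})"
proof (intro equalityI subsetI)
  fix e' assume "e' \<in> inversion_seqs (s @ [q])"
  then have l: "length e' = Suc (length s)" and b: "\<And>i. i < Suc (length s) \<Longrightarrow> e' ! i < (s @ [q]) ! i"
    by (auto simp: inversion_seqs_def)
  obtain e j where e: "e' = e @ [j]"
    using l by (metis length_Suc_conv_rev)
  have "length e = length s" using l e by simp
  moreover have "e ! i < s ! i" if "i < length s" for i
    using b[of i] that e \<open>length e = length s\<close> by (simp add: nth_append)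
  moreover have "j < q"
    using b[of "length s"] e \<open>length e = length s\<close> by (simp add: nth_append)
  ultimately show "e' \<in> (\<lambda>(e, j). e @ [j]) ` (inversion_seqs s \<times> {..<q})"
    unfolding e by (auto simp: inversion_seqs_def intro!: image_eqI[where x="(e, j)"])
qed (auto simp: inversion_seqs_def nth_append less_Suc_eq)

lemma sum_inversion_seqs_snoc:
  "(\<Sum>e\<in>inversion_seqs (s @ [q]). f e) = (\<Sum>e\<in>inversion_seqs s. \<Sum>j<q. f (e @ [j]))"
proof -
  have "inj_on (\<lambda>(e, j). e @ [j]) (inversion_seqs s \<times> {..<q})"
    by (auto simp: inj_on_def)
  then show ?thesis
    by (simp add: inversion_seqs_snoc sum.reindex sum.cartesian_product case_prod_unfold)
qed

lemma ratio_snoc: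
  assumes "length e = length s" "i \<le> length s"
  shows "ratio (s @ [q]) (e @ [j]) i = ratio s e i"
  using assms by (auto simp: ratio_def ext_e_def ext_s_def nth_append)

lemma ratio_snoc_last:
  assumes "length e = length s"
  shows "ratio (s @ [q]) (e @ [j]) (Suc (length s)) = of_nat j / of_nat q"
  using assms by (auto simp: ratio_def ext_e_def ext_s_def nth_append)

lemma prefix_weight_snoc:
  assumes "length e = length s"
  shows "prefix_weight (s @ [q]) (e @ [j]) (Suc (length s)) =
    prefix_weight s e (length s) * step_weight (ratio s e (length s)) (of_nat j / of_nat q)"
proof -
  have "prefix_weight (s @ [q]) (e @ [j]) (length s) = prefix_weight s e (length s)"
    unfolding prefix_weight_def using assms by (intro prod.cong) (auto simp: ratio_snoc)
  then show ?thesis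
    using assms by (simp add: prefix_weight_def ratio_snoc ratio_snoc_last)
qed

text \<open>Cross-multiplied, this compares \<open>i * (a + 2)\<close> with
  \<open>j * (a + 1)\<close>. For \<open>j \<ge> i + 1\<close> the bound \<open>i \<le> a\<close>
  makes the second larger; for \<open>j \<le> i\<close> with \<open>i > 0\<close> the first is
  larger. Collisions survive only at 0.\<close>

lemma step_weight_consecutive:
  assumes "i \<le> a" "j \<le> Suc a"
  shows "step_weight (of_nat i / of_nat (a + 1)) (of_nat j / of_nat (a + 2)) =
    (if i < j then [:0, 1:] else if i = 0 \<and> j = 0 then [:1, 1:] else 1)"
proof -
  have lt: "(of_nat i / of_nat (a + 1) :: rat) < of_nat j / of_nat (a + 2) \<longleftrightarrow> i * (a + 2) < j * (a + 1)"
    by (simp only: divide_less_eq less_divide_eq flip: of_nat_mult)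
       (simp add: field_simps flip: of_nat_mult of_nat_add of_nat_Suc del: of_nat_Suc)
  have nz: "rat_of_nat (a + 1) \<noteq> 0" "rat_of_nat (a + 2) \<noteq> 0"
    unfolding of_nat_eq_0_iff by simp_all
  have eq: "(of_nat i / of_nat (a + 1) :: rat) = of_nat j / of_nat (a + 2) \<longleftrightarrow> i * (a + 2) = j * (a + 1)"
    unfolding frac_eq_eq[OF nz] of_nat_mult[symmetric] of_nat_eq_iff ..
  consider "i < j" | "j \<le> i" "i > 0" | "i = 0" "j = 0" by linarith
  then show ?thesis
  proof cases
    case 1
    then obtain d where "j = i + d + 1" using less_imp_Suc_add by fastforce
    then have "i * (a + 2) < j * (a + 1)" using assms by (simp add: algebra_simps)
    then show ?thesis using 1 unfolding step_weight_def lt eq by simp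
  next
    case 2
    have "j * (a + 1) \<le> i * (a + 1)" using 2 by (intro mult_right_mono) auto
    also have "\<dots> < i * (a + 2)" using 2 by simp
    finally show ?thesis using 2 unfolding step_weight_def lt eq by simp
  next
    case 3
    then show ?thesis by (simp add: step_weight_def)
  qed
qed

lemma E_refined_Suc_eq_sum_step_weight:
  assumes "j \<le> Suc (r + l)"
  shows "E_refined [:0, 1:] r (Suc l) j =
    (\<Sum>i\<le>r + l. E_refined [:0, 1:] r l i * step_weight (of_nat i / of_nat (r + l + 1)) (of_nat j / of_nat (r + l + 2)))"
proof -
  have "(\<Sum>i\<le>r + l. E_refined [:0, 1:] r l i * step_weight (of_nat i / of_nat (r + l + 1)) (of_nat j / of_nat (r + l + 2)))
      = (\<Sum>i\<le>r + l. E_refined [:0, 1:] r l i * (if i < j then [:0, 1:] else if i = 0 \<and> j = 0 then [:1, 1:] else 1))"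
    using assms step_weight_consecutive[of _ "r + l" j] by (intro sum.cong refl) (simp only: atMost_iff add.assoc)
  also have "\<dots> = E_refined [:0, 1:] r (Suc l) j"
  proof (cases "j = 0")
    case True
    have "{..r + l} = insert 0 {1..r + l}" by auto
    moreover have "{0..r + l} = insert 0 {1..r + l}" by auto
    ultimately show ?thesis
      using True by (simp add: algebra_simps)
  next
    case False
    have "{..r + l} = {..<j} \<union> {j..r + l}" using assms by auto
    then have "(\<Sum>i\<le>r + l. E_refined [:0, 1:] r l i * (if i < j then [:0, 1:] else if i = 0 \<and> j = 0 then [:1, 1:] else 1))
       = (\<Sum>i<j. E_refined [:0, 1:] r l i * [:0, 1 :: real:]) + (\<Sum>i=j..r + l. E_refined [:0, 1:] r l i)"
      using False by (simp only:) (subst sum.union_disjoint; auto intro!: sum.cong)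
    then show ?thesis
      using False by (simp add: sum_distrib_left mult.commute)
  qed
  finally show ?thesis ..
qed

text \<open>The arbitrary test function \<open>h\<close> of the last quotient makes the induction
  close: the next factor of the weight is absorbed by taking for \<open>h\<close> the
  \<open>step_weight\<close> towards the new quotient.\<close>

lemma sum_prefix_weight_eq_sum_E_refined:
  assumes "s = [r + 2..<r + 2 + l]"
  shows "(\<Sum>e\<in>inversion_seqs s. prefix_weight s e l * h (ratio s e l)) =
    (\<Sum>i\<le>r + l. E_refined [:0, 1:] r l i * h (of_nat i / of_nat (r + l + 1)))"
  using assms
proof (induction l arbitrary: h s)
  \<comment> \<open>The last quotient is now \<open>e_0 / s_0 = 0\<close>, which agrees with
    numerator 0 over the fictitious modulus \<open>r + 1\<close>.\<close>
  case 0
  then have "inversion_seqs s = {[]}" by (auto simp: inversion_seqs_def)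
  moreover have "{..r} = insert 0 {1..r}" by auto
  ultimately show ?case
    by (simp add: prefix_weight_def ratio_def ext_e_def)
next
  case (Suc l)
  define s' where "s' = [r + 2..<r + 2 + l]"
  define q where "q = r + 2 + l"
  have s: "s = s' @ [q]" using Suc.prems by (simp add: s'_def q_def)
  have len: "length s' = l" unfolding s'_def length_upt by simp
  have leq: "\<And>e. e \<in> inversion_seqs s' \<Longrightarrow> length e = length s'"
    by (simp add: inversion_seqs_def)
  have "(\<Sum>e\<in>inversion_seqs s. prefix_weight s e (Suc l) * h (ratio s e (Suc l)))
     = (\<Sum>e\<in>inversion_seqs s'. \<Sum>j<q. prefix_weight s' e l * step_weight (ratio s' e l) (of_nat j / of_nat q) * h (of_nat j / of_nat q))"
    unfolding s sum_inversion_seqs_snoc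
  proof (intro sum.cong refl, goal_cases)
    case (1 e j)
    show ?case
      using prefix_weight_snoc[OF leq[OF 1(1)], of q j] ratio_snoc_last[OF leq[OF 1(1)], of q j]
      by (simp only: len)
  qed
  also have "\<dots> = (\<Sum>j<q. h (of_nat j / of_nat q) *
      (\<Sum>e\<in>inversion_seqs s'. prefix_weight s' e l * step_weight (ratio s' e l) (of_nat j / of_nat q)))"
    by (subst sum.swap) (simp add: sum_distrib_left sum_distrib_right mult_ac)
  also have "\<dots> = (\<Sum>j<q. h (of_nat j / of_nat q) * E_refined [:0, 1:] r (Suc l) j)"
  proof (intro sum.cong refl, goal_cases)
    case (1 j)
    have "q = r + l + 2" by (simp add: q_def)
    with 1 show ?case
      using Suc.IH[OF s'_def, of "\<lambda>u. step_weight u (of_nat j / of_nat q)"] E_refined_Suc_eq_sum_step_weight[of j r l]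
      by (simp only: lessThan_iff)
  qed
  also have "\<dots> = (\<Sum>i\<le>r + Suc l. E_refined [:0, 1:] r (Suc l) i * h (of_nat i / of_nat (r + Suc l + 1)))"
    by (intro sum.cong) (auto simp: q_def mult.commute simp del: E_refined.simps)
  finally show ?case .
qed

text \<open>The closing quotient \<open>0 / 1\<close> equals the quotient of an entry 0 for the next
  modulus \<open>r + l + 2\<close>; hence the last transition is one more step of the
  recursion.\<close>

lemma E_tilde_eq_E_refined: "E_tilde [r + 2..<r + 2 + l] = E_refined [:0, 1:] r (Suc l) 0"
proof -
  define s where "s = [r + 2..<r + 2 + l]"
  have len: "length s = l" unfolding s_def length_upt by simp
  have "E_tilde s = (\<Sum>e\<in>inversion_seqs s. prefix_weight s e l * step_weight (ratio s e l) 0)"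
    unfolding E_tilde_def prefix_weight_eq
    by (intro sum.cong refl) (simp add: len prefix_weight_def ratio_def[of _ _ "Suc l"] ext_e_def inversion_seqs_def)
  also have "\<dots> = E_refined [:0, 1:] r (Suc l) 0"
    using sum_prefix_weight_eq_sum_E_refined[OF s_def, of "\<lambda>u. step_weight u 0"] E_refined_Suc_eq_sum_step_weight[of 0 r l]
    by simp
  finally show ?thesis unfolding s_def .
qed

lemma poly_E_refined: "poly (E_refined p r m j) x = E_refined (poly p x) r m j"
  by (induction m arbitrary: j) (simp_all add: poly_sum)

lemma map_poly_E_refined: "map_poly complex_of_real (E_refined [:0, 1:] r m j) = E_refined [:0, 1:] r m j"
proof (induction m arbitrary: j)
  case (Suc m)
  have add: "map_poly complex_of_real (p + q) = map_poly complex_of_real p + map_poly complex_of_real q" for p q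
    by (simp add: poly_eq_iff coeff_map_poly)
  have "map_poly complex_of_real (\<Sum>i\<in>S. E_refined [:0, 1:] r m i) = (\<Sum>i\<in>S. E_refined [:0, 1:] r m i)" for S :: "nat set"
    using Suc by (induction S rule: infinite_finite_induct) (simp_all add: add)
  then show ?case using Suc by (simp add: add map_poly_pCons)
qed simp

section \<open>Real-rootedness\<close>

text \<open>At a point of the upper half plane the values \<open>p 0, \<dots>, p N\<close> lie in counterclockwise order
  within the sector from \<open>p 0\<close> to \<open>z * p 0\<close>; this encodes pairwise interlacing.\<close>

definition sector_ordered :: "complex \<Rightarrow> nat \<Rightarrow> (nat \<Rightarrow> complex) \<Rightarrow> bool" where
  "sector_ordered z N p \<longleftrightarrow>
     (\<forall>j\<le>N. \<forall>i\<le>j. 0 \<le> Im (p j * cnj (p i)) \<and> 0 \<le> Im (z * p i * cnj (p j)))"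

text \<open>Both conditions are sesquilinear in the entries, so they pass to sums over blocks when
  no index of \<open>A\<close> exceeds one of \<open>B\<close>.\<close>

lemma sector_ordered_sum:
  assumes "sector_ordered z N p" and "\<And>i j. i \<in> A \<Longrightarrow> j \<in> B \<Longrightarrow> i \<le> j \<and> j \<le> N"
  shows "0 \<le> Im (sum p B * cnj (sum p A))" "0 \<le> Im (z * sum p A * cnj (sum p B))"
proof -
  have "sum p B * cnj (sum p A) = (\<Sum>j\<in>B. \<Sum>i\<in>A. p j * cnj (p i))"
    by (simp add: sum_product cnj_sum)
  moreover have "z * sum p A * cnj (sum p B) = (\<Sum>i\<in>A. \<Sum>j\<in>B. z * p i * cnj (p j))"
    unfolding sum_product[symmetric] by (simp only: sum_distrib_left cnj_sum)
  ultimately show "0 \<le> Im (sum p B * cnj (sum p A))" "0 \<le> Im (z * sum p A * cnj (sum p B))"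
    using assms unfolding sector_ordered_def by (auto simp only: Im_sum intro!: sum_nonneg)
qed

text \<open>Expansion writes each imaginary part as a combination, with nonnegative coefficients, of
  the assumed quantities and of squared moduli. In the application \<open>a\<close>,
  \<open>b\<close>, \<open>c\<close> are the sums of the old row over the indices below
  \<open>i\<close>, from \<open>i\<close> to \<open>j - 1\<close>, and from \<open>j\<close> on;
  \<open>P\<close> and \<open>Q\<close> are the new entries \<open>i\<close> and
  \<open>j\<close>.\<close>

lemma sector_step:
  fixes a b c z :: complex
  assumes "0 \<le> Im z"
    and "0 \<le> Im (b * cnj a)" "0 \<le> Im (z * a * cnj b)" "0 \<le> Im (c * cnj a)"
    and "0 \<le> Im (c * cnj b)" "0 \<le> Im (z * b * cnj c)"
  defines "P \<equiv> z * a + b + c" and "Q \<equiv> z * (a + b) + c"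
  shows "0 \<le> Im (Q * cnj P)" "0 \<le> Im (z * P * cnj Q)"
proof -
  have "Im (Q * cnj P) = Im (z * a * cnj b) + (cmod z)\<^sup>2 * Im (b * cnj a)
      + Im z * (cmod b)\<^sup>2 + Im (z * b * cnj c) + Im (c * cnj b)"
    unfolding P_def Q_def cmod_power2 by (simp add: power2_eq_square algebra_simps)
  then show "0 \<le> Im (Q * cnj P)" using assms(1-6) by simp
  have "Im (z * P * cnj Q) = (cmod z)\<^sup>2 * Im (z * a * cnj b) + (cmod z)\<^sup>2 * Im (b * cnj a)
      + Im (z * b * cnj c) + (cmod z)\<^sup>2 * Im (c * cnj b) + Im z * (cmod (z * a + c))\<^sup>2
      + 0 * Im (c * cnj a)"
    unfolding P_def Q_def cmod_power2 by (simp add: power2_eq_square algebra_simps)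
  then show "0 \<le> Im (z * P * cnj Q)" using assms(1-6) by simp
qed

text \<open>This compares the new entry 0 with a later one: no index lies below 0, but the collision
  at 0 adds \<open>z * p\<close>. The old entry \<open>p\<close> of index 0 is therefore kept apart
  from the block \<open>b\<close> of indices 1 to \<open>j - 1\<close>.\<close>

lemma sector_step_zero:
  fixes p b c z :: complex
  assumes "0 \<le> Im z"
    and "0 \<le> Im (b * cnj p)" "0 \<le> Im (z * p * cnj b)"
    and "0 \<le> Im (c * cnj p)" "0 \<le> Im (z * p * cnj c)"
    and "0 \<le> Im (c * cnj b)" "0 \<le> Im (z * b * cnj c)"
  defines "P \<equiv> p + b + c + z * p" and "Q \<equiv> z * (p + b) + c"
  shows "0 \<le> Im (Q * cnj P)" "0 \<le> Im (z * P * cnj Q)"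
proof -
  have "Im (Q * cnj P) = Im z * (cmod (p + b))\<^sup>2 + Im (z * b * cnj c) + Im (c * cnj p) + Im (c * cnj b)
      + (cmod z)\<^sup>2 * Im (b * cnj p)"
    unfolding P_def Q_def cmod_power2 by (simp add: power2_eq_square algebra_simps)
  then show "0 \<le> Im (Q * cnj P)" using assms(1-7) by simp
  have "Im (z * P * cnj Q) = Im (z * p * cnj c) + Im (z * b * cnj c) + (cmod z)\<^sup>2 * Im (c * cnj b)
      + (cmod z)\<^sup>2 * Im (z * p * cnj b) + Im z * (cmod (z * p + c))\<^sup>2"
    unfolding P_def Q_def cmod_power2 by (simp add: power2_eq_square algebra_simps)
  then show "0 \<le> Im (z * P * cnj Q)" using assms(1-7) by simp
qed

lemma sector_ordered_E_refined:
  assumes z: "0 < Im z"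
  shows "sector_ordered z (r + m) (E_refined z r m)"
proof (induction m)
  case 0
  then show ?case using z by (auto simp: sector_ordered_def)
next
  case (Suc m)
  let ?p = "E_refined z r m"
  note S = sector_ordered_sum[OF Suc]
  show ?case
    unfolding sector_ordered_def
  proof (intro allI impI)
    fix i j assume j: "j \<le> r + Suc m" and "i \<le> j"
    let ?P = "E_refined z r (Suc m) i" and ?Q = "E_refined z r (Suc m) j"
    let ?c = "sum ?p {j..r + m}"
    have split: "sum ?p {l..r + m} = sum ?p {l..<j} + ?c" if "l \<le> j" for l
    proof -
      have "{l..r + m} = {l..<j} \<union> {j..r + m}" using that j by auto
      then show ?thesis by (simp only:) (subst sum.union_disjoint; auto)
    qed
    consider "i = j" | "i < j" "i > 0" | "i = 0" "j > 0" using \<open>i \<le> j\<close> by linarith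
    then show "0 \<le> Im (?Q * cnj ?P) \<and> 0 \<le> Im (z * ?P * cnj ?Q)"
    proof cases
      case 1
      have "0 \<le> Im (w * cnj w) \<and> 0 \<le> Im (z * w * cnj w)" for w
        unfolding mult.assoc complex_mult_cnj using z by simp
      then show ?thesis using 1 by blast
    next
      case 2
      let ?a = "sum ?p {..<i}" and ?b = "sum ?p {i..<j}"
      have Q: "?Q = z * (?a + ?b) + ?c"
      proof -
        have "sum ?p ({..<i} \<union> {i..<j}) = ?a + ?b" by (rule sum.union_disjoint) auto
        moreover have "{..<i} \<union> {i..<j} = {..<j}" using 2 by auto
        ultimately have "sum ?p {..<j} = ?a + ?b" by metis
        then show ?thesis using 2 by (simp only: E_refined.simps) simp
      qed
      have P: "?P = z * ?a + ?b + ?c"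
        using 2 split[of i] by simp
      show ?thesis
        unfolding P Q using z 2 j by (intro conjI sector_step S) auto
    next
      case 3
      let ?b = "sum ?p {1..<j}"
      have "{..<j} = insert 0 {1..<j}" "{0..<j} = insert 0 {1..<j}" using 3 by auto
      then have "sum ?p {..<j} = sum ?p {0} + ?b" "sum ?p {0..<j} = sum ?p {0} + ?b" by simp_all
      moreover have "sum ?p {0} = ?p 0" by simp
      ultimately have P: "?P = sum ?p {0} + ?b + ?c + z * sum ?p {0}" and Q: "?Q = z * (sum ?p {0} + ?b) + ?c"
        using 3 split[of 0] by (simp_all only: E_refined.simps le0 if_True) simp_all
      show ?thesis
        unfolding P Q using z 3 j by (intro conjI sector_step_zero S) (simp_all only: not_less, auto)
    qed
  qed
qed

text \<open>Multiply by the conjugate of the previous entry 0. The old row lies counterclockwise of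
  that entry, so its sum contributes a nonnegative imaginary part, while the collision term
  contributes \<open>Im z\<close> times a squared modulus, which is positive.\<close>

lemma E_refined_upper_half_plane:
  assumes z: "0 < Im z"
  shows "E_refined z r m 0 \<noteq> 0"
proof (induction m)
  case (Suc m)
  let ?p = "E_refined z r m"
  have "E_refined z r (Suc m) 0 * cnj (?p 0) = (\<Sum>i=0..r + m. ?p i * cnj (?p 0)) + z * (?p 0 * cnj (?p 0))"
    by (simp add: distrib_right sum_distrib_right mult.assoc)
  then have "Im (E_refined z r (Suc m) 0 * cnj (?p 0)) =
      (\<Sum>i=0..r + m. Im (?p i * cnj (?p 0))) + Im z * (cmod (?p 0))\<^sup>2"
    by (simp only: complex_mult_cnj plus_complex.sel Im_sum cmod_power2) simp
  moreover have "0 \<le> (\<Sum>i=0..r + m. Im (?p i * cnj (?p 0)))"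
    using sector_ordered_E_refined[OF z, of r m] unfolding sector_ordered_def by (intro sum_nonneg) simp
  moreover have "0 < Im z * (cmod (?p 0))\<^sup>2"
    using z Suc by simp
  ultimately have "0 < Im (E_refined z r (Suc m) 0 * cnj (?p 0))" by linarith
  then show ?case by (metis less_irrefl mult_zero_left zero_complex.sel(2))
qed simp

lemma cnj_E_refined: "cnj (E_refined z r m j) = E_refined (cnj z) r m j"
  by (induction m arbitrary: j) (simp_all add: cnj_sum)

lemma real_rooted_E_refined: "real_rooted (E_refined [:0, 1:] r m 0)"
proof -
  have val: "poly (map_poly complex_of_real (E_refined [:0, 1:] r m 0)) z = E_refined z r m 0" for z
    by (simp add: map_poly_E_refined poly_E_refined)
  have "z \<in> \<real>" if "E_refined z r m 0 = 0" for z :: complex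
  proof -
    have "\<not> 0 < Im z" "\<not> 0 < Im (cnj z)"
      using that E_refined_upper_half_plane[of z r m] E_refined_upper_half_plane[of "cnj z" r m]
      by (auto simp flip: cnj_E_refined)
    then show ?thesis by (simp add: complex_is_Real_iff)
  qed
  moreover have "E_refined [:0, 1:] r m 0 \<noteq> (0 :: real poly)"
    using E_refined_upper_half_plane[of \<i> r m] val[of \<i>] by fastforce
  ultimately show ?thesis
    unfolding real_rooted_def val by blast
qed

section \<open>Solution by Eulerian polynomials\<close>

text \<open>\<open>eul x m\<close> is \<open>x\<close> times the \<open>m\<close>-th Eulerian polynomial for \<open>m > 0\<close>; the recursion follows
  the top flat of a chain.\<close>

context
  notes sum.cong [fundef_cong]
begin

fun eul :: "'a::comm_ring_1 \<Rightarrow> nat \<Rightarrow> 'a" where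
  "eul x m = x ^ m + (\<Sum>d<m. of_nat (m choose d) * eul x d * (\<Sum>c=1..<m - d. x ^ c))"

end

declare eul.simps [simp del]

text \<open>Generating function of the FY monomials in rank \<open>k\<close> (see
  \<open>sum_FY\<close>): \<open>d\<close> is the size of the largest proper flat of the chain,
  \<open>c\<close> the exponent of the ground set, and \<open>x ^ k\<close> the extra monomial
  available when the chain has no proper flat.\<close>

definition chow_poly :: "'a::comm_ring_1 \<Rightarrow> nat \<Rightarrow> nat \<Rightarrow> 'a" where
  "chow_poly x k n = x ^ k + (\<Sum>d<k. of_nat (n choose d) * eul x d * (\<Sum>c<k - d. x ^ c))"

definition eul_egf :: "real \<Rightarrow> real fps" where
  "eul_egf x = Abs_fps (\<lambda>m. eul x m / fact m)"

lemma geometric_sum_mult: "(x - 1) * (\<Sum>c<m. x ^ c) = x ^ m - (1 :: 'a :: comm_ring_1)"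
  by (simp add: power_diff_1_eq)

text \<open>The factor \<open>x - 1\<close> clears the geometric sums in the recursion of
  \<open>eul\<close>; the left-hand side of the recursion becomes the term \<open>d = m\<close>,
  where \<open>x - x ^ 0 = x - 1\<close>.\<close>

lemma eul_binomial_sum:
  fixes x :: "'a::comm_ring_1"
  shows "(\<Sum>d\<le>m. of_nat (m choose d) * eul x d * (x - x ^ (m - d))) = (x - 1) * x ^ m"
proof -
  have g: "(x - 1) * (\<Sum>c=1..<k. x ^ c) = x ^ k - x" if "0 < k" for k
    using geometric_sum_mult[of x k] that
    by (simp add: lessThan_atLeast0 sum.atLeast_Suc_lessThan algebra_simps)
  have "(x - 1) * eul x m = (x - 1) * x ^ m +
      (\<Sum>d<m. of_nat (m choose d) * eul x d * ((x - 1) * (\<Sum>c=1..<m - d. x ^ c)))"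
    by (subst eul.simps) (simp add: distrib_left sum_distrib_left mult_ac)
  also have "\<dots> = (x - 1) * x ^ m + (\<Sum>d<m. of_nat (m choose d) * eul x d * (x ^ (m - d) - x))"
    using g by simp
  also have "(\<Sum>d<m. of_nat (m choose d) * eul x d * (x ^ (m - d) - x)) =
      - (\<Sum>d<m. of_nat (m choose d) * eul x d * (x - x ^ (m - d)))"
    by (subst sum_negf[symmetric]) (simp add: algebra_simps)
  finally show ?thesis
    by (simp add: lessThan_Suc_atMost[symmetric] algebra_simps)
qed

lemma fps_nth_mult_exp:
  fixes f :: "nat \<Rightarrow> real"
  shows "fps_nth (Abs_fps (\<lambda>m. f m / fact m) * fps_exp c) m * fact m =
    (\<Sum>d\<le>m. of_nat (m choose d) * f d * c ^ (m - d))"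
  unfolding fps_mult_nth atLeast0AtMost sum_distrib_right
  by (intro sum.cong refl) (simp add: binomial_fact)

text \<open>With \<open>F = eul_egf x\<close> the binomial identity says
  \<open>F * (x * exp t - exp (x * t)) = (x - 1) * exp (x * t)\<close>; multiplying by
  \<open>exp (- t)\<close> leaves only \<open>exp ((x - 1) * t)\<close>. This is the classical
  Eulerian generating function, kept free of division so that coefficients can be compared.\<close>

lemma eul_egf_exp:
  "eul_egf x * fps_exp (x - 1) = fps_const x * eul_egf x - fps_const (x - 1) * fps_exp (x - 1)"
proof -
  have "eul_egf x * (fps_const x * fps_exp 1 - fps_exp x) = fps_const (x - 1) * fps_exp x"
  proof (rule fps_ext)
    fix m
    have "fps_nth (eul_egf x * (fps_const x * fps_exp 1 - fps_exp x)) m * fact m =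
      x * (fps_nth (eul_egf x * fps_exp 1) m * fact m) - fps_nth (eul_egf x * fps_exp x) m * fact m"
      by (simp add: right_diff_distrib left_diff_distrib mult.left_commute[of _ "fps_const x"])
    also have "\<dots> = (\<Sum>d\<le>m. of_nat (m choose d) * eul x d * (x - x ^ (m - d)))"
      unfolding eul_egf_def fps_nth_mult_exp
      by (simp add: sum_distrib_left sum_subtractf algebra_simps)
    also note eul_binomial_sum
    finally show "fps_nth (eul_egf x * (fps_const x * fps_exp 1 - fps_exp x)) m =
        fps_nth (fps_const (x - 1) * fps_exp x) m"
      by (simp add: eq_divide_eq)
  qed
  then have "eul_egf x * (fps_const x * fps_exp 1 - fps_exp x) * fps_exp (-1) =
      fps_const (x - 1) * fps_exp x * fps_exp (-1)"
    by simp
  then have "eul_egf x * (fps_const x * (fps_exp 1 * fps_exp (-1)) - fps_exp x * fps_exp (-1)) =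
      fps_const (x - 1) * (fps_exp x * fps_exp (-1))"
    by (simp only: left_diff_distrib right_diff_distrib mult.assoc)
  moreover have "fps_exp 1 * fps_exp (-1) = (1 :: real fps)"
    "fps_exp x * fps_exp (-1) = fps_exp (x - 1)"
    by (simp_all flip: fps_exp_add_mult)
  ultimately have "eul_egf x * (fps_const x - fps_exp (x - 1)) = fps_const (x - 1) * fps_exp (x - 1)"
    by simp
  then show ?thesis by (simp add: algebra_simps)
qed

lemma eul_sum_power:
  fixes x :: real
  shows "(\<Sum>d\<le>e. of_nat (e choose d) * eul x d * (x - 1) ^ (e - d)) = x * eul x e - (x - 1) ^ Suc e"
  unfolding fps_nth_mult_exp[symmetric] eul_egf_def[symmetric] eul_egf_exp
  by (simp add: eul_egf_def field_simps)

text \<open>Differentiate the identity of \<open>eul_egf_exp\<close> and use it once more to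
  eliminate the undifferentiated product.\<close>

lemma eul_Suc_sum_power:
  fixes x :: real
  shows "(\<Sum>d\<le>e. of_nat (e choose d) * eul x (Suc d) * (x - 1) ^ (e - d)) =
    x * eul x (Suc e) + x * (1 - x) * eul x e"
proof -
  let ?f = "eul_egf x" and ?v = "fps_exp (x - 1)"
  have "fps_deriv (?f * ?v) = fps_deriv (fps_const x * ?f - fps_const (x - 1) * ?v)"
    by (simp add: eul_egf_exp)
  then have "fps_deriv ?f * ?v + fps_const (x - 1) * (?f * ?v) =
      fps_const x * fps_deriv ?f - fps_const (x - 1) * (fps_const (x - 1) * ?v)"
    by (simp add: algebra_simps)
  then have "fps_deriv ?f * ?v = fps_const x * fps_deriv ?f - fps_const (x - 1) * (fps_const x * ?f)"
    unfolding eul_egf_exp by (simp add: algebra_simps)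
  moreover have "fps_deriv ?f = Abs_fps (\<lambda>m. eul x (Suc m) / fact m)"
    by (rule fps_ext) (simp add: eul_egf_def fps_deriv_nth field_simps del: of_nat_Suc)
  ultimately have eq: "Abs_fps (\<lambda>m. eul x (Suc m) / fact m) * ?v =
      fps_const x * Abs_fps (\<lambda>m. eul x (Suc m) / fact m) - fps_const (x - 1) * (fps_const x * ?f)"
    by simp
  show ?thesis
    unfolding fps_nth_mult_exp[symmetric] eq by (simp add: eul_egf_def field_simps)
qed

lemma eul_0 [simp]: "eul x 0 = 1"
  by (subst eul.simps) simp

lemma chow_poly_Suc:
  fixes x :: "'a::comm_ring_1"
  shows "chow_poly x (Suc l) (Suc a) = x ^ Suc l +
     (\<Sum>d\<le>l. of_nat (a choose d) * eul x d * (\<Sum>c<Suc l - d. x ^ c)) +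
     (\<Sum>e\<le>l. of_nat (a choose e) * eul x (Suc e) * (\<Sum>c<l - e. x ^ c))"
proof -
  define g where "g m = (\<Sum>c<m. x ^ c)" for m
  have g0: "g 0 = 0" by (simp add: g_def)
  have "(\<Sum>d<Suc l. of_nat (Suc a choose d) * eul x d * g (Suc l - d)) =
     (\<Sum>d<Suc l. of_nat (a choose d) * eul x d * g (Suc l - d)) +
     (\<Sum>e<l. of_nat (a choose e) * eul x (Suc e) * g (l - e))"
    by (simp add: sum.lessThan_Suc_shift sum.distrib algebra_simps del: sum.lessThan_Suc)
  moreover have "(\<Sum>e\<le>l. of_nat (a choose e) * eul x (Suc e) * g (l - e)) =
     (\<Sum>e<l. of_nat (a choose e) * eul x (Suc e) * g (l - e))"
    by (simp add: g0 flip: lessThan_Suc_atMost)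
  ultimately show ?thesis
    unfolding chow_poly_def g_def[symmetric] by (simp only: add.assoc lessThan_Suc_atMost)
qed

lemma chow_poly_atMost:
  "chow_poly x l a = x ^ l + (\<Sum>d\<le>l. of_nat (a choose d) * eul x d * (\<Sum>c<l - d. x ^ c))"
  unfolding chow_poly_def by (simp flip: lessThan_Suc_atMost)

text \<open>This rewrites the summands of \<open>chow_poly_diff_sum\<close>; the companion
  \<open>chow_poly_Suc_minus\<close> rewrites its value. The geometric sum of length
  \<open>Suc m\<close> gives up its last power here and its first power there.\<close>

lemma chow_poly_diff:
  fixes x :: "'a::comm_ring_1"
  shows "chow_poly x (Suc l) (Suc a) - chow_poly x l a = x ^ l * (x - 1) +
    (\<Sum>e\<le>l. of_nat (a choose e) * (eul x (Suc e) * (\<Sum>c<l - e. x ^ c) + eul x e * x ^ (l - e)))"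
proof -
  define g where "g m = (\<Sum>c<m. x ^ c)" for m
  have "(\<Sum>d\<le>l. of_nat (a choose d) * eul x d * g (Suc l - d)) =
     (\<Sum>d\<le>l. of_nat (a choose d) * eul x d * (g (l - d) + x ^ (l - d)))"
    by (intro sum.cong refl) (simp add: g_def Suc_diff_le)
  then show ?thesis
    unfolding chow_poly_Suc chow_poly_atMost[of x l a] g_def[symmetric]
    by (simp add: sum.distrib algebra_simps)
qed

lemma chow_poly_Suc_minus:
  fixes x :: "'a::comm_ring_1"
  shows "chow_poly x (Suc l) (Suc a) - x * chow_poly x l a =
    (\<Sum>e\<le>l. of_nat (a choose e) * (eul x (Suc e) * (\<Sum>c<l - e. x ^ c) + eul x e))"
proof -
  define g where "g m = (\<Sum>c<m. x ^ c)" for m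
  have g: "g (Suc m) = 1 + x * g m" for m
    unfolding g_def by (subst sum.lessThan_Suc_shift) (simp add: sum_distrib_left)
  have "(\<Sum>d\<le>l. of_nat (a choose d) * eul x d * g (Suc l - d)) =
     (\<Sum>d\<le>l. of_nat (a choose d) * eul x d * (1 + x * g (l - d)))"
    by (intro sum.cong refl) (simp add: Suc_diff_le g)
  then show ?thesis
    unfolding chow_poly_Suc chow_poly_atMost[of x l a] g_def[symmetric]
    by (simp add: sum.distrib sum_distrib_left algebra_simps)
qed

text \<open>Collecting the terms with \<open>i + e = g\<close>, the inner sums are evaluated by \<open>eul_sum_power\<close>
  and \<open>eul_Suc_sum_power\<close>.\<close>

lemma chow_poly_diff_sum:
  fixes x :: real
  shows "(\<Sum>i\<le>m. of_nat (a choose i) * (x - 1) ^ i *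
      (chow_poly x (Suc (m - i)) (Suc (a - i)) - chow_poly x (m - i) (a - i))) =
    x * (chow_poly x (Suc m) (Suc a) - x * chow_poly x m a)"
proof -
  define h where "h k = (\<Sum>c<k. x ^ c)" for k
  define t where "t i e = (x - 1) ^ i * (eul x (Suc e) * h (m - (i + e)) + eul x e * x ^ (m - (i + e)))" for i e
  have ch: "of_nat (a choose i) * of_nat (a - i choose e) = (of_nat (a choose (i + e)) * of_nat (i + e choose i) :: real)" for i e
    using choose_mult_lemma[of i e "a - (i + e)"] choose_mult[of i "i + e" a]
    by (cases "i + e \<le> a") (auto simp: binomial_eq_0 simp flip: of_nat_mult)
  have "(\<Sum>i\<le>m. of_nat (a choose i) * (x - 1) ^ i *
      (chow_poly x (Suc (m - i)) (Suc (a - i)) - chow_poly x (m - i) (a - i))) =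
     (\<Sum>i\<le>m. of_nat (a choose i) * (x - 1) ^ i * (x ^ (m - i) * (x - 1))) +
     (\<Sum>i\<le>m. \<Sum>e\<le>m - i. of_nat (a choose i) * of_nat (a - i choose e) * t i e)"
    unfolding chow_poly_diff h_def[symmetric]
    by (simp add: distrib_left sum.distrib sum_distrib_left t_def diff_diff_left mult_ac)
  also have "(\<Sum>i\<le>m. \<Sum>e\<le>m - i. of_nat (a choose i) * of_nat (a - i choose e) * t i e) =
     (\<Sum>g\<le>m. \<Sum>i\<le>g. of_nat (a choose g) * (of_nat (g choose i) * t i (g - i)))"
  proof -
    have "Sigma {..m} (\<lambda>i. {..m - i}) = {(i, e). i + e \<le> m}" by auto
    then show ?thesis
      by (simp add: ch sum.Sigma sum.triangle_reindex_eq mult.assoc)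
  qed
  also have "\<dots> = (\<Sum>g\<le>m. of_nat (a choose g) *
     (h (m - g) * (x * eul x (Suc g) + x * (1 - x) * eul x g) + x ^ (m - g) * (x * eul x g - (x - 1) ^ Suc g)))"
  proof (intro sum.cong refl, goal_cases)
    case (1 g)
    have "(\<Sum>i\<le>g. of_nat (g choose i) * t i (g - i)) = (\<Sum>d\<le>g. of_nat (g choose (g - d)) * t (g - d) (g - (g - d)))"
      by (rule sum.nat_diff_reindex[symmetric, of _ "Suc g", simplified lessThan_Suc_atMost diff_Suc_Suc])
    also have "\<dots> = (\<Sum>d\<le>g. of_nat (g choose d) * t (g - d) d)"
      by (intro sum.cong refl) (auto simp: binomial_symmetric[symmetric])
    also have "\<dots> = h (m - g) * (\<Sum>d\<le>g. of_nat (g choose d) * eul x (Suc d) * (x - 1) ^ (g - d)) +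
       x ^ (m - g) * (\<Sum>d\<le>g. of_nat (g choose d) * eul x d * (x - 1) ^ (g - d))"
      by (simp add: t_def distrib_left sum.distrib sum_distrib_left mult_ac)
    finally show ?case
      by (simp only: eul_sum_power eul_Suc_sum_power flip: sum_distrib_left)
  qed
  \<comment> \<open>The terms \<open>x ^ (m - i) * (x - 1)\<close> from
    \<open>chow_poly_diff\<close> cancel exactly against the boundary terms
    \<open>- (x - 1) ^ Suc g\<close> from \<open>eul_sum_power\<close>.\<close>
  also have "(\<Sum>i\<le>m. of_nat (a choose i) * (x - 1) ^ i * (x ^ (m - i) * (x - 1))) + \<dots> =
     (\<Sum>g\<le>m. of_nat (a choose g) * (x * (eul x (Suc g) * h (m - g)) + x * ((1 - x) * h (m - g) + x ^ (m - g)) * eul x g))"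
    unfolding sum.distrib[symmetric] by (intro sum.cong refl) (simp add: algebra_simps)
  also have "\<dots> = x * (chow_poly x (Suc m) (Suc a) - x * chow_poly x m a)"
  proof -
    have one: "(1 - x) * h k + x ^ k = 1" for k
      using geometric_sum_mult[of x k] by (simp add: h_def algebra_simps)
    show ?thesis
      unfolding chow_poly_Suc_minus h_def[symmetric] one by (simp add: sum_distrib_left algebra_simps)
  qed
  finally show ?thesis .
qed

text \<open>This is the entry with index 1 of row \<open>m\<close>: for \<open>m > 0\<close> entries
  0 and 1 differ exactly by the previous entry 0. The value 0 at \<open>m = 0\<close> also
  annihilates the terms whose truncated index \<open>m - i\<close> is 0.\<close>

definition E_refined_diff :: "'a::comm_ring_1 \<Rightarrow> nat \<Rightarrow> nat \<Rightarrow> 'a" where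
  "E_refined_diff x r m = (if m = 0 then 0 else E_refined x r m 0 - E_refined x r (m - 1) 0)"

text \<open>Writing \<open>E m j\<close> for the entries,
  \<open>E (Suc l) (j + 1) - E (Suc l) j = (x - 1) * E l j\<close> for
  \<open>0 < j \<le> r + l\<close>, since only the old entry \<open>j\<close> changes its weight,
  from 1 to \<open>x\<close>. Iteration produces the binomials.\<close>

lemma E_refined_eq_sum_diff:
  fixes x :: "'a::comm_ring_1"
  assumes "j < r + m"
  shows "E_refined x r m (Suc j) = (\<Sum>i\<le>j. of_nat (j choose i) * (x - 1) ^ i * E_refined_diff x r (m - i))"
  using assms
proof (induction j arbitrary: m)
  case 0
  show ?case
  proof (cases m)
    case (Suc l)
    then show ?thesis by (simp add: E_refined_diff_def sum.atLeast_Suc_atMost[of 0] algebra_simps)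
  qed (simp add: E_refined_diff_def)
next
  case (Suc j)
  let ?t = "\<lambda>m j i. of_nat (j choose i) * (x - 1) ^ i * E_refined_diff x r (m - i)"
  show ?case
  proof (cases m)
    case 0
    then show ?thesis by (simp add: E_refined_diff_def)
  next
    case (Suc l)
    with Suc.prems have j: "Suc j \<le> r + l" by simp
    then have "E_refined x r m (Suc (Suc j)) = E_refined x r m (Suc j) + (x - 1) * E_refined x r l (Suc j)"
      using Suc by (simp add: sum.atLeast_Suc_atMost[of "Suc j"] algebra_simps)
    also have "E_refined x r m (Suc j) = (\<Sum>i\<le>j. ?t m j i)"
      using Suc.prems by (intro Suc.IH) simp
    also have "E_refined x r l (Suc j) = (\<Sum>i\<le>j. ?t l j i)"
      using j by (intro Suc.IH) simp
    also have "(\<Sum>i\<le>j. ?t m j i) = (\<Sum>i\<le>Suc j. of_nat (j choose i) * (x - 1) ^ i * E_refined_diff x r (m - i))"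
      by (simp add: binomial_eq_0)
    also have "(\<Sum>i\<le>Suc j. of_nat (j choose i) * (x - 1) ^ i * E_refined_diff x r (m - i)) + (x - 1) * (\<Sum>i\<le>j. ?t l j i)
       = (\<Sum>i\<le>Suc j. ?t m (Suc j) i)"
      unfolding sum.atMost_Suc_shift sum_distrib_left add.assoc sum.distrib[symmetric] Suc
      by (simp add: algebra_simps)
    finally show ?thesis .
  qed
qed

text \<open>Sum the previous formula over all entries of row \<open>m\<close>; the hockey-stick
  identity gives \<open>r + m choose Suc i\<close>. The factor \<open>x - 1\<close> aligns the
  powers with the convolution in \<open>chow_poly_diff_sum\<close>.\<close>

lemma E_refined_Suc_rec:
  fixes x :: "'a::comm_ring_1"
  shows "(x - 1) * E_refined_diff x r (Suc m) = x * (x - 1) * E_refined x r m 0 +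
    (\<Sum>i=1..m. of_nat (r + m choose i) * (x - 1) ^ i * E_refined_diff x r (Suc m - i))"
proof -
  let ?D = "E_refined_diff x r"
  have "E_refined x r (Suc m) 0 = x * E_refined x r m 0 + (\<Sum>i\<le>r + m. E_refined x r m i)"
    by (simp add: atLeast0AtMost)
  also have "(\<Sum>i\<le>r + m. E_refined x r m i) = E_refined x r m 0 + (\<Sum>j<r + m. E_refined x r m (Suc j))"
    by (simp add: sum.atMost_shift)
  also have "(\<Sum>j<r + m. E_refined x r m (Suc j)) =
      (\<Sum>j<r + m. \<Sum>i<r + m. of_nat (j choose i) * (x - 1) ^ i * ?D (m - i))"
  proof (intro sum.cong refl, goal_cases)
    case (1 j)
    then show ?case
      using E_refined_eq_sum_diff[of j r m x]
      by (simp only: lessThan_iff) (intro sum.mono_neutral_left; simp add: binomial_eq_0 subset_eq)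
  qed
  also have "\<dots> = (\<Sum>i<r + m. (\<Sum>j<r + m. of_nat (j choose i)) * ((x - 1) ^ i * ?D (m - i)))"
    by (subst sum.swap) (simp add: sum_distrib_right mult.assoc)
  also have "\<dots> = (\<Sum>i<r + m. of_nat (r + m choose Suc i) * ((x - 1) ^ i * ?D (m - i)))"
  proof -
    have "(\<Sum>j<k. j choose i) = k choose Suc i" for k i
      by (induction k) simp_all
    then show ?thesis by (simp flip: of_nat_sum)
  qed
  also have "\<dots> = (\<Sum>i<m. of_nat (r + m choose Suc i) * ((x - 1) ^ i * ?D (m - i)))"
    by (intro sum.mono_neutral_right) (auto simp: E_refined_diff_def)
  finally have "?D (Suc m) = x * E_refined x r m 0 + (\<Sum>i<m. of_nat (r + m choose Suc i) * ((x - 1) ^ i * ?D (m - i)))"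
    by (simp add: E_refined_diff_def del: E_refined.simps)
  moreover have "(\<Sum>i=1..m. of_nat (r + m choose i) * (x - 1) ^ i * ?D (Suc m - i)) =
      (\<Sum>i<m. of_nat (r + m choose Suc i) * (x - 1) ^ Suc i * ?D (m - i))"
    by (rule sum.reindex_bij_witness[of _ Suc "\<lambda>i. i - 1"]) auto
  ultimately show ?thesis
    by (simp add: distrib_left sum_distrib_left mult_ac)
qed

text \<open>Isolating the term \<open>i = 0\<close> in \<open>chow_poly_diff_sum\<close> gives
  \<open>chow_poly\<close> the recursion of \<open>E_refined_Suc_rec\<close>. The unknown carries
  the factor \<open>x - 1\<close>; the excluded point is recovered below, where the identity is one
  of polynomials.\<close>

lemma E_refined_eq_chow_poly:
  fixes x :: real
  assumes "x \<noteq> 1"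
  shows "E_refined x r m 0 = chow_poly x m (r + m)"
proof (induction m rule: less_induct)
  case (less m)
  show ?case
  proof (cases m)
    case 0
    then show ?thesis by (simp add: chow_poly_def)
  next
    case (Suc l)
    define c where "c i = chow_poly x (Suc (l - i)) (Suc (r + l - i)) - chow_poly x (l - i) (r + l - i)" for i
    have D: "E_refined_diff x r (Suc l - i) = c i" if "1 \<le> i" "i \<le> l" for i
    proof -
      have "E_refined x r (Suc (l - i)) 0 = chow_poly x (Suc (l - i)) (r + Suc (l - i))"
        "E_refined x r (l - i) 0 = chow_poly x (l - i) (r + (l - i))"
        using that Suc by - (rule less.IH, simp)+
      then show ?thesis
        using that by (simp add: E_refined_diff_def c_def Suc_diff_le del: E_refined.simps)
    qed
    have IH: "E_refined x r l 0 = chow_poly x l (r + l)"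
      using Suc by (intro less.IH) simp
    have "{..l} = insert 0 {1..l}" by auto
    then have "c 0 + (\<Sum>i=1..l. of_nat (r + l choose i) * (x - 1) ^ i * c i) =
        x * (c 0 + chow_poly x l (r + l) - x * chow_poly x l (r + l))"
      using chow_poly_diff_sum[of "r + l" x l] unfolding c_def[symmetric]
      by (simp add: c_def[of 0])
    then have "(x - 1) * c 0 = x * (x - 1) * chow_poly x l (r + l) +
        (\<Sum>i=1..l. of_nat (r + l choose i) * (x - 1) ^ i * c i)"
      by (simp add: algebra_simps)
    also have "\<dots> = (x - 1) * E_refined_diff x r (Suc l)"
      unfolding E_refined_Suc_rec IH using D by simp
    finally have "c 0 = E_refined_diff x r (Suc l)" using assms by simp
    then show ?thesis
      using IH Suc by (simp add: E_refined_diff_def c_def del: E_refined.simps)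
  qed
qed

lemma poly_eul: "poly (eul p m) x = eul (poly p x) m"
proof (induction m rule: less_induct)
  case (less m)
  then show ?case
    by (subst (1 2) eul.simps) (simp add: poly_sum)
qed

lemma poly_chow_poly: "poly (chow_poly p k n) x = chow_poly (poly p x) k n"
  by (simp add: chow_poly_def poly_sum poly_eul)

lemma E_refined_eq_chow_poly_poly:
  "E_refined [:0, 1 :: real:] r m 0 = chow_poly [:0, 1:] m (r + m)"
proof (rule ccontr)
  let ?d = "E_refined [:0, 1 :: real:] r m 0 - chow_poly [:0, 1:] m (r + m)"
  assume "\<not> ?thesis"
  then have "finite {x. poly ?d x = 0}" by (intro poly_roots_finite) simp
  moreover have "- {1} \<subseteq> {x. poly ?d x = 0}"
    by (auto simp: poly_E_refined poly_chow_poly E_refined_eq_chow_poly)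
  ultimately have "finite (- {1 :: real})" by (rule finite_subset[rotated])
  then show False by (simp add: Compl_eq_Diff_UNIV infinite_UNIV_char_0)
qed

section \<open>Feichtner--Yuzvinsky exponents\<close>

lemma finite_Collect_proper_subsets [simp]:
  assumes "finite T"
  shows "finite {F. F \<subset> T \<and> P F}"
  by (rule finite_subset[of _ "Pow T"]) (use assms in auto)

text \<open>For \<open>r \<le> card T\<close> this is the lattice of flats of the uniform matroid of
  rank \<open>r\<close> on \<open>T\<close> (\<open>flats_uniform\<close>); for
  \<open>r = card T\<close> it is all of \<open>Pow T\<close>.\<close>

definition trunc_lattice :: "'a set \<Rightarrow> nat \<Rightarrow> 'a set set" where
  "trunc_lattice T r = insert T {F. F \<subset> T \<and> card F < r}"

text \<open>The rank is raised by one, as if a new bottom element had been added: then the bounds for \<open>FY\<close>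
  below take the same form for the smallest set of a chain, and force the exponent of \<open>{}\<close> to be \<open>0\<close>.\<close>

definition rk :: "'a set \<Rightarrow> nat \<Rightarrow> 'a set \<Rightarrow> nat" where
  "rk T r F = (if F = T then Suc r else Suc (card F))"

definition FY :: "'a set \<Rightarrow> nat \<Rightarrow> ('a set \<Rightarrow> nat) set" where
  "FY T r = {a. (\<forall>F. F \<notin> trunc_lattice T r \<longrightarrow> a F = 0) \<and> (\<forall>F\<in>trunc_lattice T r. a F < rk T r F) \<and>
     (\<forall>F\<in>trunc_lattice T r. \<forall>G\<in>trunc_lattice T r. 0 < a F \<longrightarrow> 0 < a G \<longrightarrow>
        (F \<subseteq> G \<or> G \<subseteq> F) \<and> (G \<subset> F \<longrightarrow> a F + rk T r G < rk T r F))}"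

text \<open>Boolean exponents whose chain has top element exactly \<open>T\<close>; for
  \<open>T = {}\<close> the zero exponent stands for the empty chain. These are the objects that
  \<open>eul\<close> counts.\<close>

definition FY_top :: "'a set \<Rightarrow> ('a set \<Rightarrow> nat) set" where
  "FY_top T = {a \<in> FY T (card T). T \<noteq> {} \<longrightarrow> 0 < a T}"

definition FY_deg :: "'a set \<Rightarrow> nat \<Rightarrow> ('a set \<Rightarrow> nat) \<Rightarrow> nat" where
  "FY_deg T r a = (\<Sum>F\<in>trunc_lattice T r. a F)"

lemma trunc_lattice_card: "finite T \<Longrightarrow> trunc_lattice T (card T) = Pow T"
  by (auto simp: trunc_lattice_def intro!: psubset_card_mono)

lemma rk_card: "rk T (card T) F = Suc (card F)"
  by (simp add: rk_def)

lemma finite_trunc_lattice [simp]: "finite T \<Longrightarrow> finite (trunc_lattice T r)"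
  by (rule finite_subset[of _ "Pow T"]) (auto simp: trunc_lattice_def)

lemma FYD:
  assumes "a \<in> FY T r"
  shows "F \<notin> trunc_lattice T r \<Longrightarrow> a F = 0"
    and "F \<in> trunc_lattice T r \<Longrightarrow> a F < rk T r F"
    and "0 < a F \<Longrightarrow> 0 < a G \<Longrightarrow> F \<subseteq> G \<or> G \<subseteq> F"
    and "0 < a F \<Longrightarrow> 0 < a G \<Longrightarrow> G \<subset> F \<Longrightarrow> a F + rk T r G < rk T r F"
    and "0 < a F \<Longrightarrow> F \<in> trunc_lattice T r"
proof -
  have *: "(\<forall>F. F \<notin> trunc_lattice T r \<longrightarrow> a F = 0)" "(\<forall>F\<in>trunc_lattice T r. a F < rk T r F)"
    "\<forall>F\<in>trunc_lattice T r. \<forall>G\<in>trunc_lattice T r. 0 < a F \<longrightarrow> 0 < a G \<longrightarrow>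
        (F \<subseteq> G \<or> G \<subseteq> F) \<and> (G \<subset> F \<longrightarrow> a F + rk T r G < rk T r F)"
    using assms unfolding FY_def by simp_all
  show supp: "0 < a F \<Longrightarrow> F \<in> trunc_lattice T r" for F
    using *(1) by (metis less_irrefl)
  show "F \<notin> trunc_lattice T r \<Longrightarrow> a F = 0" "F \<in> trunc_lattice T r \<Longrightarrow> a F < rk T r F"
    using *(1,2) by auto
  show "0 < a F \<Longrightarrow> 0 < a G \<Longrightarrow> F \<subseteq> G \<or> G \<subseteq> F"
    and "0 < a F \<Longrightarrow> 0 < a G \<Longrightarrow> G \<subset> F \<Longrightarrow> a F + rk T r G < rk T r F"
    using *(3) supp by blast+
qed

lemma finite_FY [simp]:
  assumes "finite T"
  shows "finite (FY T r)"
proof (rule finite_subset)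
  let ?M = "\<Union>F\<in>trunc_lattice T r. {..<rk T r F}"
  show "FY T r \<subseteq> {a. \<forall>F. (F \<in> trunc_lattice T r \<longrightarrow> a F \<in> ?M) \<and> (F \<notin> trunc_lattice T r \<longrightarrow> a F = 0)}"
    using FYD(1,2) by fastforce
  show "finite {a. \<forall>F. (F \<in> trunc_lattice T r \<longrightarrow> a F \<in> ?M) \<and> (F \<notin> trunc_lattice T r \<longrightarrow> a F = 0)}"
    using assms by (intro finite_set_of_finite_funs) auto
qed

lemma finite_FY_top [simp]: "finite T \<Longrightarrow> finite (FY_top T)"
  unfolding FY_top_def by simp

lemma FY_topD:
  assumes "a \<in> FY_top D" "finite D"
  shows "0 < a F \<Longrightarrow> F \<subseteq> D" "a F < Suc (card F)"
    and "0 < a F \<Longrightarrow> 0 < a G \<Longrightarrow> F \<subseteq> G \<or> G \<subseteq> F"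
    and "0 < a F \<Longrightarrow> 0 < a G \<Longrightarrow> G \<subset> F \<Longrightarrow> a F + card G < card F"
    and "D \<noteq> {} \<Longrightarrow> 0 < a D"
proof -
  have a: "a \<in> FY D (card D)" and "D \<noteq> {} \<Longrightarrow> 0 < a D"
    using assms by (auto simp: FY_top_def)
  then show "D \<noteq> {} \<Longrightarrow> 0 < a D" by simp
  show sub: "0 < a F \<Longrightarrow> F \<subseteq> D"
    using FYD(5)[OF a] assms by (auto simp: trunc_lattice_card)
  show "a F < Suc (card F)"
    using FYD(2)[OF a, of F] sub assms by (cases "0 < a F") (auto simp: trunc_lattice_card rk_card)
  show "0 < a F \<Longrightarrow> 0 < a G \<Longrightarrow> F \<subseteq> G \<or> G \<subseteq> F"
    by (rule FYD(3)[OF a])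
  show "0 < a F \<Longrightarrow> 0 < a G \<Longrightarrow> G \<subset> F \<Longrightarrow> a F + card G < card F"
    using FYD(4)[OF a, of F G] by (simp add: rk_card)
qed

lemma FY_topI:
  assumes "finite D" "\<And>F. 0 < a F \<Longrightarrow> F \<subseteq> D" "\<And>F. a F < Suc (card F)"
    and "\<And>F G. 0 < a F \<Longrightarrow> 0 < a G \<Longrightarrow> F \<subseteq> G \<or> G \<subseteq> F"
    and "\<And>F G. 0 < a F \<Longrightarrow> 0 < a G \<Longrightarrow> G \<subset> F \<Longrightarrow> a F + card G < card F"
    and "D \<noteq> {} \<Longrightarrow> 0 < a D"
  shows "a \<in> FY_top D"
  using assms unfolding FY_top_def FY_def by (auto simp: trunc_lattice_card rk_card)

text \<open>If the support of \<open>a\<close> is a chain, this is its largest member strictly below \<open>T\<close>, or \<open>{}\<close> if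
  there is none.\<close>

definition below :: "'a set \<Rightarrow> ('a set \<Rightarrow> nat) \<Rightarrow> 'a set" where
  "below T a = \<Union>{F. F \<subset> T \<and> 0 < a F}"

text \<open>Exponents of \<open>T\<close> allowed above the largest proper member \<open>D\<close>.
  A nonempty \<open>D\<close> imposes \<open>c + card D < r\<close>; without one only
  \<open>c \<le> r\<close> remains, which adds the value \<open>r\<close>.\<close>

definition top_exps :: "nat \<Rightarrow> 'a set \<Rightarrow> nat set" where
  "top_exps r D = {..<r - card D} \<union> (if D = {} then {r} else {})"

text \<open>Every subset of the largest proper member has fewer than \<open>r\<close> elements and
  so is itself a flat. Hence below the top the exponent lives in a Boolean lattice that does not
  depend on \<open>r\<close>, and one factor \<open>eul x (card D)\<close> serves all ranks.\<close>

lemma FY_split: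
  assumes "finite T" "T \<noteq> {}" "0 < r" "a \<in> FY T r"
  shows "below T a \<subset> T" "card (below T a) < r"
    and "a T \<in> top_exps r (below T a)" "a(T := 0) \<in> FY_top (below T a)"
proof -
  let ?A = "{F. F \<subset> T \<and> 0 < a F}"
  note a = FYD[OF assms(4)]
  have fin: "finite ?A" using assms(1) by simp
  have chain: "subset.chain UNIV ?A" using a(3) by (auto simp: subset.chain_def)
  have D: "below T a \<in> ?A" if "?A \<noteq> {}"
    unfolding below_def using Union_in_chain[OF fin that chain] .
  have D0: "below T a = {}" if "?A = {}"
    using that unfolding below_def by (metis Union_empty)
  have Tne: "below T a \<subset> T \<and> card (below T a) < r \<and> a T \<in> top_exps r (below T a)"
  proof (cases "?A = {}")
    case True
    have "a T < Suc r" using a(2)[of T] by (simp add: trunc_lattice_def rk_def)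
    then show ?thesis using assms(2,3) D0[OF True] by (auto simp: top_exps_def)
  next
    case False
    note D = D[OF False]
    then have "card (below T a) < r" using a(5)[of "below T a"] by (auto simp: trunc_lattice_def)
    moreover have "a T + card (below T a) < r" if "0 < a T"
      using a(4)[of T "below T a"] D that less_imp_neq[of "below T a" T] by (simp add: rk_def)
    ultimately have "a T < r - card (below T a)" by (cases "a T = 0") auto
    then show ?thesis using D \<open>card (below T a) < r\<close> by (simp add: top_exps_def)
  qed
  then show "below T a \<subset> T" "card (below T a) < r" "a T \<in> top_exps r (below T a)" by auto
  show "a(T := 0) \<in> FY_top (below T a)"
  proof (rule FY_topI)
    show "finite (below T a)" using Tne assms(1) by (metis finite_subset psubset_imp_subset)
    show "F \<subseteq> below T a" if "0 < (a(T := 0)) F" for F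
      using that a(5)[of F] by (auto simp: below_def trunc_lattice_def split: if_splits)
    show "(a(T := 0)) F < Suc (card F)" for F
      using a(2)[of F] a(1)[of F] by (cases "F \<in> trunc_lattice T r"; cases "F = T") (simp_all add: rk_def)
    show "F \<subseteq> G \<or> G \<subseteq> F" if "0 < (a(T := 0)) F" "0 < (a(T := 0)) G" for F G
      using that a(3)[of F G] by (auto split: if_splits)
    show "(a(T := 0)) F + card G < card F" if "0 < (a(T := 0)) F" "0 < (a(T := 0)) G" "G \<subset> F" for F G
      using that a(4)[of F G] by (simp add: rk_def split: if_splits)
    show "0 < (a(T := 0)) (below T a)" if "below T a \<noteq> {}"
    proof -
      have "below T a \<in> ?A" using that D D0 by blast
      then have "0 < a (below T a)" "below T a \<noteq> T" by auto
      then show ?thesis by simp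
    qed
  qed
qed

lemma FY_join:
  assumes "finite T" "D \<subset> T" "card D < r" "a \<in> FY_top D" "c \<in> top_exps r D"
  shows "a(T := c) \<in> FY T r" "below T (a(T := c)) = D" "a T = 0"
proof -
  have fin: "finite D" using assms by (metis finite_subset psubset_imp_subset)
  note a = FY_topD[OF assms(4) fin]
  show aT: "a T = 0" using a(1)[of T] assms(2) by auto
  have L: "F \<in> trunc_lattice T r" "F \<subset> T" if "0 < a F" for F
    using a(1)[OF that] assms(2,3) card_mono[OF fin, of F] by (auto simp: trunc_lattice_def)
  have c: "c < Suc r" using assms(5) by (auto simp: top_exps_def split: if_splits)
  have cG: "c + card G < r" if "0 < a G" for G
  proof -
    have "D \<noteq> {}"
    proof
      assume "D = {}"
      then have "G = {}" using a(1)[OF that] by simp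
      then show False using a(2)[of G] that by simp
    qed
    then show ?thesis
      using assms(5) card_mono[OF fin a(1)[OF that]] by (simp add: top_exps_def)
  qed
  show "a(T := c) \<in> FY T r"
    unfolding FY_def
  proof (intro CollectI conjI allI ballI impI)
    show "(a(T := c)) F = 0" if "F \<notin> trunc_lattice T r" for F
      using that L(1)[of F] by (auto simp: trunc_lattice_def)
    show "(a(T := c)) F < rk T r F" for F
      using c a(2)[of F] by (simp add: rk_def)
    fix F G assume FG: "F \<in> trunc_lattice T r" "G \<in> trunc_lattice T r" "0 < (a(T := c)) F" "0 < (a(T := c)) G"
    show "F \<subseteq> G \<or> G \<subseteq> F"
      using FG a(3)[of F G] by (auto simp: trunc_lattice_def split: if_splits)
    show "(a(T := c)) F + rk T r G < rk T r F" if "G \<subset> F"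
      using that FG a(4)[of F G] cG[of G] L(2)[of F] by (auto simp: rk_def trunc_lattice_def split: if_splits)
  qed
  show "below T (a(T := c)) = D"
  proof (cases "D = {}")
    case True
    then have "a F = 0" for F using a(1)[of F] a(2)[of F] by (cases "F = {}") auto
    then show ?thesis using True by (auto simp: below_def)
  next
    case False
    have "F \<subseteq> D" if "F \<subset> T" "0 < (a(T := c)) F" for F
      using that a(1)[of F] by (simp split: if_splits)
    moreover have "0 < (a(T := c)) D" using a(5)[OF False] assms(2) by auto
    ultimately show ?thesis using assms(2) unfolding below_def by blast
  qed
qed

lemma sum_FY_split:
  assumes "finite T" "T \<noteq> {}" "0 < r"
  shows "(\<Sum>a\<in>FY T r. h (a T) (a(T := 0))) =
    (\<Sum>D | D \<subset> T \<and> card D < r. \<Sum>c\<in>top_exps r D. \<Sum>a\<in>FY_top D. h c a)"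
proof -
  let ?D = "{D. D \<subset> T \<and> card D < r}"
  have fin: "finite ?D"
    using assms(1) by simp
  have fin'': "finite (FY_top D)" if "D \<in> ?D" for D
    using that assms(1) finite_subset[of D T] by auto
  have fin': "finite (top_exps r D)" for D :: "'a set"
    by (simp add: top_exps_def)
  have "(\<Sum>a\<in>FY T r. h (a T) (a(T := 0))) =
      (\<Sum>(D, c, a)\<in>Sigma ?D (\<lambda>D. top_exps r D \<times> FY_top D). h c a)"
  proof (rule sum.reindex_bij_witness[of _ "\<lambda>(D, c, a). a(T := c)" "\<lambda>a. (below T a, a T, a(T := 0))"])
    fix x assume "x \<in> Sigma ?D (\<lambda>D. top_exps r D \<times> FY_top D)"
    then obtain D c a where "x = (D, c, a)" "D \<subset> T" "card D < r" "c \<in> top_exps r D" "a \<in> FY_top D"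
      by auto
    then show "(\<lambda>a. (below T a, a T, a(T := 0))) ((\<lambda>(D, c, a). a(T := c)) x) = x"
      "(\<lambda>(D, c, a). a(T := c)) x \<in> FY T r"
      using FY_join[of T D r a c] assms by (auto simp: fun_upd_idem_iff)
  qed (use FY_split[OF assms] in auto)
  also have "\<dots> = (\<Sum>D\<in>?D. \<Sum>(c, a)\<in>top_exps r D \<times> FY_top D. h c a)"
    using fin fin' fin'' by (intro sum.Sigma[symmetric]) auto
  also have "\<dots> = (\<Sum>D\<in>?D. \<Sum>c\<in>top_exps r D. \<Sum>a\<in>FY_top D. h c a)"
    by (simp add: sum.cartesian_product)
  finally show ?thesis .
qed

lemma sum_card_proper_subsets:
  fixes g :: "nat \<Rightarrow> 'b::comm_semiring_1"
  assumes "finite T" "r \<le> card T"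
  shows "(\<Sum>D | D \<subset> T \<and> card D < r. g (card D)) = (\<Sum>d<r. of_nat (card T choose d) * g d)"
proof -
  have eq: "{D. D \<subset> T \<and> card D < r} = {D. D \<subseteq> T \<and> card D < r}"
    using assms by auto
  have "(\<Sum>D | D \<subseteq> T \<and> card D < r. g (card D)) =
      (\<Sum>d<r. \<Sum>D | D \<in> {D. D \<subseteq> T \<and> card D < r} \<and> card D = d. g (card D))"
    using assms(1) by (intro sum.group[symmetric]) (auto simp flip: eq)
  also have "\<dots> = (\<Sum>d<r. of_nat (card T choose d) * g d)"
  proof (intro sum.cong refl)
    fix d assume "d \<in> {..<r}"
    then have "{D. D \<in> {D. D \<subseteq> T \<and> card D < r} \<and> card D = d} = {D. D \<subseteq> T \<and> card D = d}" by auto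
    then show "(\<Sum>D | D \<in> {D. D \<subseteq> T \<and> card D < r} \<and> card D = d. g (card D)) = of_nat (card T choose d) * g d"
      using n_subsets[OF assms(1), of d] by simp
  qed
  finally show ?thesis by (simp only: eq)
qed

lemma FY_deg_upd:
  assumes "finite T" "D \<subset> T" "card D < r" "a \<in> FY_top D"
  shows "FY_deg T r (a(T := c)) = c + FY_deg D (card D) a"
proof -
  have fin: "finite D" using assms by (metis finite_subset psubset_imp_subset)
  note a = FY_topD[OF assms(4) fin]
  have "FY_deg T r (a(T := c)) = c + (\<Sum>F\<in>trunc_lattice T r - {T}. (a(T := c)) F)"
    unfolding FY_deg_def using assms(1) by (subst sum.remove[of _ T]) (auto simp: trunc_lattice_def)
  also have "(\<Sum>F\<in>trunc_lattice T r - {T}. (a(T := c)) F) = (\<Sum>F\<in>trunc_lattice T r - {T}. a F)"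
    by (intro sum.cong) auto
  also have "\<dots> = (\<Sum>F\<in>Pow D. a F)"
  proof (rule sum.mono_neutral_right)
    show "Pow D \<subseteq> trunc_lattice T r - {T}"
    proof
      fix F assume "F \<in> Pow D"
      then have "F \<subset> T" "card F \<le> card D" using assms(2) card_mono[OF fin, of F] by auto
      then show "F \<in> trunc_lattice T r - {T}" using assms(3) by (simp add: trunc_lattice_def)
    qed
    show "\<forall>F\<in>trunc_lattice T r - {T} - Pow D. a F = 0" using a(1) by auto
  qed (use assms(1) in auto)
  finally show ?thesis by (simp add: FY_deg_def trunc_lattice_card[OF fin])
qed

text \<open>The weight \<open>h\<close> of the exponent at \<open>T\<close> is left open to cover
  two uses: \<open>h c = x ^ c\<close> gives \<open>chow_poly\<close>, and changing its value at 0
  to 0 forces \<open>T\<close> into the chain and gives \<open>eul\<close>.\<close>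

lemma sum_FY_weight:
  fixes x :: "'b::comm_ring_1" and h :: "nat \<Rightarrow> 'b"
  assumes "finite T" "T \<noteq> {}" "0 < r" "r \<le> card T"
    and IH: "\<And>D. D \<subset> T \<Longrightarrow> (\<Sum>a\<in>FY_top D. x ^ FY_deg D (card D) a) = eul x (card D)"
  shows "(\<Sum>a\<in>FY T r. h (a T) * x ^ FY_deg T r (a(T := 0))) =
    h r + (\<Sum>d<r. of_nat (card T choose d) * eul x d * (\<Sum>c<r - d. h c))"
proof -
  let ?D = "{D. D \<subset> T \<and> card D < r}"
  have "(\<Sum>a\<in>FY T r. h (a T) * x ^ FY_deg T r (a(T := 0))) =
      (\<Sum>D\<in>?D. \<Sum>c\<in>top_exps r D. \<Sum>a\<in>FY_top D. h c * x ^ FY_deg T r a)"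
    by (rule sum_FY_split[OF assms(1-3)])
  also have "\<dots> = (\<Sum>D\<in>?D. \<Sum>c\<in>top_exps r D. h c * eul x (card D))"
  proof (intro sum.cong refl)
    fix D c assume D: "D \<in> ?D"
    have "FY_deg T r a = FY_deg D (card D) a" if "a \<in> FY_top D" for a
    proof -
      have "a T = 0" using FY_topD(1)[OF that, of T] D assms(1) by (auto intro: finite_subset)
      then show ?thesis using FY_deg_upd[of T D r a 0] D that assms(1) by (simp add: fun_upd_idem)
    qed
    then show "(\<Sum>a\<in>FY_top D. h c * x ^ FY_deg T r a) = h c * eul x (card D)"
      using IH[of D] D by (simp flip: sum_distrib_left)
  qed
  also have "\<dots> = (\<Sum>D\<in>?D. eul x (card D) * (\<Sum>c<r - card D. h c) + (if D = {} then h r else 0))"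
  proof (intro sum.cong refl)
    fix D :: "'a set"
    have "(\<Sum>c\<in>top_exps r D. h c) = (\<Sum>c<r - card D. h c) + (if D = {} then h r else 0)"
      by (auto simp: top_exps_def)
    then show "(\<Sum>c\<in>top_exps r D. h c * eul x (card D)) =
        eul x (card D) * (\<Sum>c<r - card D. h c) + (if D = {} then h r else 0)"
      by (simp add: sum_distrib_right[symmetric] algebra_simps)
  qed
  also have "\<dots> = (\<Sum>D\<in>?D. eul x (card D) * (\<Sum>c<r - card D. h c)) + h r"
  proof -
    have "finite ?D" "{} \<in> ?D"
      using assms(1-3) by auto
    then show ?thesis by (simp add: sum.distrib sum.delta)
  qed
  also have "(\<Sum>D\<in>?D. eul x (card D) * (\<Sum>c<r - card D. h c)) =
      (\<Sum>d<r. of_nat (card T choose d) * (eul x d * (\<Sum>c<r - d. h c)))"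
    by (rule sum_card_proper_subsets[OF assms(1,4)])
  finally show ?thesis by (simp add: mult.assoc add.commute fun_upd_def)
qed

lemma FY_deg_split:
  assumes "finite T"
  shows "FY_deg T r a = a T + FY_deg T r (a(T := 0))"
proof -
  have T: "T \<in> trunc_lattice T r" by (simp add: trunc_lattice_def)
  have "(\<Sum>F\<in>trunc_lattice T r - {T}. a F) = (\<Sum>F\<in>trunc_lattice T r - {T}. (a(T := 0)) F)"
    by (intro sum.cong) auto
  then show ?thesis
    unfolding FY_deg_def using assms T by (subst (1 2) sum.remove[of _ T]) auto
qed

lemma sum_FY_top:
  fixes x :: "'b::comm_ring_1"
  assumes "finite T"
  shows "(\<Sum>a\<in>FY_top T. x ^ FY_deg T (card T) a) = eul x (card T)"
  using assms
proof (induction rule: finite_psubset_induct)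
  case (psubset T)
  show ?case
  proof (cases "T = {}")
    case True
    have "FY_top {} = {\<lambda>_ :: 'a set. 0}"
    proof (intro equalityI subsetI)
      fix a :: "'a set \<Rightarrow> nat" assume "a \<in> FY_top {}"
      note a = FY_topD[OF this]
      have "a F = 0" for F using a(1)[of F] a(2)[of F] by (cases "F = {}") auto
      then show "a \<in> {\<lambda>_. 0}" by auto
    qed (auto intro!: FY_topI)
    then show ?thesis using True by (simp add: FY_deg_def)
  next
    case False
    let ?h = "\<lambda>c. if c = 0 then 0 else x ^ c"
    have fin: "finite (FY T (card T))" using psubset.hyps by simp
    have "(\<Sum>a\<in>FY_top T. x ^ FY_deg T (card T) a) =
        (\<Sum>a\<in>FY T (card T). ?h (a T) * x ^ FY_deg T (card T) (a(T := 0)))"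
    proof (rule sum.mono_neutral_cong_left)
      show "x ^ FY_deg T (card T) a = ?h (a T) * x ^ FY_deg T (card T) (a(T := 0))"
        if "a \<in> FY_top T" for a
        using that False unfolding FY_top_def
        by (subst FY_deg_split[OF psubset.hyps]) (simp add: power_add)
    qed (use fin False in \<open>auto simp: FY_top_def\<close>)
    also have "\<dots> = ?h (card T) + (\<Sum>d<card T. of_nat (card T choose d) * eul x d * (\<Sum>c<card T - d. ?h c))"
      using psubset.hyps False by (intro sum_FY_weight psubset.IH) (auto simp: card_gt_0_iff)
    also have "\<dots> = eul x (card T)"
    proof -
      have h: "(\<Sum>c<m. ?h c) = (\<Sum>c=1..<m. x ^ c)" for m
        by (rule sum.mono_neutral_cong_right) auto
      show ?thesis
        using False psubset.hyps unfolding h by (subst (2) eul.simps) simp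
    qed
    finally show ?thesis .
  qed
qed

lemma sum_FY:
  fixes x :: "'b::comm_ring_1"
  assumes "finite T" "0 < r" "r \<le> card T"
  shows "(\<Sum>a\<in>FY T r. x ^ FY_deg T r a) = chow_poly x r (card T)"
proof -
  have "T \<noteq> {}" using assms by auto
  have "(\<Sum>a\<in>FY T r. x ^ FY_deg T r a) = (\<Sum>a\<in>FY T r. x ^ a T * x ^ FY_deg T r (a(T := 0)))"
    by (intro sum.cong refl, subst FY_deg_split[OF assms(1)]) (simp add: power_add)
  also have "\<dots> = x ^ r + (\<Sum>d<r. of_nat (card T choose d) * eul x d * (\<Sum>c<r - d. x ^ c))"
    using assms \<open>T \<noteq> {}\<close> by (intro sum_FY_weight) (auto intro: sum_FY_top finite_subset)
  finally show ?thesis by (simp add: chow_poly_def)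
qed

section \<open>The number of FY monomials in the Boolean case\<close>

lemma binomial_mult_fact: "d \<le> m \<Longrightarrow> of_nat (m choose d) * fact d = (fact m / fact (m - d) :: real)"
  by (simp add: binomial_fact)

lemma fact_div_fact_Suc: "M / fact e = (M / fact (Suc e)) * real (Suc e)"
  by simp

text \<open>At \<open>x = 1\<close> the recursion telescopes, because \<open>(m choose d) * d! * (m
  - d - 1) = m! / (m - d - 1)! - m! / (m - d)!\<close>.\<close>

lemma eul_1: "eul (1 :: real) m = fact m"
proof (induction m rule: less_induct)
  case (less m)
  define h where "h d = (fact m / fact (m - d) :: real)" for d
  have "eul 1 m = 1 + (\<Sum>d<m. of_nat (m choose d) * fact d * real (m - d - 1))"
    using less by (subst eul.simps) simp
  also have "(\<Sum>d<m. of_nat (m choose d) * fact d * real (m - d - 1)) = (\<Sum>d<m. h (Suc d) - h d)"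
  proof (intro sum.cong refl)
    fix d assume "d \<in> {..<m}"
    then obtain e where e: "m = Suc (d + e)" by (auto dest: less_imp_Suc_add)
    then have d: "m - d = Suc e" "m - Suc d = e" "d \<le> m" by auto
    show "of_nat (m choose d) * fact d * real (m - d - 1) = h (Suc d) - h d"
      using fact_div_fact_Suc[of "fact m" e] binomial_mult_fact[of d m] d
      by (simp add: h_def algebra_simps add_divide_distrib del: fact_Suc)
  qed
  also have "\<dots> = h m - h 0" by (rule sum_lessThan_telescope)
  finally show ?case by (simp add: h_def)
qed

lemma chow_poly_1: "chow_poly (1 :: real) n n = (\<Sum>d\<le>n. fact n / fact (n - d))"
proof -
  have "chow_poly (1 :: real) n n = 1 + (\<Sum>d<n. of_nat (n choose d) * fact d * real (n - d))"
    by (simp add: chow_poly_def eul_1)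
  also have "(\<Sum>d<n. of_nat (n choose d) * fact d * real (n - d)) = (\<Sum>d<n. fact n / fact (n - Suc d))"
  proof (intro sum.cong refl)
    fix d assume "d \<in> {..<n}"
    then obtain e where e: "n = Suc (d + e)" by (auto dest: less_imp_Suc_add)
    then have d: "n - d = Suc e" "n - Suc d = e" "d \<le> n" by auto
    show "of_nat (n choose d) * fact d * real (n - d) = fact n / fact (n - Suc d)"
      using fact_div_fact_Suc[of "fact n" e] binomial_mult_fact[of d n] d
      by (simp add: algebra_simps add_divide_distrib del: fact_Suc)
  qed
  also have "1 + \<dots> = (\<Sum>d\<le>n. fact n / fact (n - d) :: real)"
    by (simp add: sum.atMost_shift)
  finally show ?thesis .
qed

text \<open>Both sides equal the sum of the falling factorials \<open>n! / (n - d)!\<close>, the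
  left one by putting \<open>x = 1\<close> in \<open>sum_FY\<close>. The lists will index the
  evaluation points.\<close>

lemma card_FY_eq_card_distinct_lists:
  assumes "finite T" "T \<noteq> {}"
  shows "card (FY T (card T)) = card {xs. distinct xs \<and> set xs \<subseteq> T}"
proof -
  let ?n = "card T"
  have "real (card (FY T ?n)) = (\<Sum>d\<le>?n. fact ?n / fact (?n - d))"
  proof -
    have "(\<Sum>a\<in>FY T ?n. 1 ^ FY_deg T ?n a) = chow_poly (1 :: real) ?n ?n"
      using assms by (intro sum_FY) (auto simp: card_gt_0_iff)
    then show ?thesis unfolding chow_poly_1 by simp
  qed
  also have "\<dots> = (\<Sum>d\<le>?n. real (card {xs. length xs = d \<and> distinct xs \<and> set xs \<subseteq> T}))"
  proof (intro sum.cong refl)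
    fix d assume d: "d \<in> {..?n}"
    let ?c = "card {xs. length xs = d \<and> distinct xs \<and> set xs \<subseteq> T}"
    have "fact ?n = fact (?n - d) * ?c"
      using d card_lists_distinct_length_eq[OF assms(1), of d] fact_eq_fact_times[of "?n - d" ?n] by simp
    from arg_cong[OF this, of real] have "(fact ?n :: real) = fact (?n - d) * real ?c"
      by (simp only: of_nat_mult of_nat_fact)
    then show "fact ?n / fact (?n - d) = real ?c" by simp
  qed
  also have "\<dots> = real (card (\<Union>d\<in>{..?n}. {xs. length xs = d \<and> distinct xs \<and> set xs \<subseteq> T}))"
    using assms by (subst card_UN_disjoint) (auto intro: finite_subset[OF _ finite_lists_length_eq])
  also have "(\<Union>d\<in>{..?n}. {xs. length xs = d \<and> distinct xs \<and> set xs \<subseteq> T}) = {xs. distinct xs \<and> set xs \<subseteq> T}"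
    using assms by (auto dest: card_mono simp: distinct_card)
  finally show ?thesis by simp
qed

section \<open>Polynomials as finitely supported maps\<close>

lemma vector_space_qscale: "vector_space qscale"
  by unfold_locales
     (simp_all add: qscale_def distrib_left distrib_right single_add mult_single flip: mult.assoc)

interpretation mpoly: vector_space qscale
  by (rule vector_space_qscale)

lemma qscale_mult_right: "p * qscale c q = qscale c (p * q)"
  by (simp add: qscale_def mult.left_commute)

lemma qscale_single: "qscale c (Poly_Mapping.single m d) = Poly_Mapping.single m (c * d)"
  by (simp add: qscale_def mult_single)

lemma sum_single_lookup: "(\<Sum>m\<in>Poly_Mapping.keys p. Poly_Mapping.single m (Poly_Mapping.lookup p m)) = p"
  by (rule poly_mapping_eqI) (simp add: lookup_sum lookup_single when_def in_keys_iff)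

lemma sum_keys_superset:
  assumes "finite S" "Poly_Mapping.keys m \<subseteq> S" "\<And>v. f v 0 = 0"
  shows "(\<Sum>v\<in>Poly_Mapping.keys m. f v (Poly_Mapping.lookup m v)) = (\<Sum>v\<in>S. f v (Poly_Mapping.lookup m v))"
  using assms by (intro sum.mono_neutral_left) (auto simp: in_keys_iff)

lemma mon_deg_superset:
  assumes "finite S" "Poly_Mapping.keys m \<subseteq> S"
  shows "mon_deg m = (\<Sum>v\<in>S. Poly_Mapping.lookup m v)"
  unfolding mon_deg_def using sum_keys_superset[OF assms, of "\<lambda>_ c. c"] by simp

lemma keys_add_nat: "Poly_Mapping.keys (m + m') = Poly_Mapping.keys m \<union> Poly_Mapping.keys (m' :: 'v \<Rightarrow>\<^sub>0 nat)"
  by (auto simp: in_keys_iff lookup_add)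

lemma mon_deg_add: "mon_deg (m + m') = mon_deg m + mon_deg m'"
proof -
  let ?S = "Poly_Mapping.keys m \<union> Poly_Mapping.keys m'"
  have "mon_deg p = (\<Sum>v\<in>?S. Poly_Mapping.lookup p v)" if "Poly_Mapping.keys p \<subseteq> ?S" for p
    using that by (intro mon_deg_superset) auto
  then show ?thesis by (simp add: keys_add_nat lookup_add sum.distrib)
qed

lemma mon_deg_single [simp]: "mon_deg (Poly_Mapping.single v c) = c"
  by (cases "c = 0") (simp_all add: mon_deg_def)

lemma mon_deg_0 [simp]: "mon_deg 0 = 0"
  by (simp add: mon_deg_def)

lemma mon_deg_eq_0_iff: "mon_deg m = 0 \<longleftrightarrow> m = 0"
  by (auto simp: mon_deg_def in_keys_iff intro!: poly_mapping_eqI)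

lemma finite_monomials:
  assumes "finite V"
  shows "finite {m :: 'v \<Rightarrow>\<^sub>0 nat. Poly_Mapping.keys m \<subseteq> V \<and> mon_deg m = j}"
proof -
  let ?M = "{m :: 'v \<Rightarrow>\<^sub>0 nat. Poly_Mapping.keys m \<subseteq> V \<and> mon_deg m = j}"
  have "Poly_Mapping.lookup m v \<le> mon_deg m" for m :: "'v \<Rightarrow>\<^sub>0 nat" and v
    by (cases "v \<in> Poly_Mapping.keys m") (auto simp: mon_deg_def in_keys_iff intro: member_le_sum)
  then have "Poly_Mapping.lookup ` ?M \<subseteq> {f. \<forall>v. (v \<in> V \<longrightarrow> f v \<in> {..j}) \<and> (v \<notin> V \<longrightarrow> f v = 0)}"
    by (auto simp: in_keys_iff)
  moreover have "finite {f. \<forall>v. (v \<in> V \<longrightarrow> f v \<in> {..j}) \<and> (v \<notin> V \<longrightarrow> f v = (0 :: nat))}"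
    using assms by (intro finite_set_of_finite_funs) auto
  ultimately have "finite (Poly_Mapping.lookup ` ?M)" by (rule finite_subset)
  then show ?thesis
    by (rule finite_imageD) (metis inj_onI poly_mapping_eq_iff)
qed

lemma poly_ring_closed [intro]:
  shows poly_ring_0: "0 \<in> poly_ring V"
    and poly_ring_1: "1 \<in> poly_ring V"
    and poly_ring_const: "Poly_Mapping.single 0 c \<in> poly_ring V"
    and poly_ring_mvar: "v \<in> V \<Longrightarrow> mvar v \<in> poly_ring V"
    and poly_ring_add: "p \<in> poly_ring V \<Longrightarrow> q \<in> poly_ring V \<Longrightarrow> p + q \<in> poly_ring V"
    and poly_ring_uminus: "p \<in> poly_ring V \<Longrightarrow> - p \<in> poly_ring V"
    and poly_ring_mult: "p \<in> poly_ring V \<Longrightarrow> q \<in> poly_ring V \<Longrightarrow> p * q \<in> poly_ring V"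
proof -
  show "p + q \<in> poly_ring V" if "p \<in> poly_ring V" "q \<in> poly_ring V"
    using that Poly_Mapping.keys_add[of p q] by (auto simp: poly_ring_def)
  show "p * q \<in> poly_ring V" if "p \<in> poly_ring V" "q \<in> poly_ring V"
    using that Poly_Mapping.keys_mult[of p q] unfolding poly_ring_def by (fastforce simp: keys_add_nat)
qed (auto simp: poly_ring_def mvar_def)

lemma poly_ring_diff [intro]: "p \<in> poly_ring V \<Longrightarrow> q \<in> poly_ring V \<Longrightarrow> p - q \<in> poly_ring V"
  using poly_ring_add[of p V "- q"] by auto

lemma poly_ring_qscale [intro]: "p \<in> poly_ring V \<Longrightarrow> qscale c p \<in> poly_ring V"
  by (auto simp: qscale_def)

lemma poly_ring_sum [intro]: "(\<And>i. i \<in> A \<Longrightarrow> f i \<in> poly_ring V) \<Longrightarrow> sum f A \<in> poly_ring V"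
  by (induction A rule: infinite_finite_induct) auto

lemma poly_ring_power [intro]: "p \<in> poly_ring V \<Longrightarrow> p ^ m \<in> poly_ring V"
  by (induction m) auto

lemma poly_ring_prod [intro]: "(\<And>i. i \<in> A \<Longrightarrow> f i \<in> poly_ring V) \<Longrightarrow> prod f A \<in> poly_ring V"
  by (induction A rule: infinite_finite_induct) auto

lemma poly_ring_mono: "V \<subseteq> W \<Longrightarrow> poly_ring V \<subseteq> poly_ring W"
  by (auto simp: poly_ring_def)

lemma homogD: "p \<in> homog V j \<Longrightarrow> m \<in> Poly_Mapping.keys p \<Longrightarrow> mon_deg m = j \<and> Poly_Mapping.keys m \<subseteq> V"
  by (auto simp: homog_def poly_ring_def)

lemma homog_single: "Poly_Mapping.keys m \<subseteq> V \<Longrightarrow> mon_deg m = j \<Longrightarrow> Poly_Mapping.single m c \<in> homog V j"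
  by (auto simp: homog_def poly_ring_def)

lemma homog_mvar: "v \<in> V \<Longrightarrow> mvar v \<in> homog V 1"
  by (auto simp: mvar_def intro!: homog_single)

lemma homog_1: "1 \<in> homog V 0"
  using homog_single[of 0 V 0 1] by simp

lemma subspace_homog: "mpoly.subspace (homog V j)"
proof (rule mpoly.subspaceI)
  show "p + q \<in> homog V j" if "p \<in> homog V j" "q \<in> homog V j" for p q
    using that Poly_Mapping.keys_add[of p q] by (auto simp: homog_def)
  show "qscale c p \<in> homog V j" if "p \<in> homog V j" for c p
  proof -
    have "Poly_Mapping.keys (qscale c p) \<subseteq> Poly_Mapping.keys p"
      using Poly_Mapping.keys_mult[of "Poly_Mapping.single 0 c" p] by (auto simp: qscale_def split: if_splits)
    then show ?thesis using that by (auto simp: homog_def)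
  qed
qed (auto simp: homog_def)

lemma homog_mult: "p \<in> homog V i \<Longrightarrow> q \<in> homog V j \<Longrightarrow> p * q \<in> homog V (i + j)"
  using Poly_Mapping.keys_mult[of p q] by (fastforce simp: homog_def mon_deg_add)

lemma homog_power: "p \<in> homog V i \<Longrightarrow> p ^ m \<in> homog V (i * m)"
  by (induction m) (auto simp: homog_1 intro: homog_mult)

lemma homog_prod: "(\<And>i. i \<in> A \<Longrightarrow> f i \<in> homog V (d i)) \<Longrightarrow> prod f A \<in> homog V (sum d A)"
  by (induction A rule: infinite_finite_induct) (auto simp: homog_1 intro: homog_mult)

lemma homog_spanned:
  "homog V j \<subseteq> mpoly.span ((\<lambda>m. Poly_Mapping.single m 1) ` {m. Poly_Mapping.keys m \<subseteq> V \<and> mon_deg m = j})"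
proof
  fix p assume p: "p \<in> homog V j"
  have "(\<Sum>m\<in>Poly_Mapping.keys p. qscale (Poly_Mapping.lookup p m) (Poly_Mapping.single m 1)) \<in>
      mpoly.span ((\<lambda>m. Poly_Mapping.single m 1) ` {m. Poly_Mapping.keys m \<subseteq> V \<and> mon_deg m = j})"
    using homogD[OF p] by (intro mpoly.span_sum mpoly.span_scale mpoly.span_base) auto
  then show "p \<in> mpoly.span ((\<lambda>m. Poly_Mapping.single m 1) ` {m. Poly_Mapping.keys m \<subseteq> V \<and> mon_deg m = j})"
    by (simp add: qscale_single sum_single_lookup)
qed

section \<open>Homogeneous components\<close>

definition hcomp :: "nat \<Rightarrow> (('v \<Rightarrow>\<^sub>0 nat) \<Rightarrow>\<^sub>0 rat) \<Rightarrow> (('v \<Rightarrow>\<^sub>0 nat) \<Rightarrow>\<^sub>0 rat)" where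
  "hcomp j p = Poly_Mapping.mapp (\<lambda>m c. if mon_deg m = j then c else 0) p"

lemma lookup_hcomp: "Poly_Mapping.lookup (hcomp j p) m = (if mon_deg m = j then Poly_Mapping.lookup p m else 0)"
  by (simp add: hcomp_def lookup_mapp when_def in_keys_iff)

lemma keys_hcomp: "Poly_Mapping.keys (hcomp j p) = {m \<in> Poly_Mapping.keys p. mon_deg m = j}"
  by (auto simp: in_keys_iff lookup_hcomp split: if_splits)

lemma hcomp_homog: "p \<in> poly_ring V \<Longrightarrow> hcomp j p \<in> homog V j"
  by (auto simp: homog_def poly_ring_def keys_hcomp)

lemma hcomp_add: "hcomp j (p + q) = hcomp j p + hcomp j q"
  by (rule poly_mapping_eqI) (simp add: lookup_hcomp lookup_add)

lemma hcomp_0 [simp]: "hcomp j 0 = 0"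
  by (rule poly_mapping_eqI) (simp add: lookup_hcomp)

lemma hcomp_sum: "hcomp j (sum f A) = (\<Sum>a\<in>A. hcomp j (f a))"
  by (induction A rule: infinite_finite_induct) (auto simp: hcomp_add)

lemma hcomp_of_homog: "p \<in> homog V i \<Longrightarrow> hcomp j p = (if i = j then p else 0)"
  by (rule poly_mapping_eqI) (auto simp: lookup_hcomp homog_def in_keys_iff)

lemma sum_hcomp:
  assumes "p \<in> poly_ring V"
  shows "p = (\<Sum>j\<in>mon_deg ` Poly_Mapping.keys p. hcomp j p)"
proof (rule poly_mapping_eqI)
  fix m
  have "(\<Sum>j\<in>mon_deg ` Poly_Mapping.keys p. Poly_Mapping.lookup (hcomp j p) m)
      = (\<Sum>j\<in>mon_deg ` Poly_Mapping.keys p. if mon_deg m = j then Poly_Mapping.lookup p m else 0)"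
    by (simp add: lookup_hcomp)
  also have "\<dots> = Poly_Mapping.lookup p m"
    by (auto simp: sum.delta' in_keys_iff)
  finally show "Poly_Mapping.lookup p m = Poly_Mapping.lookup (\<Sum>j\<in>mon_deg ` Poly_Mapping.keys p. hcomp j p) m"
    by (simp add: lookup_sum)
qed

lemma hcomp_mult_homog:
  assumes "p \<in> poly_ring V" "g \<in> homog V d"
  shows "hcomp j (p * g) = (if d \<le> j then hcomp (j - d) p * g else 0)"
proof -
  let ?D = "mon_deg ` Poly_Mapping.keys p"
  have "hcomp j (p * g) = (\<Sum>i\<in>?D. hcomp j (hcomp i p * g))"
    by (subst sum_hcomp[OF assms(1)]) (simp add: sum_distrib_right hcomp_sum)
  also have "\<dots> = (\<Sum>i\<in>?D. if i + d = j then hcomp i p * g else 0)"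
    using hcomp_of_homog[OF homog_mult[OF hcomp_homog[OF assms(1)] assms(2)]] by simp
  also have "\<dots> = (\<Sum>i\<in>?D. if i = j - d then (if d \<le> j then hcomp i p * g else 0) else 0)"
    by (intro sum.cong) auto
  also have "\<dots> = (if j - d \<in> ?D then (if d \<le> j then hcomp (j - d) p * g else 0) else 0)"
    by (simp add: sum.delta)
  also have "\<dots> = (if d \<le> j then hcomp (j - d) p * g else 0)"
  proof (cases "j - d \<in> ?D")
    case False
    then have "hcomp (j - d) p = 0"
      by (intro poly_mapping_eqI) (metis imageI in_keys_iff lookup_hcomp lookup_zero)
    then show ?thesis by simp
  qed simp
  finally show ?thesis .
qed

section \<open>Evaluation at rational points\<close>

definition eval_monom :: "('v \<Rightarrow> rat) \<Rightarrow> ('v \<Rightarrow>\<^sub>0 nat) \<Rightarrow> rat" where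
  "eval_monom u m = (\<Prod>v\<in>Poly_Mapping.keys m. u v ^ Poly_Mapping.lookup m v)"

definition eval_mpoly :: "('v \<Rightarrow> rat) \<Rightarrow> (('v \<Rightarrow>\<^sub>0 nat) \<Rightarrow>\<^sub>0 rat) \<Rightarrow> rat" where
  "eval_mpoly u p = (\<Sum>m\<in>Poly_Mapping.keys p. Poly_Mapping.lookup p m * eval_monom u m)"

lemma eval_monom_add: "eval_monom u (m + m') = eval_monom u m * eval_monom u m'"
proof -
  let ?S = "Poly_Mapping.keys m \<union> Poly_Mapping.keys m'"
  have "eval_monom u p = (\<Prod>v\<in>?S. u v ^ Poly_Mapping.lookup p v)" if "Poly_Mapping.keys p \<subseteq> ?S" for p
    unfolding eval_monom_def using that by (intro prod.mono_neutral_left) (auto simp: in_keys_iff)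
  then show ?thesis by (simp add: keys_add_nat lookup_add power_add prod.distrib)
qed

lemma eval_mpoly_add: "eval_mpoly u (p + q) = eval_mpoly u p + eval_mpoly u q"
proof -
  let ?S = "Poly_Mapping.keys p \<union> Poly_Mapping.keys q"
  have "eval_mpoly u g = (\<Sum>m\<in>?S. Poly_Mapping.lookup g m * eval_monom u m)"
    if "Poly_Mapping.keys g \<subseteq> ?S" for g
    unfolding eval_mpoly_def using that by (intro sum.mono_neutral_left) (auto simp: in_keys_iff)
  then show ?thesis
    using Poly_Mapping.keys_add[of p q] by (simp add: lookup_add distrib_right sum.distrib)
qed

lemma eval_mpoly_single: "eval_mpoly u (Poly_Mapping.single m c) = c * eval_monom u m"
  by (simp add: eval_mpoly_def)

lemma eval_mpoly_0 [simp]: "eval_mpoly u 0 = 0"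
  by (simp add: eval_mpoly_def)

lemma eval_mpoly_const [simp]: "eval_mpoly u (Poly_Mapping.single 0 c) = c"
  by (simp add: eval_mpoly_single eval_monom_def)

lemma eval_mpoly_1 [simp]: "eval_mpoly u 1 = 1"
  using eval_mpoly_const[of u 1] by simp

lemma eval_mpoly_mvar [simp]: "eval_mpoly u (mvar v) = u v"
  by (simp add: mvar_def eval_mpoly_single eval_monom_def)

lemma eval_mpoly_sum: "eval_mpoly u (sum f A) = (\<Sum>a\<in>A. eval_mpoly u (f a))"
  by (induction A rule: infinite_finite_induct) (auto simp: eval_mpoly_add)

lemma eval_mpoly_mult: "eval_mpoly u (p * q) = eval_mpoly u p * eval_mpoly u q"
proof -
  have "p * q = (\<Sum>m\<in>Poly_Mapping.keys p. \<Sum>m'\<in>Poly_Mapping.keys q.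
      Poly_Mapping.single (m + m') (Poly_Mapping.lookup p m * Poly_Mapping.lookup q m'))"
    by (subst (1 2) sum_single_lookup[symmetric]) (simp add: sum_product mult_single)
  then show ?thesis
    unfolding eval_mpoly_def[of u p] eval_mpoly_def[of u q] sum_product
    by (simp add: eval_mpoly_sum eval_mpoly_single eval_monom_add mult_ac)
qed

lemma eval_mpoly_qscale: "eval_mpoly u (qscale c p) = c * eval_mpoly u p"
  by (simp add: qscale_def eval_mpoly_mult)

lemma eval_mpoly_diff: "eval_mpoly u (p - q) = eval_mpoly u p - eval_mpoly u q"
  using eval_mpoly_add[of u "p - q" q] by simp

lemma eval_mpoly_prod: "eval_mpoly u (prod f A) = (\<Prod>a\<in>A. eval_mpoly u (f a))"
  by (induction A rule: infinite_finite_induct) (auto simp: eval_mpoly_mult)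

section \<open>Ideals given by generators\<close>

lemma ideal_gen_base: "g \<in> G \<Longrightarrow> g \<in> ideal_gen V G"
  unfolding ideal_gen_def by (auto intro!: exI[of _ "{g}"] exI[of _ "\<lambda>_. 1"])

lemma ideal_gen_0: "0 \<in> ideal_gen V G"
  unfolding ideal_gen_def by (auto intro!: exI[of _ "{}"])

lemma ideal_gen_add:
  assumes "p \<in> ideal_gen V G" "q \<in> ideal_gen V G"
  shows "p + q \<in> ideal_gen V G"
proof -
  obtain S c where S: "p = (\<Sum>g\<in>S. c g * g)" "finite S" "S \<subseteq> G" "\<forall>g\<in>S. c g \<in> poly_ring V"
    using assms(1) by (auto simp: ideal_gen_def)
  obtain T d where T: "q = (\<Sum>g\<in>T. d g * g)" "finite T" "T \<subseteq> G" "\<forall>g\<in>T. d g \<in> poly_ring V"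
    using assms(2) by (auto simp: ideal_gen_def)
  let ?e = "\<lambda>g. (if g \<in> S then c g else 0) + (if g \<in> T then d g else 0)"
  have "(\<Sum>g\<in>S. c g * g) = (\<Sum>g\<in>S \<union> T. (if g \<in> S then c g else 0) * g)"
    using S T by (intro sum.mono_neutral_cong_left) auto
  moreover have "(\<Sum>g\<in>T. d g * g) = (\<Sum>g\<in>S \<union> T. (if g \<in> T then d g else 0) * g)"
    using S T by (intro sum.mono_neutral_cong_left) auto
  ultimately have "p + q = (\<Sum>g\<in>S \<union> T. ?e g * g)"
    by (simp only: S T distrib_right sum.distrib)
  moreover have "\<forall>g\<in>S \<union> T. ?e g \<in> poly_ring V"
    using S T by auto
  ultimately show ?thesis
    unfolding ideal_gen_def using S T by (auto intro!: exI[of _ "S \<union> T"] exI[of _ ?e])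
qed

lemma ideal_gen_mult:
  assumes "p \<in> ideal_gen V G" "r \<in> poly_ring V"
  shows "r * p \<in> ideal_gen V G"
proof -
  obtain S c where S: "p = (\<Sum>g\<in>S. c g * g)" "finite S" "S \<subseteq> G" "\<forall>g\<in>S. c g \<in> poly_ring V"
    using assms(1) by (auto simp: ideal_gen_def)
  then have "r * p = (\<Sum>g\<in>S. (r * c g) * g)"
    by (simp add: sum_distrib_left mult.assoc)
  then show ?thesis
    unfolding ideal_gen_def using S assms(2) by (auto intro!: exI[of _ S] exI[of _ "\<lambda>g. r * c g"])
qed

lemma ideal_gen_sum: "(\<And>a. a \<in> A \<Longrightarrow> f a \<in> ideal_gen V G) \<Longrightarrow> sum f A \<in> ideal_gen V G"
  by (induction A rule: infinite_finite_induct) (auto simp: ideal_gen_0 ideal_gen_add)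

lemma ideal_gen_subset_ideal:
  assumes "\<And>g. g \<in> G \<Longrightarrow> r * g \<in> ideal_gen W H" "V \<subseteq> W" "p \<in> ideal_gen V G"
  shows "r * p \<in> ideal_gen W H"
proof -
  obtain S c where S: "p = (\<Sum>g\<in>S. c g * g)" "finite S" "S \<subseteq> G" "\<forall>g\<in>S. c g \<in> poly_ring V"
    using assms(3) by (auto simp: ideal_gen_def)
  then have "r * p = (\<Sum>g\<in>S. c g * (r * g))"
    by (simp add: sum_distrib_left mult_ac)
  moreover have "c g * (r * g) \<in> ideal_gen W H" if "g \<in> S" for g
    using that S assms(1) poly_ring_mono[OF assms(2)] by (auto intro!: ideal_gen_mult[of "r * g"])
  ultimately show ?thesis by (simp add: ideal_gen_sum)
qed

lemma subspace_ideal_gen: "mpoly.subspace (ideal_gen V G)"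
  by (rule mpoly.subspaceI) (auto simp: ideal_gen_0 ideal_gen_add qscale_def intro: ideal_gen_mult)

section \<open>Dimension of a quotient as a difference of dimensions\<close>

context vector_space
begin

text \<open>The family \<open>f\<close> on \<open>A\<close> is a basis of \<open>W\<close> modulo
  \<open>U\<close>; together with a basis \<open>C\<close> of \<open>U\<close> it is a basis of
  \<open>W\<close>. Indexing by \<open>A\<close> makes injectivity of \<open>f\<close> part of the
  independence hypothesis, and the finite set \<open>S\<close> makes \<open>C\<close> finite, so
  that the cardinalities add.\<close>

lemma dim_diff_eq_card:
  assumes W: "subspace W" "W \<subseteq> span S" "finite S" and U: "subspace U" "U \<subseteq> W"
    and "finite A" and f: "\<And>a. a \<in> A \<Longrightarrow> f a \<in> W"
    and spanning: "\<And>w. w \<in> W \<Longrightarrow> \<exists>v\<in>span (f ` A). w - v \<in> U"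
    and indep: "\<And>c. (\<Sum>a\<in>A. scale (c a) (f a)) \<in> U \<Longrightarrow> \<forall>a\<in>A. c a = 0"
  shows "dim W - dim U = card A"
proof -
  obtain C where C: "C \<subseteq> U" "independent C" "U \<subseteq> span C" "card C = dim U"
    using basis_exists by blast
  have "C \<subseteq> span S" using C U W by blast
  then have "finite C" using independent_span_bound[OF \<open>finite S\<close> C(2)] by blast
  have spanC: "span C \<subseteq> U" using C U by (simp add: span_minimal)
  have inj: "inj_on f A"
  proof (rule inj_onI, rule ccontr)
    fix a b assume ab: "a \<in> A" "b \<in> A" "f a = f b" "a \<noteq> b"
    let ?c = "\<lambda>x. if x = a then 1 else if x = b then -1 else 0"
    have "(\<Sum>x\<in>A. scale (?c x) (f x)) = (\<Sum>x\<in>{a, b}. scale (?c x) (f x))"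
      using ab \<open>finite A\<close> by (intro sum.mono_neutral_right) auto
    also have "\<dots> = 0" using ab by simp
    finally have "(\<Sum>x\<in>A. scale (?c x) (f x)) \<in> U" using U by (simp add: subspace_0)
    from indep[OF this] ab show False by auto
  qed
  have key: "\<forall>a\<in>A. c a = 0" if "(\<Sum>a\<in>A. scale (c a) (f a)) + v = 0" "v \<in> U" for c v
  proof -
    have "(\<Sum>a\<in>A. scale (c a) (f a)) = - v" using that by (simp add: eq_neg_iff_add_eq_0)
    then show ?thesis using indep[of c] U that by (simp add: subspace_neg)
  qed
  have disj: "C \<inter> f ` A = {}"
  proof (rule ccontr)
    assume "C \<inter> f ` A \<noteq> {}"
    then obtain a where a: "a \<in> A" "f a \<in> C" by auto
    have "(\<Sum>x\<in>A. scale (if x = a then 1 else 0) (f x)) = (\<Sum>x\<in>{a}. scale (if x = a then 1 else 0) (f x))"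
      using a \<open>finite A\<close> by (intro sum.mono_neutral_right) auto
    then have eq: "(\<Sum>x\<in>A. scale (if x = a then 1 else 0) (f x)) + - f a = 0" by simp
    have "- f a \<in> U" using a C U by (auto intro: subspace_neg)
    from key[OF eq this] a(1) show False by auto
  qed
  have "independent (C \<union> f ` A)"
    unfolding independent_explicit_finite_subsets
  proof (intro allI impI ballI)
    fix T c v assume T: "T \<subseteq> C \<union> f ` A" "finite T" "(\<Sum>v\<in>T. scale (c v) v) = 0" "v \<in> T"
    define c' where "c' v = (if v \<in> T then c v else 0)" for v
    have "(\<Sum>v\<in>T. scale (c v) v) = (\<Sum>v\<in>f ` A \<union> C. scale (c' v) v)"
      using T \<open>finite A\<close> \<open>finite C\<close> by (intro sum.mono_neutral_cong_left) (auto simp: c'_def)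
    also have "\<dots> = (\<Sum>a\<in>A. scale (c' (f a)) (f a)) + (\<Sum>v\<in>C. scale (c' v) v)"
      using disj \<open>finite A\<close> \<open>finite C\<close> inj by (subst sum.union_disjoint) (auto simp: sum.reindex)
    finally have eq: "(\<Sum>a\<in>A. scale (c' (f a)) (f a)) + (\<Sum>v\<in>C. scale (c' v) v) = 0"
      using T by simp
    have "(\<Sum>v\<in>C. scale (c' v) v) \<in> U"
      using C U by (intro subspace_sum subspace_scale) auto
    from key[OF eq this] have A0: "\<forall>a\<in>A. c' (f a) = 0" .
    then have "(\<Sum>v\<in>C. scale (c' v) v) = 0" using eq by simp
    then have "\<forall>v\<in>C. c' v = 0"
      using C(2) \<open>finite C\<close> unfolding independent_explicit_finite_subsets by blast
    with A0 T show "c v = 0" by (auto simp: c'_def split: if_splits)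
  qed
  moreover have "C \<union> f ` A \<subseteq> W" using C U f by auto
  moreover have "W \<subseteq> span (C \<union> f ` A)"
  proof
    fix w assume "w \<in> W"
    then obtain v where v: "v \<in> span (f ` A)" "w - v \<in> U" using spanning by blast
    then have "w - v \<in> span (C \<union> f ` A)" "v \<in> span (C \<union> f ` A)"
      using C(3) span_mono[of C "C \<union> f ` A"] span_mono[of "f ` A" "C \<union> f ` A"] by auto
    then show "w \<in> span (C \<union> f ` A)" using span_add by fastforce
  qed
  ultimately have "dim W = card (C \<union> f ` A)"
    using dim_unique by blast
  also have "\<dots> = dim U + card A"
    using disj \<open>finite A\<close> \<open>finite C\<close> C inj by (simp add: card_Un_disjoint card_image)
  finally show ?thesis by simp
qed

end

section \<open>The augmented Chow ring of a uniform matroid\<close>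

lemma sum_Collect_split:
  assumes "finite A" "\<And>a. a \<in> A \<Longrightarrow> P a \<longleftrightarrow> Q a \<or> S a" "\<And>a. a \<in> A \<Longrightarrow> Q a \<Longrightarrow> \<not> S a"
  shows "sum f {a. a \<in> A \<and> P a} = sum f {a. a \<in> A \<and> Q a} + sum f {a. a \<in> A \<and> S a}"
proof -
  have "{a. a \<in> A \<and> P a} = {a. a \<in> A \<and> Q a} \<union> {a. a \<in> A \<and> S a}" using assms(2) by blast
  moreover have "{a. a \<in> A \<and> Q a} \<inter> {a. a \<in> A \<and> S a} = {}" using assms(3) by blast
  ultimately show ?thesis using assms(1) by (simp add: sum.union_disjoint)
qed

locale uniform_chow =
  fixes E :: "'a set" and k :: nat
  assumes fin: "finite E" and k_pos: "0 < k" and k_le: "k \<le> card E"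
begin

definition PF :: "'a set set" where "PF = {F. F \<subset> E \<and> card F < k}"
abbreviation "L \<equiv> trunc_lattice E k"
abbreviation "V \<equiv> chow_vars E L"
abbreviation "R \<equiv> poly_ring V"
abbreviation "I \<equiv> chow_ideal E L"
abbreviation x :: "'a set \<Rightarrow> 'a mpoly" where "x F \<equiv> mvar (Inl F)"
abbreviation y :: "'a \<Rightarrow> 'a mpoly" where "y i \<equiv> mvar (Inr i)"

definition \<alpha> :: "'a mpoly" where "\<alpha> = (\<Sum>F\<in>PF. x F)"
definition X :: "'a set \<Rightarrow> 'a mpoly" where "X F = (if F = E then \<alpha> else x F)"
definition mono :: "('a set \<Rightarrow> nat) \<Rightarrow> 'a mpoly" where "mono a = (\<Prod>F\<in>L. X F ^ a F)"

text \<open>For \<open>G = {i}\<close> this is congruent to \<open>y i\<close>.\<close>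

definition nabove :: "'a set \<Rightarrow> 'a mpoly" where "nabove G = (\<Sum>K | K \<in> PF \<and> \<not> G \<subseteq> K. x K)"

lemma L_eq: "L = insert E PF" and E_notin_PF: "E \<notin> PF"
  by (auto simp: trunc_lattice_def PF_def)

lemma L_diff: "L - {E} = PF"
  using L_eq E_notin_PF by auto

lemma finite_L: "finite L" and finite_PF [simp]: "finite PF"
  using fin by (simp_all add: PF_def)

lemma PFD: "F \<in> PF \<Longrightarrow> F \<subset> E" "F \<in> PF \<Longrightarrow> card F < k" "F \<in> PF \<Longrightarrow> finite F"
  using fin by (auto simp: PF_def intro: finite_subset)

lemma V_eq: "V = Inl ` PF \<union> Inr ` E"
  by (simp add: chow_vars_def L_diff)

lemma finite_V: "finite V"
  using fin by (simp add: V_eq)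

lemma xR [intro]: "F \<in> PF \<Longrightarrow> x F \<in> R" and yR [intro]: "i \<in> E \<Longrightarrow> y i \<in> R"
  by (auto simp: V_eq)

lemma I_0: "0 \<in> I" and I_add: "p \<in> I \<Longrightarrow> q \<in> I \<Longrightarrow> p + q \<in> I"
  and I_mult: "p \<in> I \<Longrightarrow> r \<in> R \<Longrightarrow> r * p \<in> I"
  and I_sum: "(\<And>a. a \<in> A \<Longrightarrow> f a \<in> I) \<Longrightarrow> sum f A \<in> I"
  unfolding chow_ideal_def by (auto intro: ideal_gen_0 ideal_gen_add ideal_gen_mult ideal_gen_sum)

lemma I_mult_right: "p \<in> I \<Longrightarrow> r \<in> R \<Longrightarrow> p * r \<in> I"
  using I_mult by (simp add: mult.commute)

lemma subspace_I: "mpoly.subspace I"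
  unfolding chow_ideal_def by (rule subspace_ideal_gen)

lemma I_diff: "p \<in> I \<Longrightarrow> q \<in> I \<Longrightarrow> p - q \<in> I"
  using mpoly.subspace_diff[OF subspace_I] .

lemma gen_y: "i \<in> E \<Longrightarrow> y i - nabove {i} \<in> I"
  unfolding chow_ideal_def chow_gens_def L_diff nabove_def
  by (rule ideal_gen_base) auto

lemma gen_xx: "F \<in> PF \<Longrightarrow> G \<in> PF \<Longrightarrow> \<not> F \<subseteq> G \<Longrightarrow> \<not> G \<subseteq> F \<Longrightarrow> x F * x G \<in> I"
  unfolding chow_ideal_def chow_gens_def L_diff by (rule ideal_gen_base) auto

lemma gen_yx: "i \<in> E \<Longrightarrow> F \<in> PF \<Longrightarrow> i \<notin> F \<Longrightarrow> y i * x F \<in> I"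
  unfolding chow_ideal_def chow_gens_def L_diff by (rule ideal_gen_base) auto

lemma naboveR [intro]: "nabove G \<in> R"
  unfolding nabove_def by auto

lemma alphaR [intro]: "\<alpha> \<in> R"
  unfolding \<alpha>_def by auto

lemma E_in_L [simp]: "E \<in> L" and PF_in_L [simp]: "F \<in> PF \<Longrightarrow> F \<in> L"
  by (auto simp: L_eq)

lemma L_cases: "F \<in> L \<Longrightarrow> F = E \<or> F \<in> PF"
  by (simp add: L_eq)

lemma X_PF: "F \<in> PF \<Longrightarrow> X F = x F"
  using E_notin_PF by (auto simp: X_def)

lemma XR [intro]: "F \<in> L \<Longrightarrow> X F \<in> R"
  using L_cases[of F] by (auto simp: X_PF X_def)

lemma monoR [intro]: "mono a \<in> R"
  unfolding mono_def by auto

section \<open>Powers that vanish in the Chow ring\<close>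

lemma x_nabove_single:
  assumes "F \<in> PF" "i \<in> E" "i \<notin> F"
  shows "x F * nabove {i} \<in> I"
proof -
  have "y i * x F - (y i - nabove {i}) * x F \<in> I"
    using assms by (intro I_diff gen_yx I_mult_right gen_y) auto
  then show ?thesis by (simp add: algebra_simps)
qed

text \<open>If \<open>K\<close> contains \<open>i\<close> but not all of \<open>G\<close>, then
  \<open>K\<close> and \<open>H\<close> are incomparable: \<open>i\<close> lies in \<open>K\<close>
  only, and \<open>H \<subseteq> K\<close> would put \<open>G\<close> inside \<open>K\<close>. The
  remaining summands avoid \<open>i\<close> and form \<open>nabove {i}\<close>.\<close>

lemma x_nabove:
  assumes "H \<in> PF" "G \<subseteq> E" "i \<in> G" "i \<notin> H" "G - {i} \<subseteq> H"
  shows "x H * nabove G \<in> I"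
proof -
  have "nabove G = nabove {i} + (\<Sum>K | K \<in> PF \<and> i \<in> K \<and> \<not> G \<subseteq> K. x K)"
    unfolding nabove_def using assms(3) by (intro sum_Collect_split) auto
  then have "x H * nabove G = x H * nabove {i} + (\<Sum>K | K \<in> PF \<and> i \<in> K \<and> \<not> G \<subseteq> K. x H * x K)"
    by (simp add: distrib_left sum_distrib_left)
  also have "\<dots> \<in> I"
    using assms by (intro I_add x_nabove_single I_sum gen_xx) auto
  finally show ?thesis .
qed

text \<open>The difference is the sum of the \<open>x K\<close> with
  \<open>G - {i} \<subseteq> K\<close> and \<open>i \<notin> K\<close>, and \<open>x_nabove\<close>
  kills each of them against \<open>nabove G\<close>.\<close>

lemma nabove_remove:
  assumes "G \<subseteq> E" "i \<in> G"
  shows "nabove G * (nabove G - nabove (G - {i})) \<in> I"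
proof -
  have "nabove G = nabove (G - {i}) + (\<Sum>K | K \<in> PF \<and> G - {i} \<subseteq> K \<and> \<not> G \<subseteq> K. x K)"
    unfolding nabove_def by (intro sum_Collect_split) auto
  then have d: "nabove G - nabove (G - {i}) = (\<Sum>K | K \<in> PF \<and> G - {i} \<subseteq> K \<and> \<not> G \<subseteq> K. x K)"
    by simp
  have "nabove G * (nabove G - nabove (G - {i})) =
      (\<Sum>K | K \<in> PF \<and> G - {i} \<subseteq> K \<and> \<not> G \<subseteq> K. x K * nabove G)"
    unfolding d sum_distrib_left by (simp add: mult.commute)
  also have "\<dots> \<in> I"
    using assms by (intro I_sum x_nabove[of _ _ i]) auto
  finally show ?thesis .
qed

lemma nabove_power:
  assumes "G \<subseteq> E" "i \<in> G"
  shows "nabove G ^ Suc d - nabove G * nabove (G - {i}) ^ d \<in> I"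
proof (induction d)
  case 0
  then show ?case by (simp add: I_0)
next
  case (Suc d)
  let ?g = "nabove G" and ?h = "nabove (G - {i})"
  have "?g ^ Suc (Suc d) - ?g * ?h ^ Suc d = ?g * (?g ^ Suc d - ?g * ?h ^ d) + ?h ^ d * (?g * (?g - ?h))"
    by (simp add: algebra_simps)
  also have "\<dots> \<in> I"
    using assms Suc by (intro I_add I_mult nabove_remove) auto
  finally show ?case .
qed

text \<open>Each element of \<open>G - F\<close> removed from \<open>G\<close> uses up one factor
  \<open>nabove G\<close> by \<open>nabove_power\<close>, until \<open>G\<close> exceeds
  \<open>F\<close> by a single element and \<open>x_nabove\<close> applies.\<close>

lemma x_nabove_power:
  assumes "F \<in> PF" "F \<subset> G" "G \<subseteq> E"
  shows "x F * nabove G ^ card (G - F) \<in> I"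
  using assms(2,3)
proof (induction "card (G - F)" arbitrary: G)
  case 0
  then show ?case using fin by (auto simp: card_eq_0_iff intro: finite_subset)
next
  case (Suc d)
  have finG: "finite G" using Suc.prems fin finite_subset by blast
  from Suc.prems obtain i where i: "i \<in> G" "i \<notin> F" by blast
  have eq: "G - {i} - F = G - F - {i}" by auto
  have d: "card (G - {i} - F) = d"
    using i finG Suc.hyps(2) by (simp add: eq)
  show ?case
  proof (cases "G - {i} = F")
    case True
    then have "card (G - F) = 1" using d Suc.hyps(2) by simp
    then show ?thesis
      using x_nabove[of F G i] assms(1) i True Suc.prems by simp
  next
    case False
    let ?g = "nabove G" and ?h = "nabove (G - {i})"
    have hyp: "x F * ?h ^ d \<in> I"
    proof -
      have "F \<subset> G - {i}" "G - {i} \<subseteq> E" using i False Suc.prems by blast+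
      from Suc.hyps(1)[OF d[symmetric] this] show ?thesis by (simp only: d)
    qed
    have "x F * (?g ^ Suc d - ?g * ?h ^ d) + ?g * (x F * ?h ^ d) \<in> I"
      using assms(1) i Suc.prems by (intro I_add I_mult[OF nabove_power] I_mult[OF hyp]) auto
    then show ?thesis
      by (simp add: algebra_simps flip: Suc.hyps(2))
  qed
qed

text \<open>The same peeling without the factor \<open>x F\<close>; it ends at
  \<open>nabove {} = 0\<close>, which accounts for the extra factor.\<close>

lemma nabove_power_card:
  assumes "G \<subseteq> E"
  shows "nabove G ^ Suc (card G) \<in> I"
proof -
  have "finite G" using assms fin finite_subset by blast
  then show ?thesis using assms
  proof (induction G rule: finite_induct)
    case empty
    then show ?case by (simp add: nabove_def I_0)
  next
    case (insert i G)
    let ?g = "nabove (insert i G)"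
    have "?g ^ Suc (Suc (card G)) - ?g * nabove (insert i G - {i}) ^ Suc (card G) + ?g * nabove G ^ Suc (card G) \<in> I"
      using insert by (intro I_add I_mult nabove_power) auto
    then show ?case using insert by simp
  qed
qed

text \<open>A proper flat has fewer than \<open>k\<close> elements and cannot contain
  \<open>G\<close>. So any \<open>k\<close>-element set can stand in for \<open>E\<close>, which is
  why the bounds for \<open>E\<close> involve \<open>k\<close> instead of
  \<open>card E\<close>.\<close>

lemma nabove_eq_alpha: "k \<le> card G \<Longrightarrow> nabove G = \<alpha>"
proof -
  assume "k \<le> card G"
  then have "\<not> G \<subseteq> K" if "K \<in> PF" for K
    using PFD(2,3)[OF that] card_mono[of K G] by auto
  then have "{K. K \<in> PF \<and> \<not> G \<subseteq> K} = PF" by auto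
  then show ?thesis by (simp add: nabove_def \<alpha>_def)
qed

lemma rk_less:
  assumes "F \<in> L" "G \<in> L" "G \<subset> F"
  shows "rk E k G < rk E k F"
proof -
  have G: "G \<in> PF" using L_cases[OF assms(1)] L_cases[OF assms(2)] PFD(1)[of F] assms(3) by blast
  then have "G \<noteq> E" using E_notin_PF by blast
  moreover have "finite F" using assms(1) L_cases PFD(3) fin by blast
  ultimately show ?thesis
    using PFD(2)[OF G] psubset_card_mono[OF _ assms(3)] by (simp add: rk_def)
qed

text \<open>Up to sign this is the sum of \<open>x K\<close> over all flats \<open>K\<close>
  containing \<open>F\<close>, with \<open>E\<close> included as \<open>x E = - \<alpha>\<close>:
  the element whose powers occur in the Feichtner--Yuzvinsky relations.\<close>

definition red :: "'a set \<Rightarrow> 'a mpoly" where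
  "red F = (if F = E then \<alpha> else nabove F)"

lemma redR [intro]: "red F \<in> R"
  by (auto simp: red_def)

lemma red_power: "F \<in> L \<Longrightarrow> red F ^ rk E k F \<in> I"
proof -
  assume F: "F \<in> L"
  show ?thesis
  proof (cases "F = E")
    case True
    obtain H where "H \<subseteq> E" "card H = k"
      using obtain_subset_with_card_n[OF k_le] by blast
    then show ?thesis
      using nabove_power_card[of H] True by (simp add: red_def rk_def nabove_eq_alpha)
  next
    case False
    then show ?thesis
      using F nabove_power_card[of F] PFD(1)[of F] by (simp add: red_def rk_def L_eq)
  qed
qed

lemma X_red_power:
  assumes "F \<in> L" "G \<in> L" "G \<subset> F"
  shows "X G * red F ^ (rk E k F - rk E k G) \<in> I"
proof -
  have G: "G \<noteq> E" "G \<in> PF"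
    using assms PFD(1) by (auto simp: L_eq)
  show ?thesis
  proof (cases "F = E")
    case True
    obtain H where H: "G \<subseteq> H" "H \<subseteq> E" "card H = k"
      using exists_subset_between[of G k E] PFD[OF G(2)] k_le fin by auto
    moreover have "G \<noteq> H" using H PFD(2)[OF G(2)] by auto
    ultimately show ?thesis
      using x_nabove_power[OF G(2), of H] True G PFD(3)[OF G(2)]
      by (auto simp: red_def rk_def X_def nabove_eq_alpha card_Diff_subset)
  next
    case False
    then show ?thesis
      using x_nabove_power[OF G(2) assms(3)] assms(1) G PFD[of F] PFD(3)[OF G(2)] assms(3)
      by (auto simp: red_def rk_def X_def L_eq card_Diff_subset)
  qed
qed

lemma X_E: "X E = red E"
  by (simp add: X_def red_def)

text \<open>The sum \<open>red F + X F\<close> expressed by sets strictly containing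
  \<open>F\<close>, see \<open>red_eq\<close>; trading \<open>X F\<close> for it moves a monomial
  upwards.\<close>

definition above :: "'a set \<Rightarrow> 'a mpoly" where
  "above F = X E - (\<Sum>H | H \<in> PF \<and> F \<subset> H. X H)"

lemma aboveR [intro]: "above F \<in> R"
  unfolding above_def by (intro poly_ring_diff poly_ring_sum XR) auto

lemma red_eq: "F \<in> PF \<Longrightarrow> red F = above F - X F"
proof -
  assume F: "F \<in> PF"
  have "\<alpha> = (\<Sum>K | K \<in> PF \<and> True. x K)" by (simp add: \<alpha>_def)
  also have "\<dots> = nabove F + (\<Sum>K | K \<in> PF \<and> F \<subseteq> K. x K)"
    unfolding nabove_def by (intro sum_Collect_split) auto
  also have "{K. K \<in> PF \<and> F \<subseteq> K} = insert F {H. H \<in> PF \<and> F \<subset> H}"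
    using F by auto
  also have "(\<Sum>K\<in>insert F {H. H \<in> PF \<and> F \<subset> H}. x K) = x F + (\<Sum>H | H \<in> PF \<and> F \<subset> H. x H)"
    by simp
  finally show ?thesis
    using F E_notin_PF by (auto simp: red_def above_def X_PF X_E)
qed

lemma mono_upd_add: "F \<in> L \<Longrightarrow> mono (a(F := a F + c)) = X F ^ c * mono a"
  unfolding mono_def using finite_L
  by (subst (1 2) prod.remove[of _ F]) (auto simp: power_add mult_ac intro!: prod.cong)

lemma mono_0: "mono (\<lambda>_. 0) = 1"
  by (simp add: mono_def)

lemma homog_x: "F \<in> PF \<Longrightarrow> x F \<in> homog V 1" and homog_y: "i \<in> E \<Longrightarrow> y i \<in> homog V 1"
  by (rule homog_mvar, simp add: V_eq)+

lemma homog_X: "F \<in> L \<Longrightarrow> X F \<in> homog V 1"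
  using L_cases[of F] homog_x unfolding X_def \<alpha>_def
  by (auto intro: mpoly.subspace_sum[OF subspace_homog] simp del: One_nat_def)

lemma homog_mono: "mono a \<in> homog V (FY_deg E k a)"
  unfolding mono_def FY_deg_def
  using homog_power[OF homog_X] by (intro homog_prod) simp

section \<open>Straightening: the FY monomials span\<close>

definition spanned :: "nat \<Rightarrow> 'a mpoly set" where
  "spanned j = {p. \<exists>q\<in>mpoly.span (mono ` {a \<in> FY E k. FY_deg E k a = j}). p - q \<in> I}"

lemma subspace_spanned: "mpoly.subspace (spanned j)"
proof (rule mpoly.subspaceI)
  show "0 \<in> spanned j"
    unfolding spanned_def using mpoly.span_zero I_0 by force
  show "p + p' \<in> spanned j" if "p \<in> spanned j" "p' \<in> spanned j" for p p'
  proof -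
    from that obtain q q' where q: "q \<in> mpoly.span (mono ` {a \<in> FY E k. FY_deg E k a = j})" "p - q \<in> I"
      "q' \<in> mpoly.span (mono ` {a \<in> FY E k. FY_deg E k a = j})" "p' - q' \<in> I"
      by (auto simp: spanned_def)
    have "p + p' - (q + q') = (p - q) + (p' - q')" by simp
    then show ?thesis
      using q I_add mpoly.span_add unfolding spanned_def by (metis (mono_tags, lifting) mem_Collect_eq)
  qed
  show "qscale c p \<in> spanned j" if "p \<in> spanned j" for c p
  proof -
    from that obtain q where q: "q \<in> mpoly.span (mono ` {a \<in> FY E k. FY_deg E k a = j})" "p - q \<in> I"
      by (auto simp: spanned_def)
    have "qscale c p - qscale c q \<in> I"
      using mpoly.subspace_scale[OF subspace_I q(2), of c] by (simp add: mpoly.scale_right_diff_distrib)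
    then show ?thesis
      using mpoly.span_scale[OF q(1)] by (auto simp: spanned_def)
  qed
qed

lemma spanned_cong: "p \<in> spanned j \<Longrightarrow> q - p \<in> I \<Longrightarrow> q \<in> spanned j"
  unfolding spanned_def using I_add by fastforce

lemma I_spanned: "p \<in> I \<Longrightarrow> p \<in> spanned j"
  using spanned_cong[OF mpoly.subspace_0[OF subspace_spanned]] by simp

lemma mono_spanned_base: "a \<in> FY E k \<Longrightarrow> FY_deg E k a = j \<Longrightarrow> mono a \<in> spanned j"
  unfolding spanned_def by (intro CollectI bexI[of _ "mono a"] mpoly.span_base) (auto simp: I_0)

text \<open>Termination measure of the straightening: at fixed degree it drops whenever a factor
  \<open>X F\<close> is exchanged for \<open>X H\<close> with \<open>F \<subset> H\<close>.\<close>

definition coweight :: "('a set \<Rightarrow> nat) \<Rightarrow> nat" where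
  "coweight a = (\<Sum>F\<in>L. a F * (card E - card F))"

lemma FY_deg_upd_add: "F \<in> L \<Longrightarrow> FY_deg E k (a(F := a F + c)) = FY_deg E k a + c"
  unfolding FY_deg_def using finite_L
  by (subst (1 2) sum.remove[of _ F]) (auto intro!: sum.cong)

lemma coweight_upd_add: "F \<in> L \<Longrightarrow> coweight (a(F := a F + c)) = coweight a + c * (card E - card F)"
  unfolding coweight_def using finite_L
  by (subst (1 2) sum.remove[of _ F]) (auto intro!: sum.cong simp: distrib_right)

text \<open>Each factor \<open>above F\<close> contributes some \<open>X H\<close> with
  \<open>F \<subset> H\<close>, which costs at most \<open>card E - card F - 1\<close> in
  \<open>coweight\<close>, one less than \<open>X F\<close>. The assumption \<open>IH\<close> is the
  induction hypothesis of \<open>mono_spanned\<close>, with its bound named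
  \<open>w\<close>.\<close>

lemma mono_above_power_spanned:
  assumes F: "F \<in> PF"
    and IH: "\<And>b. FY_deg E k b = j \<Longrightarrow> coweight b < w \<Longrightarrow> {F. 0 < b F} \<subseteq> L \<Longrightarrow> mono b \<in> spanned j"
    and "{F. 0 < b F} \<subseteq> L" "FY_deg E k b + e = j" "coweight b + e * (card E - card F - 1) < w"
  shows "mono b * above F ^ e \<in> spanned j"
  using assms(3-5)
proof (induction e arbitrary: b)
  case 0
  then show ?case using IH by simp
next
  case (Suc e)
  have step: "mono b * X H * above F ^ e \<in> spanned j" if H: "H \<in> L" "F \<subset> H" for H
  proof -
    have "card F < card H"
      using H L_cases[of H] PFD(3) fin by (auto intro: psubset_card_mono)
    then have "card E - card H \<le> card E - card F - 1" by linarith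
    define b' where "b' = b(H := b H + 1)"
    have "{F. 0 < b' F} \<subseteq> L" using Suc.prems(1) H by (auto simp: b'_def)
    moreover have "FY_deg E k b' = FY_deg E k b + 1" "coweight b' = coweight b + (card E - card H)"
      using FY_deg_upd_add[OF H(1), of b 1] coweight_upd_add[OF H(1), of b 1] by (simp_all add: b'_def)
    ultimately have "mono b' * above F ^ e \<in> spanned j"
      using Suc.prems(2,3) \<open>card E - card H \<le> _\<close> by (intro Suc.IH) auto
    then show ?thesis using mono_upd_add[OF H(1), of b 1] by (simp add: b'_def mult_ac)
  qed
  have "mono b * above F ^ Suc e = mono b * X E * above F ^ e -
      (\<Sum>H | H \<in> PF \<and> F \<subset> H. mono b * X H * above F ^ e)"
    unfolding power_Suc
    by (subst (1) above_def) (simp add: algebra_simps sum_distrib_left sum_distrib_right)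
  also have "\<dots> \<in> spanned j"
    using F PFD(1) by (intro mpoly.subspace_diff mpoly.subspace_sum subspace_spanned step) auto
  finally show ?case .
qed

lemma spanned_of_nat: "p \<in> spanned j \<Longrightarrow> of_nat m * p \<in> spanned j"
  using mpoly.subspace_scale[OF subspace_spanned, of p j "of_nat m"] by (simp add: qscale_def)

lemma spanned_sign: "p \<in> spanned j \<Longrightarrow> (- 1) ^ m * p \<in> spanned j"
  using mpoly.subspace_neg[OF subspace_spanned, of p j] by (cases "even m") auto

lemma mono_pred: "F \<in> L \<Longrightarrow> 0 < a F \<Longrightarrow> mono a = X F * mono (a(F := a F - 1))"
  using mono_upd_add[of F "a(F := a F - 1)" 1] by simp

text \<open>A monomial outside \<open>FY\<close> violates one of three conditions. Two incomparable
  members put it in \<open>I\<close>. Too large an exponent or too small a gap yields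
  \<open>mono b * red F ^ d \<in> I\<close>; for \<open>F = E\<close> this is the monomial itself,
  and otherwise expanding \<open>red F = above F - X F\<close> leads to monomials of smaller
  \<open>coweight\<close>.\<close>

lemma mono_spanned:
  assumes "{F. 0 < a F} \<subseteq> L" "FY_deg E k a = j"
  shows "mono a \<in> spanned j"
  using assms
proof (induction "coweight a" arbitrary: a rule: less_induct)
  case less
  have supp: "F \<in> L" if "0 < a F" for F using that less.prems by auto
  \<comment> \<open>Here \<open>d\<close> copies of \<open>F\<close> are split off from
    \<open>a\<close>. In the binomial expansion the term \<open>c = d\<close> is
    \<open>mono a\<close>, and every other term keeps a factor \<open>above F\<close>.\<close>
  have reduce: "mono a \<in> spanned j"
    if F: "F \<in> L" and d: "0 < d" "d \<le> a F" and I: "mono (a(F := a F - d)) * red F ^ d \<in> I" for F d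
  proof -
    define b where "b = a(F := a F - d)"
    have ab: "a = b(F := b F + d)" using d by (auto simp: b_def)
    have ma: "mono a = X F ^ d * mono b"
      using mono_upd_add[OF F, of b d] ab by simp
    show ?thesis
    proof (cases "F = E")
      case True
      then have "mono a \<in> I" using I by (simp add: ma b_def X_E mult.commute)
      then show ?thesis by (rule I_spanned)
    next
      case False
      then have FP: "F \<in> PF" using F L_cases by blast
      have "card F < card E" using PFD(1)[OF FP] fin by (simp add: psubset_card_mono)
      have tm: "mono b * X F ^ c * above F ^ (d - c) \<in> spanned j" if "c < d" for c
      proof -
        have "mono (b(F := b F + c)) * above F ^ (d - c) \<in> spanned j"
        proof (rule mono_above_power_spanned[OF FP, where w = "coweight a"])
          show "mono b' \<in> spanned j"
            if "FY_deg E k b' = j" "coweight b' < coweight a" "{F. 0 < b' F} \<subseteq> L" for b'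
            using less.hyps that by blast
          show "{G. 0 < (b(F := b F + c)) G} \<subseteq> L" using supp F by (auto simp: b_def)
          show "FY_deg E k (b(F := b F + c)) + (d - c) = j"
            using less.prems(2) that F by (subst (asm) ab) (simp add: FY_deg_upd_add)
          have "c * (card E - card F) + (d - c) * (card E - card F - 1) < d * (card E - card F)"
          proof -
            define m e where "m = card E - card F - 1" and "e = d - c - 1"
            have "card E - card F = Suc m" "d = c + Suc e" "d - c = Suc e"
              using \<open>card F < card E\<close> that by (auto simp: m_def e_def)
            then show ?thesis by (simp add: algebra_simps)
          qed
          then show "coweight (b(F := b F + c)) + (d - c) * (card E - card F - 1) < coweight a"
            using F by (subst ab) (simp add: coweight_upd_add)
        qed
        then show ?thesis using mono_upd_add[OF F, of b c] by (simp add: mult_ac)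
      qed
      have "mono b * (X F + - above F) ^ d = (- 1) ^ d * (mono b * red F ^ d)"
        using power_minus[of "red F" d] red_eq[OF FP] by (simp add: mult_ac)
      moreover have "(- 1) ^ d * (mono b * red F ^ d) \<in> I"
        by (rule I_mult) (use I in \<open>auto simp: b_def\<close>)
      moreover have "mono b * (X F + - above F) ^ d =
          (\<Sum>c\<le>d. of_nat (d choose c) * ((- 1) ^ (d - c) * (mono b * X F ^ c * above F ^ (d - c))))"
        unfolding binomial_ring sum_distrib_left power_minus[of "above F"] by (simp add: mult_ac)
      ultimately have "mono a - - (\<Sum>c<d. of_nat (d choose c) * ((- 1) ^ (d - c) * (mono b * X F ^ c * above F ^ (d - c)))) \<in> I"
        by (simp add: ma mult.commute add.commute flip: lessThan_Suc_atMost)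
      moreover have "- (\<Sum>c<d. of_nat (d choose c) * ((- 1) ^ (d - c) * (mono b * X F ^ c * above F ^ (d - c)))) \<in> spanned j"
        using tm by (intro mpoly.subspace_neg mpoly.subspace_sum subspace_spanned spanned_of_nat spanned_sign) auto
      ultimately show ?thesis by (rule spanned_cong[rotated])
    qed
  qed
  show ?case
  proof (cases "a \<in> FY E k")
    case True
    then show ?thesis using less.prems mono_spanned_base by blast
  next
    case False
    have "a F = 0" if "F \<notin> L" for F using supp that by blast
    with False consider F where "F \<in> L" "\<not> a F < rk E k F"
      | F G where "F \<in> L" "G \<in> L" "0 < a F" "0 < a G" "\<not> F \<subseteq> G" "\<not> G \<subseteq> F"
      | F G where "F \<in> L" "G \<in> L" "0 < a F" "0 < a G" "G \<subset> F" "\<not> a F + rk E k G < rk E k F"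
      unfolding FY_def by blast
    then show ?thesis
    proof cases
      case (1 F)
      then show ?thesis
        by (intro reduce[of F "rk E k F"] I_mult red_power) (auto simp: rk_def)
    next
      case (2 F G)
      then have "F \<in> PF" "G \<in> PF"
        using L_cases[of F] L_cases[of G] PFD(1) by blast+
      moreover have "mono a = X F * X G * mono (a(F := a F - 1, G := a G - 1))"
        using 2 mono_pred[of F a] mono_pred[of G "a(F := a F - 1)"] by (auto simp: mult.assoc)
      ultimately have "mono a \<in> I"
        using 2 by (simp only: X_PF) (intro I_mult_right gen_xx monoR)
      then show ?thesis by (rule I_spanned)
    next
      case (3 F G)
      \<comment> \<open>The gap of ranks is the power required by \<open>X_red_power\<close>, whose
        factor \<open>X G\<close> is split off from the remaining monomial.\<close>
      let ?d = "rk E k F - rk E k G"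
      let ?b = "a(F := a F - ?d)"
      have "mono ?b = X G * mono (?b(G := ?b G - 1))"
        using 3 by (intro mono_pred) auto
      then have eq: "mono ?b * red F ^ ?d = mono (?b(G := ?b G - 1)) * (X G * red F ^ ?d)"
        by (simp add: mult_ac)
      have "mono ?b * red F ^ ?d \<in> I"
        unfolding eq using 3 by (intro I_mult X_red_power) auto
      then show ?thesis
        using 3 rk_less[of F G] by (intro reduce[of F ?d]) auto
    qed
  qed
qed

lemma X_mult_spanned:
  assumes H: "H \<in> L" and p: "p \<in> spanned j"
  shows "X H * p \<in> spanned (Suc j)"
proof -
  obtain q where q: "q \<in> mpoly.span (mono ` {a \<in> FY E k. FY_deg E k a = j})" "p - q \<in> I"
    using p by (auto simp: spanned_def)
  have "X H * q \<in> spanned (Suc j)"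
    using q(1)
  proof (induction rule: mpoly.span_induct_alt)
    case base
    then show ?case using mpoly.subspace_0[OF subspace_spanned] by simp
  next
    case (step c p q)
    then obtain a where a: "a \<in> FY E k" "FY_deg E k a = j" "p = mono a" by auto
    have "mono (a(H := a H + 1)) \<in> spanned (Suc j)"
      using a FYD(5)[OF a(1)] H FY_deg_upd_add[OF H, of a 1] by (intro mono_spanned) auto
    then have "X H * p \<in> spanned (Suc j)"
      using mono_upd_add[OF H, of a 1] a by simp
    then show ?case
      using step mpoly.subspace_add[OF subspace_spanned] mpoly.subspace_scale[OF subspace_spanned]
      by (simp add: distrib_left qscale_mult_right)
  qed
  moreover have "X H * p - X H * q \<in> I"
    using I_mult[OF q(2) XR[OF H]] by (simp add: right_diff_distrib)
  ultimately show ?thesis by (rule spanned_cong)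
qed

lemma mvar_mult_spanned:
  assumes "v \<in> V" "p \<in> spanned j" "p \<in> R"
  shows "mvar v * p \<in> spanned (Suc j)"
proof -
  consider F where "F \<in> PF" "v = Inl F" | i where "i \<in> E" "v = Inr i"
    using assms(1) by (auto simp: V_eq)
  then show ?thesis
  proof cases
    case 1
    then show ?thesis using X_mult_spanned[of F p j] assms(2) by (simp add: X_PF)
  next
    case 2
    have "nabove {i} * p = (\<Sum>K | K \<in> PF \<and> \<not> {i} \<subseteq> K. X K * p)"
      unfolding nabove_def by (simp add: sum_distrib_right X_PF)
    also have "\<dots> \<in> spanned (Suc j)"
      using assms(2) by (intro mpoly.subspace_sum subspace_spanned X_mult_spanned) auto
    finally have "nabove {i} * p \<in> spanned (Suc j)" .
    moreover have "mvar v * p - nabove {i} * p \<in> I"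
      using I_mult_right[OF gen_y[OF 2(1)] assms(3)] 2 by (simp add: left_diff_distrib)
    ultimately show ?thesis by (rule spanned_cong)
  qed
qed

lemma single_spanned:
  "Poly_Mapping.keys m \<subseteq> V \<Longrightarrow> mon_deg m = j \<Longrightarrow> Poly_Mapping.single m c \<in> spanned j"
proof (induction j arbitrary: m)
  case 0
  have "qscale c (mono (\<lambda>_. 0)) \<in> spanned 0"
    by (intro mpoly.subspace_scale[OF subspace_spanned] mono_spanned) (auto simp: FY_deg_def)
  then show ?case
    using 0 by (simp add: mon_deg_eq_0_iff mono_0 qscale_def)
next
  case (Suc j)
  then have "m \<noteq> 0" by auto
  then obtain v where v: "v \<in> Poly_Mapping.keys m" by (metis all_not_in_conv keys_eq_empty)
  define m' where "m' = m - Poly_Mapping.single v 1"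
  have m: "m = Poly_Mapping.single v 1 + m'"
    using v by (intro poly_mapping_eqI) (auto simp: m'_def lookup_add lookup_minus lookup_single when_def in_keys_iff)
  have m': "Poly_Mapping.keys m' \<subseteq> V" "mon_deg m' = j"
    using Suc.prems m keys_add_nat[of "Poly_Mapping.single v 1" m'] mon_deg_add[of "Poly_Mapping.single v 1" m'] by auto
  have "mvar v * Poly_Mapping.single m' c \<in> spanned (Suc j)"
    using v Suc.prems m' by (intro mvar_mult_spanned Suc.IH) (auto simp: poly_ring_def)
  then show ?case by (simp add: mvar_def mult_single m)
qed

lemma homog_spanned_mono:
  assumes "p \<in> homog V j"
  shows "p \<in> spanned j"
proof -
  have "(\<Sum>m\<in>Poly_Mapping.keys p. Poly_Mapping.single m (Poly_Mapping.lookup p m)) \<in> spanned j"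
    using homogD[OF assms] by (intro mpoly.subspace_sum subspace_spanned single_spanned) auto
  then show ?thesis by (simp add: sum_single_lookup)
qed

end

section \<open>Independence in the Boolean case by evaluation at points\<close>

interpretation rat_fun: vector_space "\<lambda>(c :: rat) f x. c * f x"
  by unfold_locales (auto simp: fun_eq_iff algebra_simps)

lemma sum_fun_apply: "(\<Sum>a\<in>A. f a) z = (\<Sum>a\<in>A. f a z :: rat)"
  by (induction A rule: infinite_finite_induct) auto

locale boolean_chow =
  fixes E :: "'a set" and t :: "'a \<Rightarrow> rat"
  assumes finite_E: "finite E" and E_ne: "E \<noteq> {}"
    and inj_t: "inj_on t E" and t_nz: "\<And>i. i \<in> E \<Longrightarrow> t i \<noteq> 0"
begin

sublocale uniform_chow E "card E"
  using finite_E E_ne by unfold_locales (auto simp: card_gt_0_iff)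

lemma PF_eq: "PF = {F. F \<subset> E}"
  using finite_E by (auto simp: PF_def intro!: psubset_card_mono)

definition P :: "'a list set" where "P = {xs. distinct xs \<and> set xs \<subseteq> E}"

definition fl :: "'a list \<Rightarrow> nat \<Rightarrow> 'a set" where "fl xs j = E - set (drop j xs)"

definition incr :: "'a list \<Rightarrow> nat \<Rightarrow> rat" where
  "incr xs j = t (xs ! j) - (if j = 0 then 0 else t (xs ! (j - 1)))"

text \<open>A list \<open>xs\<close> of distinct elements encodes the maximal cone of the stellahedral fan spanned by
  \<open>E - set xs\<close> and the flag \<open>fl xs 0 \<subset> fl xs 1 \<subset> \<dots>\<close>; \<open>coord xs\<close> are the coordinates of
  the point on it at which \<open>(\<Sum>F \<in> PF | i \<notin> F. x F) - y i = t i\<close> for all \<open>i\<close>.\<close>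

definition coord :: "'a list \<Rightarrow> 'a set \<Rightarrow> rat" where
  "coord xs F = (\<Sum>j<length xs. if F = fl xs j then incr xs j else 0)"

definition val :: "'a list \<Rightarrow> 'a var \<Rightarrow> rat" where
  "val xs v = (case v of Inl F \<Rightarrow> coord xs F | Inr i \<Rightarrow> (\<Sum>F | F \<in> PF \<and> i \<notin> F. coord xs F) - t i)"

lemma val_simps [simp]: "val xs (Inl F) = coord xs F"
  "val xs (Inr i) = (\<Sum>F | F \<in> PF \<and> i \<notin> F. coord xs F) - t i"
  by (simp_all add: val_def)

lemma PD: "xs \<in> P \<Longrightarrow> distinct xs" "xs \<in> P \<Longrightarrow> j < length xs \<Longrightarrow> xs ! j \<in> E"
  by (auto simp: P_def)

lemma finite_P: "finite P"
  unfolding P_def using finite_subset_distinct[OF finite_E] by (simp only: conj_commute)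

lemma set_drop_nth: "set (drop j xs) = (!) xs ` {j..<length xs}"
proof -
  have "set (drop j xs) = (\<lambda>i. xs ! (j + i)) ` {..<length xs - j}"
    by (auto simp: set_conv_nth)
  also have "\<dots> = (!) xs ` ((+) j ` {..<length xs - j})"
    by (simp add: image_image)
  also have "(+) j ` {..<length xs - j} = {j..<length xs}"
  proof (intro equalityI subsetI)
    fix i assume "i \<in> {j..<length xs}"
    then show "i \<in> (+) j ` {..<length xs - j}" by (intro image_eqI[of _ _ "i - j"]) auto
  qed auto
  finally show ?thesis .
qed

lemma nth_in_drop_iff: "xs \<in> P \<Longrightarrow> l < length xs \<Longrightarrow> xs ! l \<in> set (drop j xs) \<longleftrightarrow> j \<le> l"
  using PD(1)[of xs] by (auto simp: set_drop_nth nth_eq_iff_index_eq image_iff)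

lemma nth_in_fl_iff: "xs \<in> P \<Longrightarrow> l < length xs \<Longrightarrow> xs ! l \<in> fl xs j \<longleftrightarrow> l < j"
  using nth_in_drop_iff[of xs l j] PD(2)[of xs l] by (auto simp: fl_def)

lemma fl_mono: "i \<le> j \<Longrightarrow> fl xs i \<subseteq> fl xs j"
  unfolding fl_def using set_drop_subset_set_drop[of i j xs] by auto

lemma fl_PF: "xs \<in> P \<Longrightarrow> j < length xs \<Longrightarrow> fl xs j \<in> PF"
  using nth_in_fl_iff[of xs j j] PD(2)[of xs j] by (auto simp: PF_eq fl_def)

lemma fl_eq_iff: "xs \<in> P \<Longrightarrow> i < length xs \<Longrightarrow> j < length xs \<Longrightarrow> fl xs i = fl xs j \<longleftrightarrow> i = j"
  using nth_in_fl_iff[of xs i] nth_in_fl_iff[of xs j] by (metis less_irrefl linorder_neqE_nat)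

lemma coord_fl:
  assumes "xs \<in> P" "j < length xs"
  shows "coord xs (fl xs j) = incr xs j"
proof -
  have "coord xs (fl xs j) = (\<Sum>i<length xs. if i = j then incr xs i else 0)"
    unfolding coord_def using assms fl_eq_iff by (intro sum.cong) auto
  then show ?thesis using assms by simp
qed

lemma incr_nz:
  assumes "xs \<in> P" "j < length xs"
  shows "incr xs j \<noteq> 0"
proof (cases j)
  case 0
  then show ?thesis using assms PD(2) t_nz by (simp add: incr_def)
next
  case (Suc i)
  have "xs ! j \<noteq> xs ! i" using PD(1) assms Suc by (simp add: nth_eq_iff_index_eq)
  then show ?thesis using assms Suc PD(2) inj_t by (auto simp: incr_def inj_on_def)
qed

lemma coord_nz_iff: "xs \<in> P \<Longrightarrow> coord xs F \<noteq> 0 \<longleftrightarrow> (\<exists>j<length xs. F = fl xs j)"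
proof -
  assume P: "xs \<in> P"
  have "coord xs F = 0" if "\<And>j. j < length xs \<Longrightarrow> F \<noteq> fl xs j"
    unfolding coord_def using that by (intro sum.neutral) auto
  then show ?thesis using P coord_fl incr_nz by metis
qed

lemma coord_incomparable:
  assumes "xs \<in> P" "\<not> F \<subseteq> G" "\<not> G \<subseteq> F"
  shows "coord xs F * coord xs G = 0"
proof (rule ccontr)
  assume "\<not> ?thesis"
  then obtain i j where "F = fl xs i" "G = fl xs j" using coord_nz_iff assms(1) by auto
  then show False using assms fl_mono[of i j xs] fl_mono[of j i xs] by (metis nat_le_linear)
qed

text \<open>If \<open>i\<close> is not in the list, it lies in every member of the flag, so
  \<open>coord xs F = 0\<close>. If \<open>i = xs ! l\<close>, the increments up to position
  \<open>l\<close> telescope to \<open>t i\<close>, and the value of \<open>y i\<close> is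
  0.\<close>

lemma val_Inr_coord:
  assumes "xs \<in> P" "i \<in> E" "i \<notin> F"
  shows "val xs (Inr i) * coord xs F = 0"
proof (cases "coord xs F = 0")
  case False
  then obtain j where "j < length xs" "F = fl xs j" using coord_nz_iff assms(1) by auto
  then have "i \<in> set (drop j xs)" using assms by (auto simp: fl_def)
  then obtain l where l: "l < length xs" "i = xs ! l" by (auto simp: set_drop_nth)
  have "(\<Sum>G | G \<in> PF \<and> i \<notin> G. coord xs G) =
      (\<Sum>j<length xs. \<Sum>G | G \<in> PF \<and> i \<notin> G. if G = fl xs j then incr xs j else 0)"
    unfolding coord_def by (rule sum.swap)
  also have "\<dots> = (\<Sum>j<length xs. if j \<le> l then incr xs j else 0)"
  proof (intro sum.cong refl)
    fix j assume "j \<in> {..<length xs}"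
    then have "fl xs j \<in> {G. G \<in> PF \<and> i \<notin> G} \<longleftrightarrow> j \<le> l"
      using fl_PF[OF assms(1), of j] nth_in_fl_iff[OF assms(1) l(1), of j] l(2) by auto
    then show "(\<Sum>G | G \<in> PF \<and> i \<notin> G. if G = fl xs j then incr xs j else 0) = (if j \<le> l then incr xs j else 0)"
      by (subst sum.delta) auto
  qed
  also have "\<dots> = (\<Sum>j\<le>l. incr xs j)"
    using l by (intro sum.mono_neutral_cong_right) auto
  also have "\<dots> = t (xs ! l)"
    by (induction l) (simp_all add: incr_def)
  finally show ?thesis using l by simp
qed simp

text \<open>The support of \<open>coord xs\<close> is the flag, and the flag determines the list:
  cardinalities fix the position of each member, and consecutive members differ by one
  entry.\<close>

lemma coord_separates:
  assumes "xs \<in> P" "ys \<in> P" "xs \<noteq> ys"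
  shows "\<exists>F\<in>PF. coord xs F \<noteq> coord ys F"
proof (rule ccontr)
  assume "\<not> ?thesis"
  then have eq: "coord xs F = coord ys F" if "F \<in> PF" for F using that by blast
  have card: "card (fl zs j) = card E - (length zs - j)" if "zs \<in> P" for zs j
  proof -
    have "set (drop j zs) \<subseteq> E" using that set_drop_subset[of j zs] by (auto simp: P_def)
    moreover have "card (set (drop j zs)) = length zs - j"
      using that by (simp add: P_def distinct_card)
    ultimately show ?thesis using finite_E by (simp add: fl_def card_Diff_subset finite_subset)
  qed
  have len: "length zs \<le> card E" if "zs \<in> P" for zs
    using that finite_E card_mono[of E "set zs"] by (simp add: P_def distinct_card)
  have supp: "\<exists>i<length vs. fl us j = fl vs i"
    if "us \<in> P" "vs \<in> P" "j < length us" "\<And>F. F \<in> PF \<Longrightarrow> coord us F = coord vs F" for us vs j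
    using that coord_nz_iff[of us "fl us j"] coord_nz_iff[of vs "fl us j"] fl_PF by auto
  have le: "length us \<le> length vs"
    if h: "us \<in> P" "vs \<in> P" "\<And>F. F \<in> PF \<Longrightarrow> coord us F = coord vs F" for us vs
  proof (cases "length us = 0")
    case False
    then obtain i where i: "i < length vs" "fl us 0 = fl vs i"
      using supp[OF h(1,2) _ h(3), of 0] by blast
    then have "card E - length us = card E - (length vs - i)"
      using card[OF h(1), of 0] card[OF h(2), of i] by simp
    then show ?thesis using len[OF h(1)] len[OF h(2)] i(1) by linarith
  qed simp
  have L: "length xs = length ys" using le[of xs ys] le[of ys xs] assms eq by simp
  have fl: "fl xs j = fl ys j" if j: "j < length xs" for j
  proof -
    obtain i where i: "i < length ys" "fl xs j = fl ys i" using supp[OF assms(1,2) j eq] by blast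
    then have "card E - (length xs - j) = card E - (length ys - i)" using card assms by metis
    then have "i = j" using L len[OF assms(1)] i(1) j by linarith
    then show ?thesis using i by simp
  qed
  have sets: "set (drop j xs) = set (drop j ys)" if "j \<le> length xs" for j
  proof (cases "j = length xs")
    case False
    then have "E - set (drop j xs) = E - set (drop j ys)" using fl[of j] that by (simp add: fl_def)
    moreover have "set (drop j xs) \<subseteq> E" "set (drop j ys) \<subseteq> E"
      using assms set_drop_subset[of j xs] set_drop_subset[of j ys] by (auto simp: P_def)
    ultimately show ?thesis by blast
  qed (use L in simp)
  have "xs = ys"
  proof (rule nth_equalityI[OF L])
    fix j assume j: "j < length xs"
    have "xs ! j \<in> set (drop j ys)" "xs ! j \<notin> set (drop (Suc j) ys)"
      using nth_in_drop_iff[OF assms(1) j, of j] nth_in_drop_iff[OF assms(1) j, of "Suc j"]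
        sets[of j] sets[of "Suc j"] j by auto
    then obtain l where l: "l < length ys" "xs ! j = ys ! l" "j \<le> l" "\<not> Suc j \<le> l"
      using nth_in_drop_iff[OF assms(2)] by (auto simp: set_drop_nth)
    then show "xs ! j = ys ! j" by (metis le_antisym not_less_eq_eq)
  qed
  with assms(3) show False by simp
qed

text \<open>The quadratic generators vanish on \<open>P\<close>, and the linear ones take the value
  \<open>- t i\<close>, the same at every point. That a nonzero value occurs only in degree 1 is
  what lets \<open>ideal_eval_lower\<close> drop the degree by exactly one.\<close>

lemma gens_eval:
  assumes "g \<in> chow_gens E L"
  shows "\<exists>d c. 0 < d \<and> g \<in> homog V d \<and> (\<forall>xs\<in>P. eval_mpoly (val xs) g = c) \<and> (c \<noteq> 0 \<longrightarrow> d = 1)"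
  using assms unfolding chow_gens_def L_diff
proof (elim UnE CollectE exE conjE)
  fix i assume g: "g = y i - (\<Sum>F\<in>{F \<in> PF. i \<notin> F}. x F)" and i: "i \<in> E"
  have "g \<in> homog V 1"
    unfolding g using i
    by (intro mpoly.subspace_diff mpoly.subspace_sum subspace_homog homog_x homog_y) auto
  moreover have "eval_mpoly (val xs) g = - t i" for xs
    unfolding g by (simp add: eval_mpoly_diff eval_mpoly_sum)
  ultimately show ?thesis by (intro exI[of _ 1] exI[of _ "- t i"]) auto
next
  fix F G assume g: "g = x F * x G" and FG: "F \<in> PF" "G \<in> PF" "\<not> F \<subseteq> G" "\<not> G \<subseteq> F"
  have "g \<in> homog V (1 + 1)" unfolding g using FG by (intro homog_mult homog_x) auto
  moreover have "\<forall>xs\<in>P. eval_mpoly (val xs) g = 0"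
    using FG coord_incomparable by (simp add: g eval_mpoly_mult)
  ultimately show ?thesis by (intro exI[of _ "1 + 1"] exI[of _ 0]) auto
next
  fix i F assume g: "g = y i * x F" and iF: "i \<in> E" "F \<in> PF" "i \<notin> F"
  have "g \<in> homog V (1 + 1)" unfolding g using iF by (intro homog_mult homog_x homog_y) auto
  moreover have "\<forall>xs\<in>P. eval_mpoly (val xs) g = 0"
    using iF val_Inr_coord by (simp add: g eval_mpoly_mult del: val_simps) simp
  ultimately show ?thesis by (intro exI[of _ "1 + 1"] exI[of _ 0]) auto
qed

text \<open>On the points of \<open>P\<close> the relations hold only up to terms of lower degree.\<close>

lemma ideal_eval_lower:
  assumes "f \<in> I" "f \<in> homog V j"
  obtains q where "q = 0 \<or> (\<exists>i<j. q \<in> homog V i)" "\<And>xs. xs \<in> P \<Longrightarrow> eval_mpoly (val xs) f = eval_mpoly (val xs) q"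
proof -
  obtain S c where S: "f = (\<Sum>g\<in>S. c g * g)" "finite S" "S \<subseteq> chow_gens E L" "\<forall>g\<in>S. c g \<in> R"
    using assms(1) by (auto simp: chow_ideal_def ideal_gen_def)
  have "\<forall>g\<in>S. \<exists>d s. 0 < d \<and> g \<in> homog V d \<and> (\<forall>xs\<in>P. eval_mpoly (val xs) g = s) \<and> (s \<noteq> 0 \<longrightarrow> d = 1)"
    using S(3) gens_eval by blast
  then obtain d s where ds: "\<And>g. g \<in> S \<Longrightarrow> 0 < d g \<and> g \<in> homog V (d g) \<and>
      (\<forall>xs\<in>P. eval_mpoly (val xs) g = s g) \<and> (s g \<noteq> 0 \<longrightarrow> d g = (1 :: nat))"
    by metis
  have f: "f = (\<Sum>g\<in>S. if d g \<le> j then hcomp (j - d g) (c g) * g else 0)"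
  proof -
    have "f = hcomp j f" using hcomp_of_homog[OF assms(2)] by simp
    also have "\<dots> = (\<Sum>g\<in>S. hcomp j (c g * g))" by (simp add: S(1) hcomp_sum)
    also have "\<dots> = (\<Sum>g\<in>S. if d g \<le> j then hcomp (j - d g) (c g) * g else 0)"
      using S(4) ds by (intro sum.cong refl hcomp_mult_homog) auto
    finally show ?thesis .
  qed
  \<comment> \<open>Each generator is replaced by its constant value on \<open>P\<close>. Only
    generators of degree 1 have a nonzero value, so just the components of degree
    \<open>j - 1\<close> of the cofactors survive.\<close>
  define q where "q = (\<Sum>g\<in>S. if 0 < j then qscale (s g) (hcomp (j - 1) (c g)) else 0)"
  show ?thesis
  proof
    show "q = 0 \<or> (\<exists>i<j. q \<in> homog V i)"
    proof (cases "0 < j")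
      case True
      have "q \<in> homog V (j - 1)"
        unfolding q_def using True S(4)
        by (auto intro!: mpoly.subspace_sum mpoly.subspace_scale subspace_homog hcomp_homog)
      then show ?thesis using True by (intro disjI2 exI[of _ "j - 1"]) auto
    qed (simp add: q_def)
    fix xs assume xs: "xs \<in> P"
    show "eval_mpoly (val xs) f = eval_mpoly (val xs) q"
      unfolding f q_def eval_mpoly_sum
    proof (intro sum.cong refl)
      fix g assume g: "g \<in> S"
      from ds[OF g] xs show "eval_mpoly (val xs) (if d g \<le> j then hcomp (j - d g) (c g) * g else 0) =
          eval_mpoly (val xs) (if 0 < j then qscale (s g) (hcomp (j - 1) (c g)) else 0)"
        by (cases "s g = 0") (auto simp: eval_mpoly_mult eval_mpoly_qscale)
    qed
  qed
qed

definition evf :: "'a mpoly \<Rightarrow> 'a list \<Rightarrow> rat" where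
  "evf p = (\<lambda>xs. if xs \<in> P then eval_mpoly (val xs) p else 0)"

lemma evf_add: "evf (p + q) = evf p + evf q"
  by (auto simp: evf_def eval_mpoly_add)

lemma evf_0: "evf 0 = 0"
  by (auto simp: evf_def)

lemma evf_qscale: "evf (qscale c p) = (\<lambda>xs. c * evf p xs)"
  by (auto simp: evf_def eval_mpoly_qscale)

lemma evf_sum: "evf (sum f A) = (\<Sum>a\<in>A. evf (f a))"
  by (induction A rule: infinite_finite_induct) (auto simp: evf_add evf_0)

lemma evf_span: "q \<in> mpoly.span S \<Longrightarrow> evf q \<in> rat_fun.span (evf ` S)"
proof (induction rule: mpoly.span_induct_alt)
  case base
  then show ?case unfolding evf_0 by (rule rat_fun.span_zero)
next
  case (step c p q)
  then show ?case
    unfolding evf_add evf_qscale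
    by (intro rat_fun.span_add[OF rat_fun.span_scale[OF rat_fun.span_base]]) auto
qed

abbreviation "FYB \<equiv> FY E (card E)"
abbreviation "degB \<equiv> FY_deg E (card E)"

text \<open>Induction on the degree: modulo \<open>I\<close> the polynomial is a combination of FY
  monomials of degree \<open>i\<close>, and the correction in \<open>I\<close> agrees on
  \<open>P\<close> with a polynomial of lower degree.\<close>

lemma evf_homog: "p \<in> homog V i \<Longrightarrow> evf p \<in> rat_fun.span (evf ` mono ` {a \<in> FYB. degB a < Suc i})"
proof (induction i arbitrary: p rule: less_induct)
  case (less i)
  obtain q where q: "q \<in> mpoly.span (mono ` {a \<in> FYB. degB a = i})" "p - q \<in> I"
    using homog_spanned_mono[OF less.prems] by (auto simp: spanned_def)
  have "q \<in> homog V i"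
    using q(1) mpoly.span_minimal[OF _ subspace_homog, of "mono ` {a \<in> FYB. degB a = i}" V i] homog_mono
    by auto
  then have "p - q \<in> homog V i"
    using less.prems by (intro mpoly.subspace_diff subspace_homog)
  from ideal_eval_lower[OF q(2) this] obtain q' where
    q': "q' = 0 \<or> (\<exists>i'<i. q' \<in> homog V i')" "\<And>xs. xs \<in> P \<Longrightarrow> eval_mpoly (val xs) (p - q) = eval_mpoly (val xs) q'"
    by blast
  have "evf p = evf q + evf (p - q)" by (simp flip: evf_add)
  also have "evf (p - q) = evf q'" using q'(2) by (auto simp: evf_def)
  finally have eq: "evf p = evf q + evf q'" .
  have "evf q \<in> rat_fun.span (evf ` mono ` {a \<in> FYB. degB a < Suc i})"
    using evf_span[OF q(1)]
    by (rule subsetD[OF rat_fun.span_mono, rotated]) auto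
  moreover have "evf q' \<in> rat_fun.span (evf ` mono ` {a \<in> FYB. degB a < Suc i})"
    using q'(1)
  proof
    assume "q' = 0"
    then show ?thesis by (simp only: evf_0 rat_fun.span_zero)
  next
    assume "\<exists>i'<i. q' \<in> homog V i'"
    then obtain i' where "i' < i" "q' \<in> homog V i'" by blast
    from less.IH[OF this] show ?thesis
      by (rule subsetD[OF rat_fun.span_mono, rotated]) (use \<open>i' < i\<close> in auto)
  qed
  ultimately show ?case unfolding eq by (rule rat_fun.span_add)
qed

lemma evf_R:
  assumes "p \<in> R"
  shows "evf p \<in> rat_fun.span (evf ` mono ` FYB)"
proof -
  have "evf p = (\<Sum>j\<in>mon_deg ` Poly_Mapping.keys p. evf (hcomp j p))"
    by (subst sum_hcomp[OF assms]) (rule evf_sum)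
  also have "\<dots> \<in> rat_fun.span (evf ` mono ` FYB)"
  proof (rule rat_fun.span_sum)
    fix j
    show "evf (hcomp j p) \<in> rat_fun.span (evf ` mono ` FYB)"
      using evf_homog[OF hcomp_homog[OF assms]]
      by (rule subsetD[OF rat_fun.span_mono, rotated]) auto
  qed
  finally show ?thesis .
qed

definition delta :: "'a list \<Rightarrow> 'a list \<Rightarrow> rat" where
  "delta xs ys = (if ys = xs then 1 else 0)"

text \<open>Lagrange interpolation: the coordinates \<open>x F\<close> separate the points, so every
  function on \<open>P\<close> comes from a polynomial.\<close>

lemma delta_in_span:
  assumes xs: "xs \<in> P"
  shows "delta xs \<in> rat_fun.span (evf ` mono ` FYB)"
proof -
  have "\<forall>ys\<in>P - {xs}. \<exists>F\<in>PF. coord xs F \<noteq> coord ys F"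
    using coord_separates xs by blast
  then obtain F where F: "\<And>ys. ys \<in> P - {xs} \<Longrightarrow> F ys \<in> PF \<and> coord xs (F ys) \<noteq> coord ys (F ys)"
    by metis
  define p where "p = (\<Prod>ys\<in>P - {xs}. x (F ys) - Poly_Mapping.single 0 (coord ys (F ys)))"
  define c where "c = eval_mpoly (val xs) p"
  have ev: "eval_mpoly (val zs) p = (\<Prod>ys\<in>P - {xs}. coord zs (F ys) - coord ys (F ys))" for zs
    unfolding p_def by (simp add: eval_mpoly_prod eval_mpoly_diff)
  have "c \<noteq> 0" using F finite_P by (simp add: c_def ev)
  have 0: "eval_mpoly (val zs) p = 0" if "zs \<in> P" "zs \<noteq> xs" for zs
    unfolding ev using that finite_P by (intro prod_zero) auto
  have "delta xs = evf (qscale (1 / c) p)"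
    using \<open>c \<noteq> 0\<close> 0 xs by (auto simp: fun_eq_iff delta_def evf_def eval_mpoly_qscale c_def)
  moreover have "qscale (1 / c) p \<in> R"
    unfolding p_def using F by (intro poly_ring_qscale poly_ring_prod poly_ring_diff poly_ring_const xR) blast
  ultimately show ?thesis using evf_R by simp
qed

lemma inj_delta: "inj delta"
  by (rule injI) (metis delta_def zero_neq_one)

lemma independent_delta: "rat_fun.independent (delta ` P)"
proof (rule rat_fun.independent_if_scalars_zero)
  show "finite (delta ` P)" using finite_P by simp
  fix f v assume sum: "(\<Sum>v\<in>delta ` P. (\<lambda>ys. f v * v ys)) = 0" and "v \<in> delta ` P"
  then obtain xs where xs: "xs \<in> P" "v = delta xs" by auto
  have "(\<Sum>v\<in>delta ` P. (\<lambda>ys. f v * v ys)) = (\<Sum>zs\<in>P. (\<lambda>ys. f (delta zs) * delta zs ys))"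
    using inj_delta by (subst sum.reindex) (auto intro: inj_on_subset)
  then have "0 = (\<Sum>zs\<in>P. (\<lambda>ys. f (delta zs) * delta zs ys)) xs"
    using sum by simp
  also have "\<dots> = (\<Sum>zs\<in>P. f (delta zs) * delta zs xs)"
    by (simp add: sum_fun_apply)
  also have "\<dots> = (\<Sum>zs\<in>P. if zs = xs then f (delta zs) else 0)"
    by (intro sum.cong) (auto simp: delta_def)
  also have "\<dots> = f v" using xs finite_P by simp
  finally show "f v = 0" by simp
qed

lemma card_FYB: "card FYB = card P"
  unfolding P_def by (rule card_FY_eq_card_distinct_lists[OF finite_E E_ne])

text \<open>The FY monomials span all functions on \<open>P\<close>, a space of dimension
  \<open>card P\<close>, and there are exactly \<open>card P\<close> of them; so they can neither
  coincide nor satisfy a relation.\<close>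

lemma evf_mono_basis:
  shows inj_evf_mono: "inj_on (evf \<circ> mono) FYB"
    and independent_evf_mono: "rat_fun.independent (evf ` mono ` FYB)"
proof -
  let ?B = "evf ` mono ` FYB"
  have finB: "finite ?B" using finite_E by simp
  have card: "card P \<le> card T" if "finite T" "rat_fun.span ?B \<subseteq> rat_fun.span T" for T
  proof -
    have "delta ` P \<subseteq> rat_fun.span T" using delta_in_span that by blast
    then have "card (delta ` P) \<le> card T"
      using rat_fun.independent_span_bound[OF that(1) independent_delta] by blast
    then show ?thesis using inj_delta by (simp add: card_image inj_on_subset)
  qed
  have B: "card P \<le> card ?B" using card[OF finB] by simp
  have "card ((evf \<circ> mono) ` FYB) = card FYB"
    using B card_FYB card_image_le[of FYB "evf \<circ> mono"] finite_E by (simp add: image_comp)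
  then show "inj_on (evf \<circ> mono) FYB"
    using finite_E by (intro eq_card_imp_inj_on) auto
  show "rat_fun.independent ?B"
  proof
    assume "rat_fun.dependent ?B"
    then obtain b where b: "b \<in> ?B" "b \<in> rat_fun.span (?B - {b})"
      unfolding rat_fun.dependent_def by blast
    then have "rat_fun.span ?B \<subseteq> rat_fun.span (?B - {b})"
      using rat_fun.span_redundant[of b "?B - {b}"] by (simp add: insert_absorb)
    then have "card P \<le> card (?B - {b})" using finB by (intro card) auto
    also have "\<dots> < card ?B" using b finB by (intro psubset_card_mono) auto
    also have "\<dots> \<le> card FYB"
      using card_image_le[of FYB "evf \<circ> mono"] finite_E by (simp add: image_comp)
    finally show False by (simp add: card_FYB)
  qed
qed

text \<open>A relation of degree \<open>j\<close> would agree on \<open>P\<close> with a polynomial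
  of lower degree, hence with a combination of FY monomials of degree below \<open>j\<close>,
  against independence as functions. The indexing by \<open>g\<close> serves the transfer from
  smaller rank.\<close>

lemma mono_independent:
  assumes A: "finite A" "inj_on g A" "\<And>a. a \<in> A \<Longrightarrow> g a \<in> FYB \<and> degB (g a) = j"
    and "(\<Sum>a\<in>A. qscale (c a) (mono (g a))) \<in> I" "a \<in> A"
  shows "c a = 0"
proof (rule ccontr)
  let ?f = "\<Sum>a\<in>A. qscale (c a) (mono (g a))"
  let ?B = "evf ` mono ` FYB"
  let ?u = "\<lambda>a. evf (mono (g a))"
  assume nz: "c a \<noteq> 0"
  have "?f \<in> homog V j"
    using A(3) homog_mono by (intro mpoly.subspace_sum mpoly.subspace_scale subspace_homog) metis
  from ideal_eval_lower[OF assms(4) this] obtain q where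
    q: "q = 0 \<or> (\<exists>i<j. q \<in> homog V i)" "\<And>xs. xs \<in> P \<Longrightarrow> eval_mpoly (val xs) ?f = eval_mpoly (val xs) q"
    by blast
  have neq: "?u a \<noteq> evf (mono b)" if "b \<in> FYB" "b \<noteq> g a" for b
    using inj_onD[OF inj_evf_mono, of "g a" b] A(3)[OF assms(5)] that by auto
  have q_span: "evf q \<in> rat_fun.span (?B - {?u a})"
    using q(1)
  proof
    assume "q = 0"
    then show ?thesis by (simp only: evf_0 rat_fun.span_zero)
  next
    assume "\<exists>i<j. q \<in> homog V i"
    then obtain i where "i < j" "q \<in> homog V i" by blast
    from evf_homog[OF this(2)] show ?thesis
      by (rule subsetD[OF rat_fun.span_mono, rotated]) (use \<open>i < j\<close> A(3)[OF assms(5)] neq in force)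
  qed
  have "evf q = evf ?f" using q(2) by (auto simp: evf_def)
  also have "\<dots> = (\<Sum>b\<in>A. (\<lambda>xs. c b * ?u b xs))" by (simp add: evf_sum evf_qscale)
  also have "\<dots> = (\<lambda>xs. c a * ?u a xs) + (\<Sum>b\<in>A - {a}. (\<lambda>xs. c b * ?u b xs))"
    using A(1) assms(5) by (rule sum.remove)
  finally have eq: "(\<lambda>xs. c a * ?u a xs) = evf q - (\<Sum>b\<in>A - {a}. (\<lambda>xs. c b * ?u b xs))" by simp
  have "(\<lambda>xs. c a * ?u a xs) \<in> rat_fun.span (?B - {?u a})"
    unfolding eq
  proof (intro rat_fun.span_diff q_span rat_fun.span_sum rat_fun.span_scale rat_fun.span_base)
    fix b assume b: "b \<in> A - {a}"
    then have "g b \<noteq> g a" using inj_onD[OF A(2), of b a] assms(5) by auto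
    then show "?u b \<in> ?B - {?u a}" using neq[of "g b"] A(3)[of b] b by auto
  qed
  from rat_fun.span_scale[OF this, of "1 / c a"] nz have "?u a \<in> rat_fun.span (?B - {?u a})" by simp
  then have "rat_fun.dependent ?B"
    unfolding rat_fun.dependent_def using A(3)[OF assms(5)] by blast
  then show False using independent_evf_mono by simp
qed

end

section \<open>Transfer of independence to rank \<open>k\<close>\<close>

context uniform_chow
begin

text \<open>Multiplication by \<open>\<alpha> ^ (card E - k)\<close> embeds the ring of rank \<open>k\<close> into the Boolean one.\<close>

lemma mono_independent_uniform:
  assumes "finite A" "\<And>a. a \<in> A \<Longrightarrow> a \<in> FY E k \<and> FY_deg E k a = j"
    and "(\<Sum>a\<in>A. qscale (c a) (mono a)) \<in> I" "a \<in> A"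
  shows "c a = 0"
proof -
  obtain f :: "'a \<Rightarrow> nat" where f: "inj_on f E"
    using finite_imp_inj_to_nat_seg[OF fin] by blast
  \<comment> \<open>Any injective nonzero choice will do; \<open>Suc\<close> avoids the value
    0.\<close>
  define t where "t i = (of_nat (Suc (f i)) :: rat)" for i
  have E_ne: "E \<noteq> {}" using k_pos k_le by auto
  interpret B: boolean_chow E t
  proof
    show "inj_on t E" using f by (auto simp: inj_on_def t_def)
    show "t i \<noteq> 0" for i unfolding t_def by (simp only: of_nat_eq_0_iff)
  qed (use fin E_ne in auto)
  define m where "m = card E - k"
  have PF_sub: "PF \<subseteq> B.PF" by (auto simp: PF_def B.PF_eq)
  have V_sub: "V \<subseteq> B.V" using PF_sub by (auto simp: V_eq B.V_eq)
  have pow_R: "B.\<alpha> ^ i \<in> B.R" for i by auto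
  \<comment> \<open>A set \<open>F\<close> with at least \<open>k\<close> elements satisfies
    \<open>x F * \<alpha> ^ (card E - card F) = 0\<close> in the Boolean ring, and
    \<open>card E - card F \<le> m\<close>. So after multiplication by \<open>\<alpha> ^ m\<close>
    only the flats of the rank \<open>k\<close> matroid count.\<close>
  have kill: "B.\<alpha> ^ m * B.x F \<in> B.I" if "F \<in> B.PF - PF" for F
  proof -
    have F: "F \<subset> E" "k \<le> card F" using that by (auto simp: PF_def B.PF_eq)
    have "card F < card E" using F fin by (simp add: psubset_card_mono)
    have "B.X F * B.red E ^ (rk E (card E) E - rk E (card E) F) \<in> B.I"
      using that F by (intro B.X_red_power) auto
    then have base: "B.x F * B.\<alpha> ^ (card E - card F) \<in> B.I"
      using that less_imp_neq[OF F(1)] by (simp add: B.X_PF B.red_def rk_def)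
    have "B.\<alpha> ^ (m - (card E - card F)) * (B.x F * B.\<alpha> ^ (card E - card F)) \<in> B.I"
      by (rule B.I_mult[OF base pow_R])
    moreover have "m = m - (card E - card F) + (card E - card F)"
      using F \<open>card F < card E\<close> by (simp add: m_def)
    then have "B.\<alpha> ^ m = B.\<alpha> ^ (m - (card E - card F)) * B.\<alpha> ^ (card E - card F)"
      by (metis power_add)
    ultimately show ?thesis by (simp only: mult_ac)
  qed
  have kill_sum: "B.\<alpha> ^ m * (\<Sum>F\<in>S. B.x F) \<in> B.I" if "S \<subseteq> B.PF - PF" for S
    unfolding sum_distrib_left using that kill by (intro B.I_sum) auto
  have gens: "B.\<alpha> ^ m * g \<in> B.I" if "g \<in> chow_gens E L" for g
    using that unfolding chow_gens_def L_diff
  proof (elim UnE CollectE exE conjE)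
    fix i assume g: "g = y i - (\<Sum>F\<in>{F \<in> PF. i \<notin> F}. x F)" and i: "i \<in> E"
    have "B.nabove {i} = (\<Sum>F\<in>{F \<in> PF. i \<notin> F}. x F) + (\<Sum>F\<in>{F \<in> B.PF - PF. i \<notin> F}. x F)"
    proof -
      have "{F \<in> PF. i \<notin> F} = {F \<in> B.PF. F \<in> PF \<and> i \<notin> F}" using PF_sub by auto
      moreover have "{F \<in> B.PF - PF. i \<notin> F} = {F \<in> B.PF. F \<notin> PF \<and> i \<notin> F}" by auto
      ultimately show ?thesis
        unfolding B.nabove_def by (simp only:) (intro sum_Collect_split; auto)
    qed
    then have "g = (B.y i - B.nabove {i}) + (\<Sum>F\<in>{F \<in> B.PF - PF. i \<notin> F}. x F)"
      using g by simp
    then have "B.\<alpha> ^ m * g = B.\<alpha> ^ m * (B.y i - B.nabove {i}) + B.\<alpha> ^ m * (\<Sum>F\<in>{F \<in> B.PF - PF. i \<notin> F}. x F)"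
      by (simp only: distrib_left)
    also have "\<dots> \<in> B.I"
      using i by (intro B.I_add B.I_mult B.gen_y kill_sum pow_R) auto
    finally show ?thesis .
  next
    fix F G assume "g = x F * x G" "F \<in> PF" "G \<in> PF" "\<not> F \<subseteq> G" "\<not> G \<subseteq> F"
    then show ?thesis using B.I_mult[OF B.gen_xx[of F G] pow_R] PF_sub by auto
  next
    fix i F assume "g = y i * x F" "i \<in> E" "F \<in> PF" "i \<notin> F"
    then show ?thesis using B.I_mult[OF B.gen_yx[of i F] pow_R] PF_sub by auto
  qed
  have ideal: "B.\<alpha> ^ m * p \<in> B.I" if "p \<in> I" for p
    using ideal_gen_subset_ideal[of "chow_gens E L" "B.\<alpha> ^ m" B.V "chow_gens E B.L" V p] gens V_sub that
    unfolding chow_ideal_def by blast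
  have \<alpha>_R: "\<alpha> \<in> B.R"
    using alphaR poly_ring_mono[OF V_sub] by blast
  have alpha_diff: "B.\<alpha> ^ m * (B.\<alpha> - \<alpha>) \<in> B.I"
  proof -
    have "B.\<alpha> - \<alpha> = (\<Sum>F\<in>B.PF - PF. B.x F)"
      unfolding B.\<alpha>_def \<alpha>_def using PF_sub B.finite_PF by (simp only: sum_diff)
    then show ?thesis using kill_sum[of "B.PF - PF"] by simp
  qed
  have alpha_power: "B.\<alpha> ^ m * (B.\<alpha> ^ e - \<alpha> ^ e) \<in> B.I" for e
  proof (induction e)
    case 0
    then show ?case by (simp add: B.I_0)
  next
    case (Suc e)
    have "B.\<alpha> ^ m * (B.\<alpha> ^ Suc e - \<alpha> ^ Suc e) =
        \<alpha> * (B.\<alpha> ^ m * (B.\<alpha> ^ e - \<alpha> ^ e)) + B.\<alpha> ^ e * (B.\<alpha> ^ m * (B.\<alpha> - \<alpha>))"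
      by (simp add: algebra_simps)
    also have "\<dots> \<in> B.I"
      by (intro B.I_add B.I_mult[OF Suc] B.I_mult[OF alpha_diff] \<alpha>_R pow_R)
    finally show ?case .
  qed
  \<comment> \<open>Multiplication by \<open>\<alpha> ^ m\<close> raises the exponent of
    \<open>E\<close> by \<open>m\<close>; this turns the bounds \<open>a E \<le> k\<close> and
    \<open>a E + card G < k\<close> into the Boolean ones with \<open>card E\<close>.\<close>
  define g where "g a = a(E := a E + m)" for a :: "'a set \<Rightarrow> nat"
  have mono: "B.mono (g a) - B.\<alpha> ^ m * mono a \<in> B.I" if "a \<in> FY E k" for a
  proof -
    define w where "w = (\<Prod>F\<in>PF. x F ^ a F)"
    have "mono a = X E ^ a E * (\<Prod>F\<in>PF. X F ^ a F)"
      unfolding mono_def L_eq using E_notin_PF by simp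
    then have mono: "mono a = \<alpha> ^ a E * w"
      unfolding w_def by (simp add: X_PF X_def[of E] cong: prod.cong)
    have "B.mono (g a) = B.X E ^ (a E + m) * (\<Prod>F\<in>B.PF. B.X F ^ g a F)"
      unfolding B.mono_def B.L_eq using B.E_notin_PF by (simp add: g_def)
    also have "(\<Prod>F\<in>B.PF. B.X F ^ g a F) = (\<Prod>F\<in>PF. x F ^ a F)"
    proof (rule prod.mono_neutral_cong_right)
      show "\<forall>F\<in>B.PF - PF. B.X F ^ g a F = 1"
      proof
        fix F assume F: "F \<in> B.PF - PF"
        then have "F \<notin> L" "F \<noteq> E" using L_cases B.E_notin_PF by auto
        then have "g a F = 0" using FYD(1)[OF that] by (simp add: g_def)
        then show "B.X F ^ g a F = 1" by simp
      qed
      show "B.X F ^ g a F = x F ^ a F" if "F \<in> PF" for F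
        using that E_notin_PF PF_sub B.X_PF[of F] by (auto simp: g_def)
    qed (use PF_sub B.finite_PF in auto)
    finally have "B.mono (g a) = B.\<alpha> ^ (a E + m) * w" by (simp add: B.X_def w_def)
    then have "B.mono (g a) - B.\<alpha> ^ m * mono a = w * (B.\<alpha> ^ m * (B.\<alpha> ^ a E - \<alpha> ^ a E))"
      by (simp add: mono power_add algebra_simps)
    moreover have "w \<in> B.R"
      unfolding w_def using PF_sub by (intro poly_ring_prod poly_ring_power B.xR) auto
    ultimately show ?thesis using B.I_mult[OF alpha_power] by simp
  qed
  have sum: "(\<Sum>a\<in>A. qscale (c a) (B.mono (g a))) \<in> B.I"
  proof -
    have "(\<Sum>a\<in>A. qscale (c a) (B.mono (g a))) = (\<Sum>a\<in>A. qscale (c a) (B.mono (g a) - B.\<alpha> ^ m * mono a)) +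
        B.\<alpha> ^ m * (\<Sum>a\<in>A. qscale (c a) (mono a))"
      by (simp add: sum_distrib_left qscale_mult_right mpoly.scale_right_diff_distrib sum_subtractf)
    also have "\<dots> \<in> B.I"
      using assms(2,3) mono ideal
      by (intro B.I_add B.I_sum mpoly.subspace_scale[OF B.subspace_I]) auto
    finally show ?thesis .
  qed
  have inj: "inj_on g A"
  proof (rule inj_onI, rule ext)
    fix a b F assume "g a = g b"
    then have "g a F = g b F" by simp
    then show "a F = b F" by (simp add: g_def split: if_splits)
  qed
  have lev: "g a \<in> FY E (card E) \<and> FY_deg E (card E) (g a) = j + m" if "a \<in> A" for a
  proof
    have a: "a \<in> FY E k" "FY_deg E k a = j" using assms(2)[OF that] by auto
    note aD = FYD[OF a(1)]
    have le: "a E \<le> k" using aD(2)[of E] by (simp add: rk_def)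
    have lt: "a E + card G < k" if "0 < a G" "G \<noteq> E" for G
    proof -
      have G: "G \<in> PF" using aD(5)[OF that(1)] that(2) L_cases by blast
      show ?thesis
        using aD(4)[of E G] that PFD(1,2)[OF G] by (cases "a E = 0") (auto simp: rk_def)
    qed
    show "g a \<in> FY E (card E)"
      unfolding FY_def trunc_lattice_card[OF fin] rk_card
    proof (intro CollectI conjI allI ballI impI)
      show "g a F = 0" if "F \<notin> Pow E" for F
        using that aD(1)[of F] by (auto simp: g_def trunc_lattice_def)
      show "g a F < Suc (card F)" for F
        using le k_le aD(2)[of F] aD(1)[of F]
        by (cases "F \<in> L"; cases "F = E") (simp_all add: g_def m_def rk_def)
      fix F G assume FG: "F \<in> Pow E" "G \<in> Pow E" "0 < g a F" "0 < g a G"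
      show "F \<subseteq> G \<or> G \<subseteq> F"
        using FG aD(3)[of F G] by (cases "F = E"; cases "G = E") (simp_all add: g_def)
      show "g a F + Suc (card G) < Suc (card F)" if GF: "G \<subset> F"
      proof (cases "F = E")
        case True
        then have "G \<noteq> E" using GF by blast
        moreover from this have "0 < a G" using FG(4) by (simp add: g_def)
        ultimately show ?thesis using lt[of G] k_le True by (simp add: g_def m_def)
      next
        case False
        moreover from this have "G \<noteq> E" using FG(1) GF by blast
        ultimately have "0 < a F" "0 < a G" "G \<noteq> E" using FG(3,4) by (simp_all add: g_def)
        then show ?thesis using aD(4)[of F G] GF False by (simp add: g_def rk_def)
      qed
    qed
    have "FY_deg E (card E) (g a) = (a E + m) + (\<Sum>F\<in>B.PF. a F)"
    proof -
      have "(\<Sum>F\<in>B.PF. g a F) = (\<Sum>F\<in>B.PF. a F)"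
        using B.E_notin_PF by (intro sum.cong) (auto simp: g_def)
      then show ?thesis unfolding FY_deg_def B.L_eq using B.E_notin_PF by (simp add: g_def)
    qed
    also have "(\<Sum>F\<in>B.PF. a F) = (\<Sum>F\<in>PF. a F)"
    proof (rule sum.mono_neutral_right)
      show "\<forall>F\<in>B.PF - PF. a F = 0"
        using aD(1) L_cases B.E_notin_PF by (metis DiffD1 DiffD2)
    qed (use PF_sub in auto)
    also have "a E + m + (\<Sum>F\<in>PF. a F) = FY_deg E k a + m"
      unfolding FY_deg_def L_eq using E_notin_PF by simp
    finally show "FY_deg E (card E) (g a) = j + m" using a(2) by simp
  qed
  show ?thesis by (rule B.mono_independent[OF assms(1) inj lev sum assms(4)])
qed

lemma chow_dim_eq: "chow_dim E L j = card {a \<in> FY E k. FY_deg E k a = j}"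
  unfolding chow_dim_def
proof (rule mpoly.dim_diff_eq_card)
  let ?A = "{a \<in> FY E k. FY_deg E k a = j}"
  show "mpoly.subspace (homog V j)" by (rule subspace_homog)
  show "homog V j \<subseteq> mpoly.span ((\<lambda>m. Poly_Mapping.single m 1) ` {m. Poly_Mapping.keys m \<subseteq> V \<and> mon_deg m = j})"
    by (rule homog_spanned)
  show "finite ((\<lambda>m. Poly_Mapping.single m (1 :: rat)) ` {m. Poly_Mapping.keys m \<subseteq> V \<and> mon_deg m = j})"
    using finite_monomials[OF finite_V] by simp
  show "mpoly.subspace (homog V j \<inter> I)"
    by (intro mpoly.subspace_inter subspace_homog subspace_I)
  show finA: "finite ?A" using fin by simp
  show mono: "mono a \<in> homog V j" if "a \<in> ?A" for a
    using that homog_mono[of a] by simp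
  show "\<exists>v\<in>mpoly.span (mono ` ?A). w - v \<in> homog V j \<inter> I" if w: "w \<in> homog V j" for w
  proof -
    obtain q where q: "q \<in> mpoly.span (mono ` ?A)" "w - q \<in> I"
      using homog_spanned_mono[OF w] by (auto simp: spanned_def)
    have "q \<in> homog V j"
      using q(1) mpoly.span_minimal[OF _ subspace_homog, of "mono ` ?A" V j] mono by auto
    then show ?thesis using q w mpoly.subspace_diff[OF subspace_homog] by blast
  qed
  show "\<forall>a\<in>?A. c a = 0" if "(\<Sum>a\<in>?A. qscale (c a) (mono a)) \<in> homog V j \<inter> I" for c
    using mono_independent_uniform[OF finA _ that[THEN IntD2]] by blast
qed simp

end

section \<open>Flats of uniform matroids and conclusion\<close>

lemma flats_uniform:
  assumes "finite E" "k \<le> card E"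
  shows "flats E (\<lambda>A. min (card A) k) = trunc_lattice E k"
proof (intro equalityI subsetI)
  fix A assume A: "A \<in> flats E (\<lambda>A. min (card A) k)"
  show "A \<in> trunc_lattice E k"
  proof (cases "A = E")
    case False
    then obtain e where e: "e \<in> E - A" using A by (auto simp: flats_def)
    then have "min (card A) k < min (card (insert e A)) k" using A by (auto simp: flats_def)
    then have "card A < k" by linarith
    then show ?thesis using A False by (auto simp: trunc_lattice_def flats_def)
  qed (simp add: trunc_lattice_def)
next
  fix A assume A: "A \<in> trunc_lattice E k"
  then have "finite A" using assms(1) by (auto simp: trunc_lattice_def intro: finite_subset)
  then have "card (insert e A) = Suc (card A)" if "e \<in> E - A" for e
    using that by simp
  then show "A \<in> flats E (\<lambda>A. min (card A) k)"
    using A by (auto simp: trunc_lattice_def flats_def)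
qed

lemma aug_chow_hilbert_uniform:
  assumes "1 \<le> k" "k \<le> n"
  shows "aug_chow_hilbert (uniform_ground n) (uniform_rank k) = fps_of_poly (E_refined [:0, 1:] (n - k) k 0)"
proof (rule fps_ext)
  fix j
  interpret uniform_chow "{1..n}" k
    using assms by unfold_locales auto
  have rank: "uniform_rank k = (\<lambda>A. min (card A) k)" by (auto simp: uniform_rank_def)
  have "fps_nth (aug_chow_hilbert (uniform_ground n) (uniform_rank k)) j =
      real (card {a \<in> FY {1..n} k. FY_deg {1..n} k a = j})"
    using assms flats_uniform[of "{1..n}" k]
    by (simp add: aug_chow_hilbert_def uniform_ground_def rank chow_dim_eq[unfolded One_nat_def])
  also have "\<dots> = coeff (\<Sum>a\<in>FY {1..n} k. monom 1 (FY_deg {1..n} k a)) j"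
    by (simp add: coeff_sum sum.If_cases Int_def)
  also have "(\<Sum>a\<in>FY {1..n} k. monom 1 (FY_deg {1..n} k a)) = chow_poly [:0, 1 :: real:] k n"
    using sum_FY[of "{1..n}" k "[:0, 1 :: real:]"] assms by (simp add: monom_altdef)
  also have "\<dots> = E_refined [:0, 1:] (n - k) k 0"
    using assms by (simp add: E_refined_eq_chow_poly_poly del: E_refined.simps)
  finally show "fps_nth (aug_chow_hilbert (uniform_ground n) (uniform_rank k)) j =
      fps_nth (fps_of_poly (E_refined [:0, 1:] (n - k) k 0)) j"
    by simp
qed

theorem theorem5p2:
  shows "(\<forall>k n :: nat. 2 \<le> k \<and> k \<le> n \<longrightarrow>
            fps_of_poly (E_tilde [n - k + 2 ..< n + 1])
              = aug_chow_hilbert (uniform_ground n) (uniform_rank k))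
       \<and> (\<forall>k n :: nat. 1 \<le> k \<and> k \<le> n \<longrightarrow>
            (\<exists>p. fps_of_poly p = aug_chow_hilbert (uniform_ground n) (uniform_rank k)
                 \<and> real_rooted p))"
proof (intro conjI allI impI; elim conjE)
  fix k n :: nat
  assume kn: "2 \<le> k" "k \<le> n"
  then have n: "n - k + 2 + (k - 1) = n + 1" and k: "Suc (k - 1) = k" by simp_all
  from kn show "fps_of_poly (E_tilde [n - k + 2 ..< n + 1]) = aug_chow_hilbert (uniform_ground n) (uniform_rank k)"
    using E_tilde_eq_E_refined[of "n - k" "k - 1", unfolded n k] aug_chow_hilbert_uniform[of k n] by simp
next
  fix k n :: nat
  assume "1 \<le> k" "k \<le> n"
  \<comment> \<open>The case \<open>k = 1\<close>, whose list of moduli would be empty, is covered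
    as well: real-rootedness is known for the entries \<open>E_refined\<close> themselves.\<close>
  then show "\<exists>p. fps_of_poly p = aug_chow_hilbert (uniform_ground n) (uniform_rank k) \<and> real_rooted p"
    using aug_chow_hilbert_uniform real_rooted_E_refined by metis
qed

end
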